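(* Let $\mathcal S_{k,\ell}(x)=\sum_{n\le x}\Lambda_k(n)\Lambda_\ell(n)$. If $k>\ell\ge1$ are integers, then $\mathcal S_{k,\ell}(x)\ll x\log^{k+\ell-2}x$. If $k\ge1$, then $$\mathcal S_{k,k}(x)=\frac{k!}{(2k-1)!}\,x\log^{2k-1}x+O(x\log^{2k-2}x).$$ Implied constants may depend on $k,\ell$.
   Context: For $j\ge0$, $\Lambda_j$ is defined by $\big(-\frac{\zeta'}{\zeta}(s)\big)^j=\sum_{n\ge1}\Lambda_j(n)n^{-s}$ for $\mathrm{Re}(s)>1$; equivalently $\Lambda_j$ is the $j$-fold Dirichlet convolution of the von Mangoldt function $\Lambda$, with $\Lambda_0(1)=1$ and $\Lambda_0(n)=0$ for $n>1$. *)

theory Defs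
  imports
    Complex_Main
    "HOL-Library.Landau_Symbols"
    "HOL-Number_Theory.Prime_Powers"
begin

text \<open>
  Arithmetic functions are functions on \<^typ>\<open>nat\<close> whose value at \<open>0\<close> plays no role: the
  set of divisors of \<open>0\<close> is infinite, so the convolution is \<open>0\<close> there.
\<close>

definition dirichlet_conv :: "(nat \<Rightarrow> real) \<Rightarrow> (nat \<Rightarrow> real) \<Rightarrow> nat \<Rightarrow> real" where
  "dirichlet_conv f g n = (\<Sum>d | d dvd n. f d * g (n div d))"

text \<open>
  The function \<open>\<Lambda>\<^sub>j\<close>, the coefficients of \<open>(- \<zeta>' / \<zeta>) ^ j\<close>: the \<open>j\<close>-fold Dirichlet
  convolution power of \<^const>\<open>mangoldt\<close>. (This is not the generalized von Mangoldt function
  \<open>\<mu> * log ^ j\<close>, for which the same notation is common.)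
\<close>

primrec mangoldt_pow :: "nat \<Rightarrow> nat \<Rightarrow> real" where
  "mangoldt_pow 0 = (\<lambda>n. if n = 1 then 1 else 0)"
| "mangoldt_pow (Suc j) = dirichlet_conv mangoldt (mangoldt_pow j)"

definition mangoldt_corr :: "nat \<Rightarrow> nat \<Rightarrow> real \<Rightarrow> real" where
  "mangoldt_corr k l x = (\<Sum>n | n \<ge> 1 \<and> real n \<le> x. mangoldt_pow k n * mangoldt_pow l n)"

lemma finite_mangoldt_corr_range: "finite {n::nat. n \<ge> 1 \<and> real n \<le> x}"
  by (rule finite_subset[of _ "{..nat \<lfloor>x\<rfloor>}"]) (auto simp: le_nat_floor)

lemma mangoldt_pow_1: "mangoldt_pow 1 n = mangoldt n"
proof (cases "n = 0")
  case True
  then show ?thesis by (simp add: dirichlet_conv_def)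
next
  case False
  have "(\<Sum>d | d dvd n. mangoldt d * (if n div d = 1 then 1 else 0))
      = (\<Sum>d | d dvd n. if d = n then mangoldt n else (0::real))"
    using False by (intro sum.cong) auto
  also have "\<dots> = mangoldt n"
    using False by (subst sum.delta) auto
  finally show ?thesis by (simp add: dirichlet_conv_def)
qed

end

theory Submission
  imports
    Defs
    "HOL-Computational_Algebra.Squarefree"
    "HOL-Probability.Probability"
    "HOL-Complex_Analysis.Complex_Analysis"
    "HOL-Real_Asymp.Real_Asymp"
begin

text \<open>
  If \<open>n\<close> is squarefree then \<open>\<Lambda>\<^sub>k(n)\<close> is \<open>k!\<close> times the product of \<open>ln p\<close> over the primes \<open>p\<close>
  dividing \<open>n\<close> when there are exactly \<open>k\<close> of them, and \<open>0\<close> otherwise. Hence \<open>\<Lambda>\<^sub>k \<Lambda>\<^sub>l\<close> vanishes on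
  squarefree numbers for \<open>k \<noteq> l\<close>, and \<open>\<Lambda>\<^sub>k\<^sup>2\<close> is there \<open>k!\<close> times the \<open>k\<close>-fold convolution power of
  \<open>\<Lambda>\<^sup>2\<close>. Numbers that are not squarefree are negligible: if \<open>q\<close> is the \<open>p\<close>-part of \<open>n\<close> then
  \<open>\<Lambda>\<^sub>k(n) \<le> k ln q ln\<^sup>k\<^sup>-\<^sup>1 n\<close>, and the sum of \<open>ln\<^sup>2 q / q\<close> over the proper prime powers \<open>q\<close> converges.
  The summatory function of the convolution powers of \<open>\<Lambda>\<^sup>2\<close> follows by induction and partial
  summation from the sum of \<open>\<Lambda>(n)\<^sup>2\<close> over \<open>n \<le> x\<close>, which is \<open>x ln x + O(x)\<close>.

  The last estimate is as deep as the prime number theorem with error \<open>O(x / ln x)\<close>. It comes from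
  the bound \<open>O((2 + \<bar>t\<bar>)\<^sup>1\<^sup>/\<^sup>2)\<close> for the second derivative of \<open>- \<zeta>' / \<zeta> - \<zeta>\<close>, uniform for
  \<open>1 < \<sigma> \<le> 2\<close>, which rests on the inequality \<open>3 + 4 cos \<theta> + cos 2\<theta> \<ge> 0\<close>. Levy's inversion formula,
  applied to an exponential distribution, turns this bound into an estimate for smoothed sums of
  \<open>(\<Lambda>(n) - 1) ln\<^sup>2 n\<close>, and the positivity of \<open>\<Lambda>\<close> removes the smoothing.
\<close>

section \<open>Convolution powers\<close>

text \<open>Two derivatives are the least number for which this smoothing suffices. Smoothing over
  the range from x to x * e^h costs O(x / h), and undoing it for weights ln^j n costs O(h * x * ln^j
  x). The best h gives x * ln^(j/2) x, and dividing the weights back down to ln n by partial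
  summation leaves x * ln^(1 - j/2) x: the required O(x) first appears at j = 2, with h = 1 / ln x.
  The zeta function is estimated only at Re s > 1. As sigma = 1 + 1 / ln x loses just a constant
  factor in x^sigma, no boundary values on Re s = 1, no zero-free region to the left of it and no
  contour shift enter; the continuation serves for Cauchy's bounds on derivatives. Losses in the
  analytic part are counted in powers of \<open>small s\<close> = (2 + |t|)^(1/30). The inversion
  kernel decays like 1 / t^2, so any exponent below 1 would be integrable; a quotient of a
  derivative by the function costs \<open>small s ^ 5\<close>, the worst product has three of them,
  and 15 / 30 = 1/2.\<close>

primrec conv_pow :: "(nat \<Rightarrow> real) \<Rightarrow> nat \<Rightarrow> nat \<Rightarrow> real" where
  "conv_pow f 0 = (\<lambda>n. if n = 1 then 1 else 0)"
| "conv_pow f (Suc k) = dirichlet_conv f (conv_pow f k)"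

lemma mangoldt_pow_eq: "mangoldt_pow k = conv_pow mangoldt k"
  by (induction k) simp_all

lemma conv_pow_nonneg:
  assumes "\<And>n. f n \<ge> 0"
  shows "conv_pow f k n \<ge> 0"
  by (induction k arbitrary: n) (auto simp: dirichlet_conv_def intro!: sum_nonneg mult_nonneg_nonneg assms)

text \<open>Each factor of the convolution contributes at most one full divisor sum. The exponent
  \<open>r\<close> is 1 for \<open>mangoldt\<close> and 2 for its square, so that one proof serves
  both.\<close>

lemma conv_pow_le:
  fixes f :: "nat \<Rightarrow> real"
  assumes f: "\<And>n. f n \<ge> 0" and sum: "\<And>n. n > 0 \<Longrightarrow> (\<Sum>d | d dvd n. f d) \<le> ln (real n) ^ r"
  shows "n > 0 \<Longrightarrow> conv_pow f k n \<le> ln (real n) ^ (r * k)"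
proof (induction k arbitrary: n)
  case 0
  then show ?case by auto
next
  case (Suc k)
  have "conv_pow f (Suc k) n = (\<Sum>d | d dvd n. f d * conv_pow f k (n div d))"
    by (simp add: dirichlet_conv_def)
  also have "\<dots> \<le> (\<Sum>d | d dvd n. f d * ln (real n) ^ (r * k))"
  proof (intro sum_mono mult_left_mono f)
    fix d assume d: "d \<in> {d. d dvd n}"
    then have "n div d > 0" using Suc.prems by (auto elim!: dvdE)
    then have "conv_pow f k (n div d) \<le> ln (real (n div d)) ^ (r * k)" by (intro Suc.IH)
    also have "\<dots> \<le> ln (real n) ^ (r * k)"
      using \<open>n div d > 0\<close> Suc.prems by (intro power_mono) auto
    finally show "conv_pow f k (n div d) \<le> ln (real n) ^ (r * k)" .
  qed
  also have "\<dots> = (\<Sum>d | d dvd n. f d) * ln (real n) ^ (r * k)"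
    by (simp add: sum_distrib_right)
  also have "\<dots> \<le> ln (real n) ^ r * ln (real n) ^ (r * k)"
    using Suc.prems by (intro mult_right_mono sum) auto
  finally show ?case by (simp add: power_add)
qed

text \<open>In a product of k factors equal to n, the prime p divides one of them: there are k
  choices, the sum over that factor is bounded by the p-part alone, and each of the other k - 1
  factors gives at most \<open>ln n ^ r\<close>. The induction asks whether p divides the first
  factor.\<close>

lemma conv_pow_le_prime_part:
  fixes f :: "nat \<Rightarrow> real"
  assumes f: "\<And>n. f n \<ge> 0" and sum: "\<And>n. n > 0 \<Longrightarrow> (\<Sum>d | d dvd n. f d) \<le> ln (real n) ^ r"
    and psum: "\<And>n::nat. n > 0 \<Longrightarrow> (\<Sum>d | d dvd n \<and> p dvd d. f d) \<le> ln (real (p ^ multiplicity p n)) ^ r"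
    and p: "prime (p::nat)"
  shows "n > 0 \<Longrightarrow> p dvd n \<Longrightarrow> conv_pow f k n \<le> k * ln (real (p ^ multiplicity p n)) ^ r * ln (real n) ^ (r * (k - 1))"
proof (induction k arbitrary: n)
  case 0
  then show ?case using p by auto
next
  case (Suc k)
  let ?q = "ln (real (p ^ multiplicity p n))"
  have ln0: "ln (real n) \<ge> 0" using Suc.prems by simp
  have q0: "?q \<ge> 0" using prime_gt_0_nat[OF p] by (simp add: ln_realpow)
  have "conv_pow f (Suc k) n = (\<Sum>d | d dvd n. f d * conv_pow f k (n div d))"
    by (simp add: dirichlet_conv_def)
  also have "\<dots> = (\<Sum>d | d dvd n \<and> p dvd d. f d * conv_pow f k (n div d)) +
                   (\<Sum>d | d dvd n \<and> \<not>p dvd d. f d * conv_pow f k (n div d))"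
    using Suc.prems by (subst sum.union_disjoint [symmetric]) (auto intro!: sum.cong)
  also have "(\<Sum>d | d dvd n \<and> p dvd d. f d * conv_pow f k (n div d)) \<le>
             (\<Sum>d | d dvd n \<and> p dvd d. f d * ln (real n) ^ (r * k))"
  proof (intro sum_mono mult_left_mono f)
    fix d assume d: "d \<in> {d. d dvd n \<and> p dvd d}"
    then have "n div d > 0" using Suc.prems by (auto elim!: dvdE)
    then have "conv_pow f k (n div d) \<le> ln (real (n div d)) ^ (r * k)" by (intro conv_pow_le[OF f sum])
    also have "\<dots> \<le> ln (real n) ^ (r * k)"
      using \<open>n div d > 0\<close> Suc.prems by (intro power_mono) auto
    finally show "conv_pow f k (n div d) \<le> ln (real n) ^ (r * k)" .
  qed
  also have "\<dots> = (\<Sum>d | d dvd n \<and> p dvd d. f d) * ln (real n) ^ (r * k)"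
    by (simp add: sum_distrib_right)
  also have "\<dots> \<le> ?q ^ r * ln (real n) ^ (r * k)"
    using Suc.prems by (intro mult_right_mono psum) auto
  also have "(\<Sum>d | d dvd n \<and> \<not>p dvd d. f d * conv_pow f k (n div d)) \<le>
             (\<Sum>d | d dvd n \<and> \<not>p dvd d. f d * (k * ?q ^ r * ln (real n) ^ (r * (k - 1))))"
  proof (intro sum_mono mult_left_mono f)
    fix d assume d: "d \<in> {d. d dvd n \<and> \<not>p dvd d}"
    then obtain e where e: "n = d * e" by (auto elim!: dvdE)
    have e0: "e > 0" "d > 0" using Suc.prems e by auto
    have pe: "p dvd e" using d Suc.prems p e by (auto simp: prime_dvd_mult_iff)
    \<comment> \<open>As p does not divide d, the whole p-part of n lies in e, and the induction
      hypothesis speaks of the same prime power.\<close>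
    have "multiplicity p n = multiplicity p d + multiplicity p e"
      using e e0 p by (auto simp: prime_elem_multiplicity_mult_distrib)
    also have "multiplicity p d = 0" using d by (auto intro: not_dvd_imp_multiplicity_0)
    finally have m: "multiplicity p e = multiplicity p n" by simp
    have "conv_pow f k e \<le> k * ln (real (p ^ multiplicity p e)) ^ r * ln (real e) ^ (r * (k - 1))"
      using e0 pe by (intro Suc.IH)
    also have "\<dots> \<le> k * ?q ^ r * ln (real n) ^ (r * (k - 1))"
      using e0 e q0 by (auto simp: m ln_mult intro!: mult_left_mono power_mono mult_nonneg_nonneg)
    finally show "conv_pow f k (n div d) \<le> k * ?q ^ r * ln (real n) ^ (r * (k - 1))" using e e0 by simp
  qed
  also have "\<dots> = (\<Sum>d | d dvd n \<and> \<not>p dvd d. f d) * (k * ?q ^ r * ln (real n) ^ (r * (k - 1)))"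
    by (simp add: sum_distrib_right)
  also have "\<dots> \<le> ln (real n) ^ r * (k * ?q ^ r * ln (real n) ^ (r * (k - 1)))"
  proof (intro mult_right_mono)
    have "(\<Sum>d | d dvd n \<and> \<not>p dvd d. f d) \<le> (\<Sum>d | d dvd n. f d)"
      using Suc.prems f by (intro sum_mono2) auto
    also have "\<dots> \<le> ln (real n) ^ r" using Suc.prems by (intro sum)
    finally show "(\<Sum>d | d dvd n \<and> \<not>p dvd d. f d) \<le> ln (real n) ^ r" .
  qed (use ln0 q0 in auto)
  \<comment> \<open>In the case k = 0, where \<open>k - 1\<close> is truncated, the factor k makes
    both sides vanish.\<close>
  also have "\<dots> = k * ?q ^ r * ln (real n) ^ (r * k)"
    by (cases k) (auto simp: power_add)
  finally show ?case by (simp add: algebra_simps)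
qed

lemma mangoldt_sum_prime_part:
  assumes p: "prime (p::nat)" and n: "n > 0"
  shows "(\<Sum>d | d dvd n \<and> p dvd d. mangoldt d) = ln (real (p ^ multiplicity p n))"
proof -
  let ?m = "multiplicity p n"
  have "(\<Sum>d | d dvd n \<and> p dvd d. mangoldt d) = (\<Sum>d\<in>(\<lambda>i. p ^ i) ` {1..?m}. mangoldt d :: real)"
  proof (rule sum.mono_neutral_right)
    show "finite {d. d dvd n \<and> p dvd d}" using n by simp
    show "(\<lambda>i. p ^ i) ` {1..?m} \<subseteq> {d. d dvd n \<and> p dvd d}"
      using p n by (auto intro: multiplicity_dvd' dvd_power)
    show "\<forall>d\<in>{d. d dvd n \<and> p dvd d} - (\<lambda>i. p ^ i) ` {1..?m}. mangoldt d = (0::real)"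
    proof safe
      fix d assume d: "d dvd n" "p dvd d" "d \<notin> (\<lambda>i. p ^ i) ` {1..?m}"
      show "mangoldt d = (0::real)"
      proof (cases "primepow d")
        case True
        then obtain q k where q: "prime q" "k > 0" "d = q ^ k" by (auto simp: primepow_def)
        then have "p = q" using d p by (metis prime_dvd_power primes_dvd_imp_eq)
        then have "k \<le> ?m" using d q n p
          by (simp add: prime_nat_iff  power_dvd_iff_le_multiplicity)
        then show ?thesis using d q \<open>p = q\<close> by auto
      qed (simp add: mangoldt_def)
    qed
  qed
  also have "\<dots> = (\<Sum>i=1..?m. mangoldt (p ^ i))"
    using prime_gt_1_nat[OF p] by (subst sum.reindex) (auto simp: inj_on_def)
  also have "\<dots> = (\<Sum>i=1..?m. ln (real p))" using p by (intro sum.cong) auto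
  also have "\<dots> = ln (real (p ^ ?m))" using prime_gt_0_nat[OF p] by (simp add: ln_realpow)
  finally show ?thesis .
qed

lemma sum_squares_le_square_sum:
  fixes f :: "'a \<Rightarrow> real"
  assumes "finite A" "\<And>x. x \<in> A \<Longrightarrow> f x \<ge> 0"
  shows "(\<Sum>x\<in>A. f x ^ 2) \<le> (\<Sum>x\<in>A. f x) ^ 2"
proof -
  have "(\<Sum>x\<in>A. f x ^ 2) \<le> (\<Sum>x\<in>A. f x * (\<Sum>y\<in>A. f y))"
    unfolding power2_eq_square using assms by (intro sum_mono mult_left_mono member_le_sum) auto
  then show ?thesis by (simp add: sum_distrib_right power2_eq_square)
qed

abbreviation mangoldt_sq :: "nat \<Rightarrow> real" where
  "mangoldt_sq \<equiv> \<lambda>n. mangoldt n ^ 2"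

lemma mangoldt_pow_le_prime_part:
  assumes p: "prime (p::nat)" and n: "n > 0" "p dvd n"
  shows "mangoldt_pow k n \<le> k * ln (real (p ^ multiplicity p n)) * ln (real n) ^ (k - 1)"
  using conv_pow_le_prime_part[OF _ _ _ p n, of mangoldt 1 k] mangoldt_sum_prime_part[OF p]
  by (simp add: mangoldt_pow_eq mangoldt_sum mangoldt_nonneg del: of_nat_power)

lemma mangoldt_sq_pow_le_prime_part:
  assumes p: "prime (p::nat)" and n: "n > 0" "p dvd n"
  shows "conv_pow mangoldt_sq k n \<le> k * ln (real (p ^ multiplicity p n)) ^ 2 * ln (real n) ^ (2 * (k - 1))"
proof (rule conv_pow_le_prime_part[OF _ _ _ p n])
  fix m :: nat assume m: "m > 0"
  have "(\<Sum>d | d dvd m. mangoldt_sq d) \<le> (\<Sum>d | d dvd m. mangoldt d) ^ 2"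
    using m by (intro sum_squares_le_square_sum mangoldt_nonneg) auto
  then show "(\<Sum>d | d dvd m. mangoldt_sq d) \<le> ln (real m) ^ 2" using m by (simp add: mangoldt_sum)
  have "(\<Sum>d | d dvd m \<and> p dvd d. mangoldt_sq d) \<le> (\<Sum>d | d dvd m \<and> p dvd d. mangoldt d) ^ 2"
    using m by (intro sum_squares_le_square_sum mangoldt_nonneg) auto
  then show "(\<Sum>d | d dvd m \<and> p dvd d. mangoldt_sq d) \<le> ln (real (p ^ multiplicity p m)) ^ 2"
    using mangoldt_sum_prime_part[OF p m] by simp
qed auto

text \<open>The only prime powers dividing a squarefree n are its prime factors. Hence the ordered
  factorizations of n into k prime powers are the orderings of its primes, k! of them if there are k
  primes and none otherwise.\<close>

lemma conv_pow_squarefree: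
  fixes f :: "nat \<Rightarrow> real"
  assumes f: "\<And>n. \<not>primepow n \<Longrightarrow> f n = 0"
  shows "squarefree n \<Longrightarrow> conv_pow f k n =
    (if card (prime_factors n) = k then fact k * (\<Prod>p\<in>prime_factors n. f p) else 0)"
proof (induction k arbitrary: n)
  case 0
  then have "n > 0" using not_squarefree_0 by (cases n) auto
  then have "prime_factors n = {} \<longleftrightarrow> n = 1"
    by (auto simp: prime_factorization_empty_iff)
  then show ?case by (auto simp: card_eq_0_iff)
next
  case (Suc k)
  have n0: "n > 0" using Suc.prems not_squarefree_0 by (cases n) auto
  have "conv_pow f (Suc k) n = (\<Sum>d | d dvd n. f d * conv_pow f k (n div d))"
    by (simp add: dirichlet_conv_def)
  also have "\<dots> = (\<Sum>d\<in>prime_factors n. f d * conv_pow f k (n div d))"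
  proof (rule sum.mono_neutral_right)
    show "\<forall>d\<in>{d. d dvd n} - prime_factors n. f d * conv_pow f k (n div d) = 0"
    proof safe
      fix d assume d: "d dvd n" "d \<notin> prime_factors n"
      have "\<not>primepow d"
      proof
        assume "primepow d"
        then obtain q j where q: "prime q" "j > 0" "d = q ^ j" by (auto simp: primepow_def)
        have "squarefree (q ^ j)" using q d Suc.prems squarefree_mono by blast
        then have "j = 1" using q by (auto simp: squarefree_power_iff)
        then show False using q d n0 by (auto simp: prime_factors_dvd)
      qed
      then show "f d * conv_pow f k (n div d) = 0" by (simp add: f)
    qed
  qed (use n0 in \<open>auto simp: prime_factors_dvd\<close>)
  \<comment> \<open>The summand turns out not to depend on p; adding it over the
    \<open>Suc k\<close> primes makes \<open>fact k\<close> into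
    \<open>fact (Suc k)\<close>.\<close>
  also have "\<dots> = (\<Sum>p\<in>prime_factors n. if card (prime_factors n) = Suc k
                      then fact k * (\<Prod>p\<in>prime_factors n. f p) else 0)"
  proof (intro sum.cong refl)
    fix p assume p: "p \<in> prime_factors n"
    then obtain m where m: "n = p * m" by (auto elim!: dvdE simp: prime_factors_dvd)
    have pp: "prime p" using p by auto
    have m0: "m > 0" using n0 m by auto
    have sm: "squarefree m" using Suc.prems m by (metis dvd_triv_right squarefree_mono)
    have "\<not>p dvd m"
    proof
      assume "p dvd m"
      then have "p ^ 2 dvd n" using m by (auto simp: power2_eq_square)
      then show False using Suc.prems pp by (auto simp: squarefree_def)
    qed
    then have pm: "p \<notin> prime_factors m" by auto
    have pn: "prime_factors n = insert p (prime_factors m)"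
      using m m0 pp by (auto simp: prime_factors_product prime_factorization_prime)
    show "f p * conv_pow f k (n div p) = (if card (prime_factors n) = Suc k
                      then fact k * (\<Prod>p\<in>prime_factors n. f p) else 0)"
      using Suc.IH[OF sm] pm m pp unfolding pn by (auto simp: prime_gt_0_nat)
  qed
  finally show ?case by simp
qed

lemma mangoldt_pow_sq_squarefree:
  assumes "squarefree n"
  shows "mangoldt_pow k n * mangoldt_pow k n = fact k * conv_pow mangoldt_sq k n"
proof -
  have 1: "mangoldt_pow k n = (if card (prime_factors n) = k then fact k * (\<Prod>p\<in>prime_factors n. mangoldt p) else 0)"
    unfolding mangoldt_pow_eq by (intro conv_pow_squarefree assms) (simp add: mangoldt_def)
  have 2: "conv_pow mangoldt_sq k n = (if card (prime_factors n) = k then fact k * (\<Prod>p\<in>prime_factors n. mangoldt_sq p) else 0)"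
    by (intro conv_pow_squarefree assms) (simp add: mangoldt_def)
  show ?thesis unfolding 1 2 by (simp add: prod_power_distrib power2_eq_square flip: prod.distrib)
qed

lemma mangoldt_pow_mult_squarefree:
  assumes "squarefree n" "k \<noteq> l"
  shows "mangoldt_pow k n * mangoldt_pow l n = 0"
  using conv_pow_squarefree[of mangoldt n k] conv_pow_squarefree[of mangoldt n l] assms
  by (auto simp: mangoldt_pow_eq mangoldt_def)

section \<open>Numbers that are not squarefree\<close>

abbreviation proper_prime_powers :: "nat set" where
  "proper_prime_powers \<equiv> {p ^ a |p a. prime (p::nat) \<and> a \<ge> 2}"

text \<open>Since \<open>ln q\<close> is at most 8 q^(1/8), the term for q = p^a is at most 64
  q^(-3/4), a geometric progression in a with ratio at most 2^(-3/4). Starting at a = 2 it sums to a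
  multiple of p^(-3/2), which is summable over all integers p.\<close>

lemma sum_ln_sq_proper_prime_powers:
  obtains C :: real where "C \<ge> 0"
    "\<And>Q. finite Q \<Longrightarrow> Q \<subseteq> proper_prime_powers \<Longrightarrow> (\<Sum>q\<in>Q. ln (real q) ^ 2 / q) \<le> C"
proof -
  define u where "u = (\<lambda>p::nat. real p powr (-3/4))"
  define r :: real where "r = 2 powr (-3/4)"
  define Z where "Z = (\<Sum>p::nat. real p powr (-3/2))"
  have r: "0 < r" "r < 1" unfolding r_def by (auto simp: powr_less_one)
  have sm: "summable (\<lambda>p::nat. real p powr (-3/2))" by (simp add: summable_real_powr_iff)
  have Z0: "Z \<ge> 0" unfolding Z_def by (intro suminf_nonneg sm) auto
  show ?thesis
  proof (rule that[of "64 * (Z / (1 - r))"])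
    show "64 * (Z / (1 - r)) \<ge> 0" using Z0 r by simp
    fix Q :: "nat set" assume Q: "finite Q" "Q \<subseteq> proper_prime_powers"
    define M where "M = Max (insert 2 Q)"
    have M: "q \<le> M" if "q \<in> Q" for q using that Q unfolding M_def by simp
    let ?P = "{2..M} \<times> {2..M}"
    have sub: "Q \<subseteq> (\<lambda>(p,a). p ^ a) ` ?P"
    proof
      fix q assume q: "q \<in> Q"
      then obtain p a where pa: "prime p" "a \<ge> 2" "q = p ^ a" using Q by auto
      have p2: "p \<ge> 2" using pa prime_ge_2_nat by auto
      have "p \<le> q" using pa p2 by (simp add: self_le_power)
      moreover have "a \<le> q"
      proof -
        have "a \<le> 2 ^ a" by (simp add: less_imp_le)
        also have "\<dots> \<le> p ^ a" by (rule power_mono[OF p2]) simp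
        finally show ?thesis using pa by simp
      qed
      ultimately have "(p, a) \<in> ?P" using M[OF q] pa(2) p2 by simp
      then show "q \<in> (\<lambda>(p,a). p ^ a) ` ?P" using pa(3) by force
    qed
    have "(\<Sum>q\<in>Q. ln (real q) ^ 2 / q) \<le> (\<Sum>q\<in>(\<lambda>(p,a). p ^ a) ` ?P. ln (real q) ^ 2 / q)"
      by (intro sum_mono2 sub) auto
    \<comment> \<open>On the box the base runs over all integers, so the map is not injective; the
      terms are nonnegative, and counting some q repeatedly only enlarges the sum.\<close>
    also have "\<dots> \<le> (\<Sum>x\<in>?P. ln (real (case x of (p,a) \<Rightarrow> p ^ a)) ^ 2 / (case x of (p,a) \<Rightarrow> p ^ a))"
      using sum_image_le[of ?P "\<lambda>q. ln (real q) ^ 2 / q" "\<lambda>(p,a). p ^ a"] by (simp add: o_def case_prod_unfold)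
    also have "\<dots> \<le> (\<Sum>x\<in>?P. 64 * u (fst x) ^ snd x)"
    proof (rule sum_mono)
      fix x assume "x \<in> ?P"
      then obtain p a where x: "x = (p, a)" and p: "p \<ge> 2" and a: "a \<ge> 2" by auto
      define q where "q = p ^ a"
      have q1: "real q \<ge> 1" using p by (simp add: q_def Suc_leI)
      have "ln (real q) \<le> real q powr (1/8) / (1/8)" using q1 by (intro ln_powr_bound) auto
      then have "ln (real q) ^ 2 \<le> (real q powr (1/8) / (1/8)) ^ 2" using q1 by (intro power_mono) auto
      also have "\<dots> = 64 * real q powr (1/4)"
        by (simp add: power2_eq_square flip: powr_add)
      finally have "ln (real q) ^ 2 / q \<le> 64 * real q powr (1/4) / q" using q1 by (intro divide_right_mono) auto
      also have "\<dots> = 64 * real q powr (1/4 - 1)" using q1 by (subst powr_diff) simp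
      also have "(1/4 - 1 :: real) = -3/4" by simp
      also have "real q powr (-3/4) = (real p powr real a) powr (-3/4)" using p by (simp add: powr_realpow q_def)
      also have "\<dots> = (real p powr (-3/4)) powr real a" by (simp only: powr_powr mult.commute)
      also have "\<dots> = u p ^ a" using p by (simp add: powr_realpow u_def)
      finally show "ln (real (case x of (p, a) \<Rightarrow> p ^ a)) ^ 2 / real (case x of (p, a) \<Rightarrow> p ^ a) \<le> 64 * u (fst x) ^ snd x"
        by (simp add: q_def x)
    qed
    also have "\<dots> = 64 * (\<Sum>p\<in>{2..M}. \<Sum>a\<in>{2..M}. u p ^ a)"
      by (simp add: sum_distrib_left sum.cartesian_product case_prod_unfold)
    also have "\<dots> \<le> 64 * (\<Sum>p\<in>{2..M}. real p powr (-3/2) / (1 - r))"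
    proof (intro mult_left_mono sum_mono)
      fix p assume "p \<in> {2..M}"
      then have p: "p \<ge> 2" by auto
      have u: "0 \<le> u p" "u p \<le> r" unfolding u_def r_def using p by (auto intro!: powr_mono2')
      have "(\<Sum>a\<in>{2..M}. u p ^ a) \<le> u p ^ 2 / (1 - u p)"
        using u r by (cases "2 \<le> M") (auto simp: sum_gp divide_right_mono)
      also have "\<dots> \<le> u p ^ 2 / (1 - r)" using u r by (intro divide_left_mono) auto
      also have "u p ^ 2 = real p powr (-3/2)" by (simp add: u_def power2_eq_square flip: powr_add)
      finally show "(\<Sum>a\<in>{2..M}. u p ^ a) \<le> real p powr (-3/2) / (1 - r)" .
    qed auto
    also have "\<dots> = 64 * ((\<Sum>p\<in>{2..M}. real p powr (-3/2)) / (1 - r))" by (simp add: sum_divide_distrib)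
    also have "\<dots> \<le> 64 * (Z / (1 - r))"
      unfolding Z_def using r by (intro mult_left_mono divide_right_mono sum_le_suminf sm) auto
    finally show "(\<Sum>q\<in>Q. ln (real q) ^ 2 / q) \<le> 64 * (Z / (1 - r))" .
  qed
qed

lemma card_multiples_le:
  assumes "q > 0"
  shows "real (card {n\<in>{1..N}. q dvd n}) \<le> real N / real q"
proof -
  have "{n\<in>{1..N}. q dvd n} \<subseteq> (\<lambda>m. q * m) ` {1..N div q}"
  proof
    fix n assume "n \<in> {n\<in>{1..N}. q dvd n}"
    then obtain m where m: "n = q * m" "1 \<le> n" "n \<le> N" by auto
    then have "m \<in> {1..N div q}" using assms by (auto simp: less_eq_div_iff_mult_less_eq mult.commute Suc_le_eq intro!: Nat.gr0I)
    then show "n \<in> (\<lambda>m. q * m) ` {1..N div q}" using m by auto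
  qed
  then have "card {n\<in>{1..N}. q dvd n} \<le> card ((\<lambda>m. q * m) ` {1..N div q})" by (intro card_mono) auto
  also have "\<dots> \<le> N div q" using card_image_le[of "{1..N div q}" "\<lambda>m. q * m"] by simp
  finally have "real (card {n\<in>{1..N}. q dvd n}) \<le> real (N div q)" by simp
  also have "\<dots> \<le> real N / real q" by (simp add: of_nat_div_le_of_nat) 
  finally show ?thesis .
qed

abbreviation nonsqfree :: "nat \<Rightarrow> nat set" where
  "nonsqfree N \<equiv> {n \<in> {1..N}. \<not>squarefree n}"

text \<open>Choose for each such n a prime whose square divides it, and group the n by the
  corresponding prime part q, a proper prime power. At most N / q numbers belong to q, and
  \<open>ln q ^ 2 / q\<close> has a bounded sum.\<close>

lemma sum_nonsquarefree_le:
  obtains C :: real where "C \<ge> 0"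
    "\<And>N h. (\<And>n p. n \<in> {1..N} \<Longrightarrow> prime p \<Longrightarrow> p ^ 2 dvd n \<Longrightarrow> h n \<le> ln (real (p ^ multiplicity p n)) ^ 2) \<Longrightarrow>
       (\<Sum>n\<in>nonsqfree N. h n) \<le> C * real N"
proof -
  obtain C where C: "C \<ge> 0"
    "\<And>Q. finite Q \<Longrightarrow> Q \<subseteq> proper_prime_powers \<Longrightarrow> (\<Sum>q\<in>Q. ln (real q) ^ 2 / q) \<le> C"
    using sum_ln_sq_proper_prime_powers by blast
  show ?thesis
  proof (rule that[OF C(1)])
    fix N :: nat and h :: "nat \<Rightarrow> real"
    assume h: "\<And>n p. n \<in> {1..N} \<Longrightarrow> prime p \<Longrightarrow> p ^ 2 dvd n \<Longrightarrow> h n \<le> ln (real (p ^ multiplicity p n)) ^ 2"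
    define S where "S = nonsqfree N"
    have fS: "finite S" unfolding S_def by simp
    have "\<exists>p. prime p \<and> p ^ 2 dvd n" if "n \<in> S" for n
    proof -
      have "\<not>squarefree n" using that by (simp add: S_def)
      then obtain x where x: "x ^ 2 dvd n" "\<not>is_unit x" by (auto simp only: squarefree_def)
      have "x \<noteq> 1" using x(2) by simp
      then obtain p where p: "prime p" "p dvd x" using prime_factor_nat[OF \<open>x \<noteq> 1\<close>] by auto
      have "p ^ 2 dvd n" using dvd_trans[OF dvd_power_same[OF p(2)] x(1)] .
      then show ?thesis using p by blast
    qed
    then obtain P where P: "\<And>n. n \<in> S \<Longrightarrow> prime (P n) \<and> P n ^ 2 dvd n" by metis
    define q where "q = (\<lambda>n. P n ^ multiplicity (P n) n)"
    have mult: "multiplicity (P n) n \<ge> 2" if "n \<in> S" for n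
      using P[OF that] that by (intro multiplicity_geI) (auto simp: S_def)
    have mem: "q n \<in> proper_prime_powers" if "n \<in> S" for n
      using P[OF that] mult[OF that] unfolding q_def by blast
    have "sum h S \<le> (\<Sum>n\<in>S. ln (real (q n)) ^ 2)"
      unfolding q_def using P by (intro sum_mono h) (auto simp: S_def)
    also have "\<dots> = (\<Sum>y\<in>q ` S. \<Sum>n\<in>{n\<in>S. q n = y}. ln (real (q n)) ^ 2)"
      by (rule sum.image_gen[OF fS])
    also have "\<dots> = (\<Sum>y\<in>q ` S. real (card {n\<in>S. q n = y}) * ln (real y) ^ 2)"
      by (intro sum.cong refl) (simp add: sum.cong)
    also have "\<dots> \<le> (\<Sum>y\<in>q ` S. (real N / real y) * ln (real y) ^ 2)"
    proof (intro sum_mono mult_right_mono)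
      fix y assume y: "y \<in> q ` S"
      have "y > 0" using y P by (auto simp: q_def prime_gt_0_nat)
      have "card {n\<in>S. q n = y} \<le> card {n\<in>{1..N}. y dvd n}"
        by (intro card_mono) (auto simp: S_def q_def multiplicity_dvd)
      then show "real (card {n\<in>S. q n = y}) \<le> real N / real y"
        using card_multiples_le[OF \<open>y > 0\<close>, of N] by linarith
    qed auto
    also have "\<dots> = real N * (\<Sum>y\<in>q ` S. ln (real y) ^ 2 / y)" by (simp add: sum_distrib_left)
    also have "\<dots> \<le> real N * C"
      using fS mem by (intro mult_left_mono C(2)) auto
    finally show "(\<Sum>n\<in>nonsqfree N. h n) \<le> C * real N"
      by (simp add: S_def mult.commute)
  qed
qed

text \<open>Abel summation writes both weighted sums as combinations of partial sums with the same
  coefficients \<open>f n - f (Suc n)\<close> and \<open>f N\<close>, all nonnegative. It is applied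
  with weights \<open>ln (x / n) ^ m / n\<close> and, later, 1 / ln n.\<close>

lemma abel_comparison:
  fixes c g f :: "nat \<Rightarrow> real"
  assumes A: "\<And>n. n \<le> N \<Longrightarrow> \<bar>\<Sum>j=1..n. c j\<bar> \<le> K * (\<Sum>j=1..n. g j)"
    and f: "\<And>n. 1 \<le> n \<Longrightarrow> n < N \<Longrightarrow> f (Suc n) \<le> f n" "\<And>n. n \<in> {1..N} \<Longrightarrow> f n \<ge> 0"
  shows "\<bar>\<Sum>n=1..N. c n * f n\<bar> \<le> K * (\<Sum>n=1..N. g n * f n)"
proof -
  have *: "(\<Sum>n=1..N. c n * f n) = (\<Sum>n\<in>{1..<N}. (\<Sum>j=1..n. c j) * (f n - f (Suc n))) + (\<Sum>j=1..N. c j) * f N" for c N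
  proof (induction N)
    case (Suc N)
    then show ?case by (cases N) (auto simp: algebra_simps sum.atLeastLessThan_Suc)
  qed auto
  have "\<bar>\<Sum>n=1..N. c n * f n\<bar> \<le> \<bar>\<Sum>n\<in>{1..<N}. (\<Sum>j=1..n. c j) * (f n - f (Suc n))\<bar> + \<bar>(\<Sum>j=1..N. c j) * f N\<bar>"
    unfolding * by (rule abs_triangle_ineq)
  also have "\<dots> \<le> (\<Sum>n\<in>{1..<N}. \<bar>(\<Sum>j=1..n. c j) * (f n - f (Suc n))\<bar>) + \<bar>(\<Sum>j=1..N. c j) * f N\<bar>"
    by (intro add_mono sum_abs) auto
  also have "\<dots> \<le> (\<Sum>n\<in>{1..<N}. (K * (\<Sum>j=1..n. g j)) * (f n - f (Suc n))) + (K * (\<Sum>j=1..N. g j)) * f N"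
  proof (intro add_mono sum_mono)
    fix n assume "n \<in> {1..<N}"
    then show "\<bar>(\<Sum>j=1..n. c j) * (f n - f (Suc n))\<bar> \<le> (K * (\<Sum>j=1..n. g j)) * (f n - f (Suc n))"
      using A[of n] f(1)[of n] by (auto simp: abs_mult intro!: mult_right_mono)
  next
    show "\<bar>(\<Sum>j=1..N. c j) * f N\<bar> \<le> (K * (\<Sum>j=1..N. g j)) * f N"
      using A[of N] f(2)[of N] by (cases "N = 0") (auto simp: abs_mult intro!: mult_right_mono)
  qed
  also have "\<dots> = K * (\<Sum>n=1..N. g n * f n)"
    unfolding * by (simp add: sum_distrib_left algebra_simps)
  finally show ?thesis .
qed

lemma sum_inverse_le_ln: "N \<ge> 1 \<Longrightarrow> (\<Sum>d=1..N. 1 / real d) \<le> 1 + ln (real N)"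
proof (induction N rule: nat_induct_at_least)
  case (Suc N)
  have "ln (real N / real (Suc N)) \<le> real N / real (Suc N) - 1"
    using Suc by (intro ln_le_minus_one) auto
  also have "real N / real (Suc N) - 1 = - 1 / real (Suc N)" by (simp add: field_simps)
  finally have "1 / real (Suc N) \<le> ln (real (Suc N)) - ln (real N)"
    using Suc by (simp add: ln_div)
  then show ?case using Suc by simp
qed auto

section \<open>Summatory functions of convolution powers\<close>

text \<open>The main term is the integral of the summand over [1, x]: substituting u = ln t and L =
  ln x, it is the Beta integral of u * (L - u)^m over [0, L]. The derivative of the summand is O((1
  + L)^(m+1) / t^2), so the errors on the unit intervals are summable.\<close>

lemma log_power_sum_asymp:
  fixes m :: nat
  obtains C :: real where "C \<ge> 0" "\<And>x. x \<ge> 1 \<Longrightarrow>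
    \<bar>(\<Sum>n=1..nat \<lfloor>x\<rfloor>. ln (real n) * ln (x / n) ^ m / n) - ln x ^ (m + 2) / ((real m + 1) * (real m + 2))\<bar> \<le> C * (1 + ln x) ^ (m + 1)"
proof -
  define S where "S = (\<Sum>n::nat. 1 / real n ^ 2)"
  have sm: "summable (\<lambda>n::nat. 1 / real n ^ 2)"
    using inverse_power_summable[of 2, where ?'a = real] by (simp add: field_simps)
  have S0: "S \<ge> 0" unfolding S_def by (intro suminf_nonneg sm) auto
  show ?thesis
  proof (rule that[of "2 + S * (m + 2)"])
    fix x :: real assume x: "x \<ge> 1"
    define L N where "L = ln x" and "N = nat \<lfloor>x\<rfloor>"
    have L0: "L \<ge> 0" using x by (simp add: L_def)
    let ?B = "(1 + L) ^ (m + 1)"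
    have N: "N \<ge> 1" "real N \<le> x" "x < real N + 1" using x unfolding N_def by linarith+
    define g where "g = (\<lambda>t. ln t * ln (x / t) ^ m / t)"
    \<comment> \<open>An antiderivative of g, found by parts. Only its second term survives at t = 1
      and gives the main term, while at t = x both vanish.\<close>
    define G where "G = (\<lambda>t. - (ln t * ln (x / t) ^ (m + 1) / (real m + 1) + ln (x / t) ^ (m + 2) / ((real m + 1) * (real m + 2))))"
    define g' where "g' = (\<lambda>t. (ln (x / t) ^ m - m * ln t * ln (x / t) ^ (m - 1) - ln t * ln (x / t) ^ m) / t ^ 2)"
    have G: "(G has_real_derivative g t) (at t)" if "t > 0" for t
    proof -
      have D: "((\<lambda>t. ln (x / t)) has_real_derivative - 1 / t) (at t)"
        using that x by (auto intro!: derivative_eq_intros simp: field_simps power2_eq_square)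
      have D1: "((\<lambda>t. ln (x / t) ^ (m + 1)) has_real_derivative (m + 1) * ln (x / t) ^ m * (- 1 / t)) (at t)"
        by (rule DERIV_cong[OF DERIV_power[OF D, of "m + 1"]]) simp
      have D2: "((\<lambda>t. ln (x / t) ^ (m + 2)) has_real_derivative (m + 2) * ln (x / t) ^ (m + 1) * (- 1 / t)) (at t)"
        by (rule DERIV_cong[OF DERIV_power[OF D, of "m + 2"]]) simp
      have D3: "(ln has_real_derivative 1 / t) (at t)"
        using that by (auto intro!: derivative_eq_intros)
      note X = DERIV_minus[OF DERIV_add[OF DERIV_cdivide[OF DERIV_mult'[OF D3 D1], of "real m + 1"] DERIV_cdivide[OF D2, of "(real m + 1) * (real m + 2)"]]]
      have "- ((ln t * (M * b * (- 1 / t)) + 1 / t * a) / M + N * a * (- 1 / t) / (M * N)) = ln t * b / t"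
        if "M > 0" "N > 0" for a b M N :: real using that \<open>t > 0\<close> by (simp add: field_simps)
      note Y = this[where a = "ln (x / t) ^ (m + 1)" and b = "ln (x / t) ^ m" and M = "real m + 1" and N = "real m + 2"]
      show ?thesis unfolding G_def g_def by (rule DERIV_cong[OF X]) (use Y in \<open>simp add: add.commute\<close>)
    qed
    have g: "(g has_real_derivative g' t) (at t)" if "t > 0" for t
    proof -
      have D: "((\<lambda>t. ln (x / t)) has_real_derivative - 1 / t) (at t)"
        using that x by (auto intro!: derivative_eq_intros simp: field_simps power2_eq_square)
      show ?thesis unfolding g'_def g_def
        using that x by (auto intro!: derivative_eq_intros DERIV_power D simp: divide_simps power2_eq_square)
    qed
    have bd: "0 \<le> ln t \<and> ln t \<le> L \<and> 0 \<le> ln (x / t) \<and> ln (x / t) \<le> L" if "t \<ge> 1" "t \<le> x" for t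
      using that x by (auto simp: L_def ln_div)
    have pw: "L ^ i \<le> ?B" if "i \<le> m + 1" for i
    proof -
      have "L ^ i \<le> (1 + L) ^ i" using L0 by (intro power_mono) auto
      also have "\<dots> \<le> ?B" using L0 that by (intro power_increasing) auto
      finally show ?thesis .
    qed
    have g'_le: "\<bar>g' t\<bar> \<le> (m + 2) * ?B / t ^ 2" if "t \<ge> 1" "t \<le> x" for t
    proof -
      note b = bd[OF that]
      have 1: "\<bar>ln (x / t) ^ m\<bar> \<le> ?B"
        using b pw[of m] power_mono[of "ln (x/t)" L m] by (simp add: power_abs)
      have 2: "\<bar>m * ln t * ln (x / t) ^ (m - 1)\<bar> \<le> m * ?B"
      proof (cases "m = 0")
        case False
        have "ln t * ln (x / t) ^ (m - 1) \<le> L * L ^ (m - 1)"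
          using b by (intro mult_mono power_mono) auto
        also have "\<dots> = L ^ m" using False by (cases m) auto
        also have "\<dots> \<le> ?B" by (rule pw) auto
        finally show ?thesis using b by (simp add: abs_mult mult.assoc mult_left_mono)
      qed auto
      have "ln t * ln (x / t) ^ m \<le> L * L ^ m"
        using b by (intro mult_mono power_mono) auto
      also have "\<dots> \<le> ?B" using pw[of "m + 1"] by simp
      finally have 3: "\<bar>ln t * ln (x / t) ^ m\<bar> \<le> ?B" using b by (simp add: abs_mult)
      have "\<bar>ln (x / t) ^ m - m * ln t * ln (x / t) ^ (m - 1) - ln t * ln (x / t) ^ m\<bar> \<le>
            ?B + m * ?B + ?B"
        using 1 2 3 by linarith
      also have "\<dots> = (m + 2) * ?B" by (simp add: algebra_simps)
      finally show ?thesis unfolding g'_def using that by (simp add: divide_right_mono)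
    qed
    have step: "\<bar>G (real (Suc n)) - G (real n) - g (real n)\<bar> \<le> (m + 2) * ?B * (1 / real n ^ 2)" if "n \<in> {1..<N}" for n
    proof -
      have n: "real n \<ge> 1" "real n + 1 \<le> x" using that N by auto
      \<comment> \<open>Two mean values: first for G, which turns the integral over the unit
        interval into a value of g, then for g, which compares this value with the one at n.\<close>
      obtain \<xi> where \<xi>: "real n < \<xi>" "\<xi> < real n + 1" "G (real n + 1) - G (real n) = (real n + 1 - real n) * g \<xi>"
        using MVT2[of "real n" "real n + 1" G g] G n by auto
      obtain \<eta> where \<eta>: "real n < \<eta>" "\<eta> < \<xi>" "g \<xi> - g (real n) = (\<xi> - real n) * g' \<eta>"
        using MVT2[of "real n" \<xi> g g'] g n \<xi> by auto
      have "\<bar>g \<xi> - g (real n)\<bar> \<le> 1 * ((m + 2) * ?B / \<eta> ^ 2)"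
        unfolding \<eta>(3) abs_mult using \<xi> \<eta> n by (intro mult_mono g'_le) auto
      also have "\<dots> \<le> (m + 2) * ?B / real n ^ 2"
        using \<eta> n L0 by (auto intro!: divide_left_mono power_mono mult_nonneg_nonneg mult_pos_pos)
      finally show ?thesis using \<xi> by (simp add: add.commute)
    qed
    have tel: "(\<Sum>n\<in>{1..<N}. G (real (Suc n)) - G (real n)) = G (real N) - G 1"
      using sum_Suc_diff'[of 1 N "\<lambda>n. G (real n)"] N by simp
    have tel2: "(\<Sum>n\<in>{1..<N}. G (real (Suc n)) - G (real n) - g (real n)) = (G (real N) - G 1) - (\<Sum>n\<in>{1..<N}. g (real n))"
      unfolding tel [symmetric] by (simp add: sum_subtractf)
    have spl: "(\<Sum>n=1..N. g (real n)) = (\<Sum>n\<in>{1..<N}. g (real n)) + g (real N)"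
      using N by (cases N) (simp_all add: atLeastLessThanSuc_atLeastAtMost)
    have "\<bar>(\<Sum>n\<in>{1..<N}. G (real (Suc n)) - G (real n) - g (real n))\<bar> \<le>
          (\<Sum>n\<in>{1..<N}. (m + 2) * ?B * (1 / real n ^ 2))"
      by (intro order.trans[OF sum_abs] sum_mono step)
    also have "\<dots> = (m + 2) * ?B * (\<Sum>n\<in>{1..<N}. 1 / real n ^ 2)" by (simp add: sum_distrib_left)
    also have "\<dots> \<le> (m + 2) * ?B * S" unfolding S_def
      using L0 by (intro mult_left_mono sum_le_suminf sm) auto
    finally have A: "\<bar>(G (real N) - G 1) - (\<Sum>n\<in>{1..<N}. g (real n))\<bar> \<le> (m + 2) * ?B * S"
      unfolding tel2 .
    note bN = bd[of "real N"]
    have "ln (real N) * ln (x / N) ^ m \<le> L * L ^ m"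
      using bN N L0 by (intro mult_mono power_mono) auto
    also have "\<dots> \<le> ?B" using pw[of "m + 1"] by simp
    finally have "ln (real N) * ln (x / N) ^ m / N \<le> ?B / 1"
      using N L0 by (intro frac_le) auto
    then have B: "\<bar>g (real N)\<bar> \<le> ?B" unfolding g_def using bN N by (simp add: abs_mult)
    \<comment> \<open>As x lies within 1 of N, \<open>G N\<close> is O(1 + L) although x need not be
      an integer.\<close>
    have v: "ln (x / N) \<le> 1"
    proof -
      have "ln (x / N) \<le> x / N - 1" using x N by (intro ln_le_minus_one) auto
      also have "\<dots> \<le> 1" using N by (simp add: field_simps)
      finally show ?thesis .
    qed
    have v0: "ln (x / N) \<ge> 0" using bN N by auto
    have "ln (real N) * ln (x / N) ^ (m + 1) / (real m + 1) \<le> L * 1 / 1"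
      using bN N v v0 L0 by (intro frac_le mult_mono power_le_one) auto
    moreover have "ln (x / N) ^ (m + 2) / ((real m + 1) * (real m + 2)) \<le> 1 / 1"
    proof (intro frac_le power_le_one v v0)
      have "(1::real) * 1 \<le> (real m + 1) * (real m + 2)" by (intro mult_mono) auto
      then show "(1::real) \<le> (real m + 1) * (real m + 2)" by simp
    qed auto
    moreover have "0 \<le> ln (real N) * ln (x / N) ^ (m + 1) / (real m + 1)" "0 \<le> ln (x / N) ^ (m + 2) / ((real m + 1) * (real m + 2))"
      using v0 bN N by (auto intro!: divide_nonneg_pos mult_nonneg_nonneg add_pos_pos)
    ultimately have "\<bar>G (real N)\<bar> \<le> 1 + L" unfolding G_def by (simp only: abs_minus_cancel)
    also have "\<dots> \<le> ?B" using L0 by (intro self_le_power) auto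
    finally have C: "\<bar>G (real N)\<bar> \<le> ?B" .
    have G1: "G 1 = - (L ^ (m + 2) / ((real m + 1) * (real m + 2)))" by (simp add: G_def L_def)
    have "\<bar>(\<Sum>n=1..N. g (real n)) - L ^ (m + 2) / ((real m + 1) * (real m + 2))\<bar> \<le>
       (m + 2) * ?B * S + ?B + ?B"
      using A B C unfolding spl G1 by linarith
    also have "\<dots> = (2 + S * (m + 2)) * ?B" by (simp add: algebra_simps)
    finally show "\<bar>(\<Sum>n=1..nat \<lfloor>x\<rfloor>. ln (real n) * ln (x / n) ^ m / n) - ln x ^ (m + 2) / ((real m + 1) * (real m + 2))\<bar> \<le> (2 + S * (m + 2)) * (1 + ln x) ^ (m + 1)"
      unfolding g_def L_def N_def by simp
  qed (use S0 in auto)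
qed

text \<open>Replacing ln n by w costs K times the sum of \<open>ln (x / n) ^ m / n\<close>, because
  these weights decrease in n. That is O(ln^(m+1) x), the size of the error already present.\<close>

lemma weighted_log_power_sum_asymp:
  fixes w :: "nat \<Rightarrow> real" and m :: nat
  assumes w: "\<And>N. \<bar>\<Sum>n=1..N. w n - ln (real n)\<bar> \<le> K * real N"
  obtains C :: real where "C \<ge> 0" "\<And>x. x \<ge> 1 \<Longrightarrow>
    \<bar>(\<Sum>n=1..nat \<lfloor>x\<rfloor>. w n * ln (x / n) ^ m / n) - ln x ^ (m + 2) / ((real m + 1) * (real m + 2))\<bar> \<le> C * (1 + ln x) ^ (m + 1)"
proof -
  obtain C where C: "C \<ge> 0" "\<And>x. x \<ge> 1 \<Longrightarrow>
    \<bar>(\<Sum>n=1..nat \<lfloor>x\<rfloor>. ln (real n) * ln (x / n) ^ m / n) - ln x ^ (m + 2) / ((real m + 1) * (real m + 2))\<bar> \<le> C * (1 + ln x) ^ (m + 1)"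
    by (rule log_power_sum_asymp[of m]) (rule that)
  have K: "K \<ge> 0" using w[of 1] by simp
  show ?thesis
  proof (rule that[of "C + K"])
    fix x :: real assume x: "x \<ge> 1"
    define N where "N = nat \<lfloor>x\<rfloor>"
    have N: "N \<ge> 1" "real N \<le> x" using x unfolding N_def by linarith+
    define f where "f = (\<lambda>n::nat. ln (x / n) ^ m / n)"
    have f0: "f n \<ge> 0" if "n \<in> {1..N}" for n
      unfolding f_def using that N x by (intro divide_nonneg_nonneg zero_le_power ln_ge_zero) auto
    have f_le: "f n \<le> ln x ^ m / n" if "n \<in> {1..N}" for n
    proof -
      have "x / real n \<le> x" "x / real n \<ge> 1" using that x N by (auto simp: field_simps)
      then show ?thesis unfolding f_def using x by (intro divide_right_mono power_mono) auto
    qed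
    have anti: "f (Suc n) \<le> f n" if "1 \<le> n" "n < N" for n
    proof -
      have "1 \<le> x / Suc n" "x / Suc n \<le> x / n" using that x N by (auto simp: field_simps)
      then show ?thesis unfolding f_def using that x
        by (intro frac_le power_mono) (auto intro!: zero_le_power)
    qed
    have "\<bar>\<Sum>n=1..N. (w n - ln (real n)) * f n\<bar> \<le> K * (\<Sum>n=1..N. 1 * f n)"
      by (intro abel_comparison f0 anti) (use w in auto)
    also have "\<dots> \<le> K * (\<Sum>n=1..N. ln x ^ m * (1 / n))"
      using K f_le by (intro mult_left_mono sum_mono) auto
    also have "\<dots> = K * (ln x ^ m * (\<Sum>n=1..N. 1 / n))" by (simp add: sum_distrib_left)
    also have "\<dots> \<le> K * ((1 + ln x) ^ m * (1 + ln x))"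
    proof -
      have "(\<Sum>n=1..N. 1 / real n) \<le> 1 + ln (real N)" using N by (intro sum_inverse_le_ln)
      also have "\<dots> \<le> 1 + ln x" using N by simp
      finally show ?thesis using K x by (intro mult_left_mono mult_mono power_mono sum_nonneg) auto
    qed
    finally have 1: "\<bar>\<Sum>n=1..N. (w n - ln (real n)) * f n\<bar> \<le> K * (1 + ln x) ^ (m + 1)" by (simp add: mult.commute)
    have 2: "(\<Sum>n=1..N. (w n - ln (real n)) * f n) = (\<Sum>n=1..N. w n * ln (x / n) ^ m / n) - (\<Sum>n=1..N. ln (real n) * ln (x / n) ^ m / n)"
      by (simp add: f_def algebra_simps sum_subtractf diff_divide_distrib)
    show "\<bar>(\<Sum>n=1..nat \<lfloor>x\<rfloor>. w n * ln (x / n) ^ m / n) - ln x ^ (m + 2) / ((real m + 1) * (real m + 2))\<bar> \<le> (C + K) * (1 + ln x) ^ (m + 1)"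
      using 1 C(2)[OF x] unfolding 2 N_def[symmetric] by (simp only: distrib_right)
  qed (use C K in auto)
qed

lemma sum_dirichlet_conv:
  "(\<Sum>n=1..nat \<lfloor>x\<rfloor>. dirichlet_conv f g n) = (\<Sum>d=1..nat \<lfloor>x\<rfloor>. f d * (\<Sum>m=1..nat \<lfloor>x / d\<rfloor>. g m))"
proof -
  have mem: "n \<in> {1..nat \<lfloor>y\<rfloor>} \<longleftrightarrow> n \<ge> 1 \<and> real n \<le> y" for n y
    by (auto simp: le_nat_floor) linarith
  have "(\<Sum>n=1..nat \<lfloor>x\<rfloor>. dirichlet_conv f g n) = (\<Sum>(n,d)\<in>(SIGMA n:{1..nat \<lfloor>x\<rfloor>}. {d. d dvd n}). f d * g (n div d))"
    unfolding dirichlet_conv_def by (subst sum.Sigma) auto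
  also have "\<dots> = (\<Sum>(d,m)\<in>(SIGMA d:{1..nat \<lfloor>x\<rfloor>}. {1..nat \<lfloor>x / d\<rfloor>}). f d * g m)"
  proof (rule sum.reindex_bij_witness[of _ "\<lambda>(d,m). (d * m, d)" "\<lambda>(n,d). (d, n div d)"], goal_cases)
    case (2 a)
    then obtain n d where a: "a = (n, d)" "n \<ge> 1" "real n \<le> x" "d dvd n" by (auto simp only: mem mem_Sigma_iff)
    then obtain m where m: "n = d * m" by auto
    then have "d \<ge> 1" "m \<ge> 1" using a by (auto simp: Suc_le_eq intro!: Nat.gr0I)
    moreover have "real d * real m \<le> x" using a m by simp
    moreover have "d \<le> n" using m \<open>m \<ge> 1\<close> by simp
    then have "real d \<le> x" using a(3) by linarith
    ultimately show ?case using a m by (simp only: mem mem_Sigma_iff prod.case) (simp add: field_simps)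
  next
    case (4 b)
    then obtain d m where b: "b = (d, m)" "d \<ge> 1" "m \<ge> 1" "real m \<le> x / d" by (auto simp only: mem mem_Sigma_iff)
    then show ?case by (simp only: mem mem_Sigma_iff prod.case) (simp add: field_simps)
  qed auto
  also have "\<dots> = (\<Sum>d=1..nat \<lfloor>x\<rfloor>. f d * (\<Sum>m=1..nat \<lfloor>x / d\<rfloor>. g m))"
    by (subst sum.Sigma [symmetric]) (auto simp: sum_distrib_left)
  finally show ?thesis .
qed

lemma conv_pow_1: "n > 0 \<Longrightarrow> conv_pow f (Suc 0) n = f n"
proof -
  assume n: "n > 0"
  have "(\<Sum>d | d dvd n. f d * (if n div d = 1 then 1 else 0)) = (\<Sum>d | d dvd n. if d = n then f n else (0::real))"
    using n by (intro sum.cong) auto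
  also have "\<dots> = f n" using n by (subst sum.delta) auto
  finally show ?thesis by (simp add: dirichlet_conv_def)
qed

lemma sum_ln_ge: "(\<Sum>n=1..N. ln (real n)) \<ge> N * ln (real N) - N"
proof (induction N)
  case (Suc N)
  show ?case
  proof (cases "N = 0")
    case False
    have "ln (real (Suc N) / real N) \<le> real (Suc N) / real N - 1"
      using False by (intro ln_le_minus_one) auto
    also have "\<dots> = 1 / real N" using False by (simp add: field_simps)
    finally have "ln (real (Suc N)) - ln (real N) \<le> 1 / real N" using False by (simp add: ln_div)
    then have "real N * (ln (real (Suc N)) - ln (real N)) \<le> 1" using False by (simp add: field_simps)
    then show ?thesis using Suc by (simp add: algebra_simps)
  qed simp
qed simp

lemma sum_ln_asymp:
  assumes x: "x \<ge> 1"
  shows "\<bar>(\<Sum>n=1..nat \<lfloor>x\<rfloor>. ln (real n)) - x * ln x\<bar> \<le> 2 * x"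
proof -
  define N where "N = nat \<lfloor>x\<rfloor>"
  have N: "N \<ge> 1" "real N \<le> x" "x < real N + 1" using x unfolding N_def by linarith+
  have "(\<Sum>n=1..N. ln (real n)) \<le> (\<Sum>n=1..N. ln x)" using N by (intro sum_mono) auto
  also have "\<dots> \<le> x * ln x" using N x by (simp add: mult_right_mono)
  finally have 1: "(\<Sum>n=1..N. ln (real n)) \<le> x * ln x" .
  have "ln (x / N) \<le> x / N - 1" using x N by (intro ln_le_minus_one) auto
  then have "N * (ln x - ln N) \<le> x - N" using x N by (simp add: ln_div field_simps)
  moreover have "(x - N) * ln x \<le> 1 * (x - 1)" using N x ln_le_minus_one[of x] by (intro mult_mono) auto
  ultimately have "x * ln x - N * ln N \<le> x" using N by (simp add: algebra_simps)
  then show ?thesis using 1 sum_ln_ge[of N] N x unfolding N_def[symmetric] by linarith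
qed

text \<open>One more convolution with w replaces x * ln^(2k+1) x / (2k+1)! by x times the sum of
  w(d) / d * ln^(2k+1)(x / d) / (2k+1)!. This adds two logarithms and the divisor (2k+2)(2k+3),
  which completes the factorial. The old error is multiplied by the sum of w(d) / d, which is O(ln^2
  x).\<close>

lemma sum_conv_pow_asymp:
  fixes w :: "nat \<Rightarrow> real"
  assumes w0: "\<And>n. w n \<ge> 0" and w: "\<And>N. \<bar>\<Sum>n=1..N. w n - ln (real n)\<bar> \<le> K * real N"
  shows "\<exists>C\<ge>0. \<forall>x\<ge>1. \<bar>(\<Sum>n=1..nat \<lfloor>x\<rfloor>. conv_pow w (Suc k) n) - x * ln x ^ (2 * k + 1) / fact (2 * k + 1)\<bar> \<le> C * x * (1 + ln x) ^ (2 * k)"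
proof (induction k)
  case 0
  have K: "K \<ge> 0" using w[of 1] by simp
  show ?case
  proof (intro exI[of _ "K + 2"] conjI allI impI)
    fix x :: real assume x: "x \<ge> 1"
    have "(\<Sum>n=1..nat \<lfloor>x\<rfloor>. conv_pow w (Suc 0) n) = (\<Sum>n=1..nat \<lfloor>x\<rfloor>. w n - ln (real n)) + (\<Sum>n=1..nat \<lfloor>x\<rfloor>. ln (real n))"
      unfolding sum.distrib [symmetric] by (intro sum.cong refl) (simp add: conv_pow_1 del: conv_pow.simps)
    moreover have "K * real (nat \<lfloor>x\<rfloor>) \<le> K * x" using x K by (intro mult_left_mono) auto
    ultimately show "\<bar>(\<Sum>n=1..nat \<lfloor>x\<rfloor>. conv_pow w (Suc 0) n) - x * ln x ^ (2 * 0 + 1) / fact (2 * 0 + 1)\<bar> \<le> (K + 2) * x * (1 + ln x) ^ (2 * 0)"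
      using sum_ln_asymp[OF x] w[of "nat \<lfloor>x\<rfloor>"]
      unfolding mult_0_right add_0 power_one_right power_0 mult_1_right fact_1 div_by_1 distrib_right by linarith
  qed (use K in auto)
next
  case (Suc k)
  then obtain B where B: "B \<ge> 0" "\<And>x. x \<ge> 1 \<Longrightarrow>
    \<bar>(\<Sum>n=1..nat \<lfloor>x\<rfloor>. conv_pow w (Suc k) n) - x * ln x ^ (2 * k + 1) / fact (2 * k + 1)\<bar> \<le> B * x * (1 + ln x) ^ (2 * k)"
    by blast
  obtain C where C: "C \<ge> 0" "\<And>x. x \<ge> 1 \<Longrightarrow>
    \<bar>(\<Sum>n=1..nat \<lfloor>x\<rfloor>. w n * ln (x / n) ^ (2*k+1) / n) - ln x ^ (2*k+1 + 2) / ((real (2*k+1) + 1) * (real (2*k+1) + 2))\<bar> \<le> C * (1 + ln x) ^ (2*k+1 + 1)"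
    by (rule weighted_log_power_sum_asymp[OF w, of "2 * k + 1"]) (rule that)
  \<comment> \<open>The case m = 0 is used only as an upper bound for the sum of w(n) / n.\<close>
  obtain D where D: "D \<ge> 0" "\<And>x. x \<ge> 1 \<Longrightarrow>
    \<bar>(\<Sum>n=1..nat \<lfloor>x\<rfloor>. w n * ln (x / n) ^ 0 / n) - ln x ^ (0 + 2) / ((real 0 + 1) * (real 0 + 2))\<bar> \<le> D * (1 + ln x) ^ (0 + 1)"
    by (rule weighted_log_power_sum_asymp[OF w, of 0]) (rule that)
  show ?case
  proof (intro exI[of _ "C + B * (D + 1)"] conjI allI impI)
    fix x :: real assume x: "x \<ge> 1"
    let ?N = "nat \<lfloor>x\<rfloor>" and ?F = "fact (2 * k + 1) :: real"
    define W where "W = (\<lambda>y::real. \<Sum>n=1..nat \<lfloor>y\<rfloor>. conv_pow w (Suc k) n)"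
    have xd: "x / d \<ge> 1" "d \<ge> 1" "x / d \<le> x" if "d \<in> {1..?N}" for d
    proof -
      have "real d \<le> x" using that by auto linarith
      then show "x / d \<ge> 1" "d \<ge> 1" "x / d \<le> x" using that x by (auto simp: field_simps)
    qed
    have L: "ln x \<ge> 0" using x by simp
    let ?m = "x * ln x ^ (2 * Suc k + 1) / fact (2 * Suc k + 1)"
    let ?a = "(2 * real k + 2) * (2 * real k + 3)"
    let ?P = "\<lambda>d. x / d * ln (x / d) ^ (2*k+1) / ?F"
    define M where "M = (\<Sum>n=1..?N. w n * ln (x / n) ^ (2*k+1) / n)"
    have main: "(\<Sum>d=1..?N. w d * (?P d)) = x / ?F * M"
      unfolding M_def by (simp add: sum_distrib_left algebra_simps)
    have "\<bar>(\<Sum>n=1..?N. conv_pow w (Suc (Suc k)) n) - x / ?F * M\<bar> =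
          \<bar>\<Sum>d=1..?N. w d * (W (x / d) - ?P d)\<bar>"
      unfolding main [symmetric] W_def
      by (subst conv_pow.simps(2), subst sum_dirichlet_conv) (simp only: sum_subtractf right_diff_distrib)
    also have "\<dots> \<le> (\<Sum>d=1..?N. \<bar>w d * (W (x / d) - ?P d)\<bar>)" by (rule sum_abs)
    also have "\<dots> \<le> (\<Sum>d=1..?N. w d * (B * (x / d) * (1 + ln x) ^ (2 * k)))"
    proof (intro sum_mono)
      fix d assume d: "d \<in> {1..?N}"
      have "\<bar>W (x / d) - ?P d\<bar> \<le> B * (x / d) * (1 + ln (x / d)) ^ (2 * k)"
        unfolding W_def by (intro B xd d)
      also have "\<dots> \<le> B * (x / d) * (1 + ln x) ^ (2 * k)"
        using xd[OF d] B x by (intro mult_left_mono power_mono) auto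
      finally show "\<bar>w d * (W (x / d) - ?P d)\<bar> \<le> w d * (B * (x / d) * (1 + ln x) ^ (2 * k))"
        unfolding abs_mult abs_of_nonneg[OF w0] by (intro mult_left_mono w0)
    qed
    also have "\<dots> = B * x * (1 + ln x) ^ (2 * k) * (\<Sum>n=1..?N. w n / n)"
      by (simp add: sum_distrib_left algebra_simps)
    also have "\<dots> \<le> B * x * (1 + ln x) ^ (2 * k) * ((D + 1) * (1 + ln x) ^ 2)"
    proof (intro mult_left_mono)
      have "(\<Sum>n=1..?N. w n / n) \<le> ln x ^ 2 / 2 + D * (1 + ln x)"
        using abs_le_D1[OF D(2)[OF x]] by (simp add: power2_eq_square)
      also have "\<dots> \<le> 1 * (1 + ln x) ^ 2 + D * (1 + ln x) ^ 2"
        using L D(1) by (intro add_mono mult_left_mono) (auto simp: power2_eq_square algebra_simps)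
      finally show "(\<Sum>n=1..?N. w n / n) \<le> (D + 1) * (1 + ln x) ^ 2" by (simp add: algebra_simps)
    qed (use B x in auto)
    also have "\<dots> = B * (D + 1) * x * (1 + ln x) ^ (2 * Suc k)"
      by (simp add: power_add power2_eq_square algebra_simps)
    finally have 1: "\<bar>(\<Sum>n=1..?N. conv_pow w (Suc (Suc k)) n) - x / ?F * M\<bar> \<le> B * (D + 1) * x * (1 + ln x) ^ (2 * Suc k)" .
    have "\<bar>M - ln x ^ (2 * Suc k + 1) / ?a\<bar> \<le> C * (1 + ln x) ^ (2 * Suc k)"
      using C(2)[OF x] unfolding M_def by (simp add: algebra_simps)
    then have "x / ?F * \<bar>M - ln x ^ (2 * Suc k + 1) / ?a\<bar> \<le> x / 1 * (C * (1 + ln x) ^ (2 * Suc k))"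
      using x fact_ge_1[of "2 * k + 1", where 'a = real] by (intro mult_mono divide_left_mono) auto
    moreover have "x / ?F * \<bar>M - ln x ^ (2 * Suc k + 1) / ?a\<bar> =
        \<bar>x / ?F * M - ?m\<bar>"
    proof -
      have "fact (2 * Suc k + 1) = ?a * ?F" by (simp add: algebra_simps)
      then have "x / ?F * M - ?m = x / ?F * (M - ln x ^ (2 * Suc k + 1) / ?a)"
        by (simp only: right_diff_distrib) (simp only: times_divide_eq_right times_divide_eq_left mult_ac divide_divide_eq_left)
      then show ?thesis using x by (simp only: abs_mult) simp
    qed
    ultimately have 2: "\<bar>x / ?F * M - ?m\<bar> \<le> C * x * (1 + ln x) ^ (2 * Suc k)"
      by (simp add: mult.commute mult.left_commute)
    show "\<bar>(\<Sum>n=1..?N. conv_pow w (Suc (Suc k)) n) - ?m\<bar> \<le> (C + B * (D + 1)) * x * (1 + ln x) ^ (2 * Suc k)"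
    proof -
      have "\<bar>a - c\<bar> \<le> p + q" if "\<bar>a - b\<bar> \<le> q" "\<bar>b - c\<bar> \<le> p" for a b c p q :: real
        using that by linarith
      from this[OF 1 2] show ?thesis by (simp only: distrib_right)
    qed
  qed (use B C D in auto)
qed

lemma ge_1_le_eq_atLeastAtMost: "{n::nat. n \<ge> 1 \<and> real n \<le> x} = {1..nat \<lfloor>x\<rfloor>}"
  by (auto simp: le_nat_floor) linarith

section \<open>Contribution of the numbers that are not squarefree to the main sums\<close>

lemma sum_nonsquarefree_le_scaled:
  obtains C :: real where "C \<ge> 0"
    "\<And>x M h. x \<ge> 1 \<Longrightarrow> M > 0 \<Longrightarrow> (\<And>n p. n \<ge> 1 \<Longrightarrow> real n \<le> x \<Longrightarrow> prime p \<Longrightarrow> p dvd n \<Longrightarrow> h n \<le> M * ln (real (p ^ multiplicity p n)) ^ 2) \<Longrightarrow>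
       (\<Sum>n\<in>nonsqfree (nat \<lfloor>x\<rfloor>). h n) \<le> C * M * x"
proof -
  obtain C where C: "C \<ge> 0" "\<And>N h. (\<And>n p. n \<in> {1..N} \<Longrightarrow> prime p \<Longrightarrow> p ^ 2 dvd n \<Longrightarrow> h n \<le> ln (real (p ^ multiplicity p n)) ^ 2) \<Longrightarrow>
       (\<Sum>n\<in>nonsqfree N. h n) \<le> C * real N"
    using sum_nonsquarefree_le by blast
  show ?thesis
  proof (rule that[OF C(1)])
    fix x M :: real and h :: "nat \<Rightarrow> real"
    assume x: "x \<ge> 1" and M: "M > 0"
      and h: "\<And>n p. n \<ge> 1 \<Longrightarrow> real n \<le> x \<Longrightarrow> prime p \<Longrightarrow> p dvd n \<Longrightarrow> h n \<le> M * ln (real (p ^ multiplicity p n)) ^ 2"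
    let ?S = "nonsqfree (nat \<lfloor>x\<rfloor>)"
    have "(\<Sum>n\<in>?S. h n / M) \<le> C * real (nat \<lfloor>x\<rfloor>)"
    proof (rule C(2))
      fix n p assume n: "n \<in> {1..nat \<lfloor>x\<rfloor>}" and p: "prime p" "p ^ 2 dvd n"
      have "n \<ge> 1" "real n \<le> x" using n unfolding ge_1_le_eq_atLeastAtMost[symmetric] by auto
      moreover have "p dvd n" using p(2) by (rule dvd_trans[rotated]) simp
      ultimately have "h n \<le> M * ln (real (p ^ multiplicity p n)) ^ 2" using p by (intro h)
      then show "h n / M \<le> ln (real (p ^ multiplicity p n)) ^ 2" using M by (simp add: field_simps)
    qed
    also have "\<dots> \<le> C * x" using x C(1) by (intro mult_left_mono) auto
    finally have "(\<Sum>n\<in>?S. h n) / M \<le> C * x" by (simp add: sum_divide_distrib)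
    then show "(\<Sum>n\<in>?S. h n) \<le> C * M * x" using M by (simp add: field_simps)
  qed
qed

lemma ln_ge_1: "x \<ge> 3 \<Longrightarrow> ln x \<ge> (1::real)"
  using exp_le by (subst ln_ge_iff) auto

lemma mangoldt_pow_nonneg: "mangoldt_pow k n \<ge> 0"
  unfolding mangoldt_pow_eq by (intro conv_pow_nonneg mangoldt_nonneg)

text \<open>Both factors are bounded through the same prime p, so each trades one power of ln x for
  the logarithm of the p-part. The product has the square of that logarithm, which the sum over
  nonsquarefree n absorbs, and two powers of ln x are saved.\<close>

lemma mangoldt_pow_corr_nonsquarefree:
  assumes k: "k \<ge> 1" "l \<ge> 1"
  obtains C :: real where "C \<ge> 0"
    "\<And>x. x \<ge> 3 \<Longrightarrow> (\<Sum>n\<in>nonsqfree (nat \<lfloor>x\<rfloor>). mangoldt_pow k n * mangoldt_pow l n) \<le> C * (x * ln x ^ (k + l - 2))"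
proof -
  obtain C where C: "C \<ge> 0"
    "\<And>x M h. x \<ge> 1 \<Longrightarrow> M > 0 \<Longrightarrow> (\<And>n p. n \<ge> 1 \<Longrightarrow> real n \<le> x \<Longrightarrow> prime p \<Longrightarrow> p dvd n \<Longrightarrow> h n \<le> M * ln (real (p ^ multiplicity p n)) ^ 2) \<Longrightarrow>
       (\<Sum>n\<in>nonsqfree (nat \<lfloor>x\<rfloor>). h n) \<le> C * M * x"
    using sum_nonsquarefree_le_scaled by blast
  show ?thesis
  proof (rule that[of "C * (real k * real l)"])
    fix x :: real assume x: "x \<ge> 3"
    have L: "ln x \<ge> 1" using x by (rule ln_ge_1)
    have "(\<Sum>n\<in>nonsqfree (nat \<lfloor>x\<rfloor>). mangoldt_pow k n * mangoldt_pow l n) \<le> C * (real k * real l * ln x ^ (k + l - 2)) * x"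
    proof (rule C(2))
      show "real k * real l * ln x ^ (k + l - 2) > 0" using k L by simp
      fix n p :: nat assume n: "n \<ge> 1" "real n \<le> x" and p: "prime p" "p dvd n"
      let ?q = "ln (real (p ^ multiplicity p n))"
      have q0: "?q \<ge> 0" using prime_gt_0_nat[OF p(1)] by (intro ln_ge_zero) (simp add: Suc_leI)
      have le: "mangoldt_pow j n \<le> j * ?q * ln x ^ (j - 1)" for j
      proof -
        have "mangoldt_pow j n \<le> j * ?q * ln (real n) ^ (j - 1)" using n p by (intro mangoldt_pow_le_prime_part) auto
        also have "\<dots> \<le> j * ?q * ln x ^ (j - 1)" using n q0 by (intro mult_left_mono power_mono) auto
        finally show ?thesis .
      qed
      have "mangoldt_pow k n * mangoldt_pow l n \<le> (k * ?q * ln x ^ (k - 1)) * (l * ?q * ln x ^ (l - 1))"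
        using L q0 by (intro mult_mono le mangoldt_pow_nonneg mult_nonneg_nonneg) auto
      also have "\<dots> = real k * real l * ln x ^ ((k - 1) + (l - 1)) * ?q ^ 2"
        by (simp only: power_add power2_eq_square mult_ac)
      also have "(k - 1) + (l - 1) = k + l - 2" using k by simp
      finally show "mangoldt_pow k n * mangoldt_pow l n \<le> real k * real l * ln x ^ (k + l - 2) * ?q ^ 2" .
    qed (use x in auto)
    then show "(\<Sum>n\<in>nonsqfree (nat \<lfloor>x\<rfloor>). mangoldt_pow k n * mangoldt_pow l n) \<le> C * (real k * real l) * (x * ln x ^ (k + l - 2))"
      by (simp only: mult_ac)
  qed (use C in auto)
qed

text \<open>Here a single factor already carries the square of the logarithm of the p-part.\<close>

lemma mangoldt_sq_pow_nonsquarefree: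
  assumes k: "k \<ge> 1"
  obtains C :: real where "C \<ge> 0"
    "\<And>x. x \<ge> 3 \<Longrightarrow> (\<Sum>n\<in>nonsqfree (nat \<lfloor>x\<rfloor>). conv_pow mangoldt_sq k n) \<le> C * (x * ln x ^ (2 * k - 2))"
proof -
  obtain C where C: "C \<ge> 0"
    "\<And>x M h. x \<ge> 1 \<Longrightarrow> M > 0 \<Longrightarrow> (\<And>n p. n \<ge> 1 \<Longrightarrow> real n \<le> x \<Longrightarrow> prime p \<Longrightarrow> p dvd n \<Longrightarrow> h n \<le> M * ln (real (p ^ multiplicity p n)) ^ 2) \<Longrightarrow>
       (\<Sum>n\<in>nonsqfree (nat \<lfloor>x\<rfloor>). h n) \<le> C * M * x"
    using sum_nonsquarefree_le_scaled by blast
  show ?thesis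
  proof (rule that[of "C * real k"])
    fix x :: real assume x: "x \<ge> 3"
    have L: "ln x \<ge> 1" using x by (rule ln_ge_1)
    have "(\<Sum>n\<in>nonsqfree (nat \<lfloor>x\<rfloor>). conv_pow mangoldt_sq k n) \<le> C * (real k * ln x ^ (2 * k - 2)) * x"
    proof (rule C(2))
      show "real k * ln x ^ (2 * k - 2) > 0" using k L by simp
      fix n p :: nat assume n: "n \<ge> 1" "real n \<le> x" and p: "prime p" "p dvd n"
      let ?q = "ln (real (p ^ multiplicity p n))"
      have "conv_pow mangoldt_sq k n \<le> k * ?q ^ 2 * ln (real n) ^ (2 * (k - 1))"
        using n p by (intro mangoldt_sq_pow_le_prime_part) auto
      also have "\<dots> \<le> k * ?q ^ 2 * ln x ^ (2 * (k - 1))" using n by (intro mult_left_mono power_mono) auto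
      also have "2 * (k - 1) = 2 * k - 2" by simp
      finally show "conv_pow mangoldt_sq k n \<le> real k * ln x ^ (2 * k - 2) * ?q ^ 2" by (simp only: mult_ac)
    qed (use x in auto)
    then show "(\<Sum>n\<in>nonsqfree (nat \<lfloor>x\<rfloor>). conv_pow mangoldt_sq k n) \<le> C * real k * (x * ln x ^ (2 * k - 2))"
      by (simp only: mult_ac)
  qed (use C in auto)
qed

lemma sum_squarefree_split:
  fixes h :: "nat \<Rightarrow> real"
  shows "(\<Sum>n=1..N. h n) = (\<Sum>n | n \<in> {1..N} \<and> squarefree n. h n) + (\<Sum>n\<in>nonsqfree N. h n)"
  by (subst sum.union_disjoint [symmetric]) (auto intro!: sum.cong)

section \<open>Dirichlet series\<close>

definition dseries :: "(nat \<Rightarrow> real) \<Rightarrow> complex \<Rightarrow> complex" where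
  "dseries c s = (\<Sum>n. of_real (c n) * of_nat n powr (-s))"

text \<open>Absolute convergence on the half-plane Re s > 1. Real exponents are enough, as the
  absolute value of n^(-s) depends on Re s only.\<close>

definition dconv :: "(nat \<Rightarrow> real) \<Rightarrow> bool" where
  "dconv c \<longleftrightarrow> (\<forall>\<sigma>>1. summable (\<lambda>n. \<bar>c n\<bar> * real n powr (-\<sigma>)))"

lemma norm_nat_powr: "norm (of_nat n powr (-s) :: complex) = real n powr (- Re s)"
  by (subst norm_powr_real_powr) auto

lemma norm_dseries_term: "norm (of_real (c n) * of_nat n powr (-s) :: complex) = \<bar>c n\<bar> * real n powr (- Re s)"
  by (simp add: norm_mult norm_nat_powr)

lemma dseries_norm_summable:
  assumes "dconv c" "Re s > 1"
  shows "summable (\<lambda>n. norm (of_real (c n) * of_nat n powr (-s) :: complex))"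
  unfolding norm_dseries_term by (rule assms(1)[unfolded dconv_def, rule_format, OF assms(2)])

lemma dseries_sums:
  assumes "dconv c" "Re s > 1"
  shows "(\<lambda>n. of_real (c n) * of_nat n powr (-s)) sums dseries c s"
  unfolding dseries_def by (rule summable_sums[OF summable_norm_cancel[OF dseries_norm_summable[OF assms]]])

lemma dconv_1: "dconv (\<lambda>n. 1)"
  unfolding dconv_def by (auto simp: summable_real_powr_iff)

lemma dconv_le:
  assumes "dconv c" "\<And>n. n > 0 \<Longrightarrow> \<bar>d n\<bar> \<le> \<bar>c n\<bar>"
  shows "dconv d"
  unfolding dconv_def
proof (intro allI impI)
  fix \<sigma> :: real assume "\<sigma> > 1"
  then have "summable (\<lambda>n. \<bar>c n\<bar> * real n powr (-\<sigma>))" using assms(1)[unfolded dconv_def] by blast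
  then show "summable (\<lambda>n. \<bar>d n\<bar> * real n powr (-\<sigma>))"
  proof (rule summable_comparison_test'[of _ 0])
    fix n :: nat
    show "norm (\<bar>d n\<bar> * real n powr (-\<sigma>)) \<le> \<bar>c n\<bar> * real n powr (-\<sigma>)"
      using assms(2)[of n] by (cases "n = 0") (auto simp: abs_mult intro!: mult_right_mono)
  qed
qed

text \<open>Half of the distance from \<sigma> to 1 pays for the logarithm.\<close>

lemma dconv_mult_ln:
  assumes "dconv c"
  shows "dconv (\<lambda>n. c n * ln (real n))"
  unfolding dconv_def
proof (intro allI impI)
  fix \<sigma> :: real assume s: "\<sigma> > 1"
  define \<delta> where "\<delta> = (\<sigma> - 1) / 2"
  have d: "\<delta> > 0" "\<sigma> - \<delta> > 1" using s by (auto simp: \<delta>_def field_simps)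
  have "summable (\<lambda>n. 1 / \<delta> * (\<bar>c n\<bar> * real n powr (-(\<sigma> - \<delta>))))"
    using assms d unfolding dconv_def by (intro summable_mult) blast
  then show "summable (\<lambda>n. \<bar>c n * ln (real n)\<bar> * real n powr (-\<sigma>))"
  proof (rule summable_comparison_test'[of _ 1])
    fix n :: nat assume n: "n \<ge> 1"
    have "ln (real n) \<le> real n powr \<delta> / \<delta>" using n d by (intro ln_powr_bound) auto
    then have "\<bar>c n\<bar> * ln (real n) * real n powr (-\<sigma>) \<le> \<bar>c n\<bar> * (real n powr \<delta> / \<delta>) * real n powr (-\<sigma>)"
      by (intro mult_right_mono mult_left_mono) auto
    also have "\<dots> = 1 / \<delta> * (\<bar>c n\<bar> * (real n powr \<delta> * real n powr (-\<sigma>)))" by (simp add: field_simps)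
    also have "real n powr \<delta> * real n powr (-\<sigma>) = real n powr (-(\<sigma> - \<delta>))" by (simp flip: powr_add)
    finally show "norm (\<bar>c n * ln (real n)\<bar> * real n powr (-\<sigma>)) \<le> 1 / \<delta> * (\<bar>c n\<bar> * real n powr (-(\<sigma> - \<delta>)))"
      using n by (simp add: abs_mult)
  qed
qed

lemma dconv_diff:
  assumes "dconv c" "dconv d"
  shows "dconv (\<lambda>n. c n - d n)"
  unfolding dconv_def
proof (intro allI impI)
  fix \<sigma> :: real assume s: "\<sigma> > 1"
  then have "summable (\<lambda>n. \<bar>c n\<bar> * real n powr (-\<sigma>) + \<bar>d n\<bar> * real n powr (-\<sigma>))"
    using assms unfolding dconv_def by (intro summable_add) auto
  then show "summable (\<lambda>n. \<bar>c n - d n\<bar> * real n powr (-\<sigma>))"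
    by (rule summable_comparison_test'[of _ 0]) (auto simp: abs_mult mult_right_mono simp flip: distrib_right)
qed

lemma dseries_diff:
  assumes "dconv c" "dconv d" "Re s > 1"
  shows "dseries (\<lambda>n. c n - d n) s = dseries c s - dseries d s"
proof -
  have "(\<lambda>n. of_real (c n) * of_nat n powr (-s) - of_real (d n) * of_nat n powr (-s)) sums (dseries c s - dseries d s)"
    using assms by (intro sums_diff dseries_sums)
  then show ?thesis unfolding dseries_def by (simp add: sums_iff algebra_simps)
qed

lemma has_field_derivative_dseries:
  assumes c: "dconv c" and s: "Re s > 1"
  shows "(dseries c has_field_derivative - dseries (\<lambda>n. c n * ln (real n)) s) (at s)"
proof -
  let ?S = "{s. Re s > 1}"
  have op: "open ?S" by (rule open_halfspace_Re_gt)
  have "\<exists>g g'. \<forall>x\<in>?S. ((\<lambda>n. of_real (c n) * of_nat n powr (-x)) sums g x) \<and>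
          ((\<lambda>n. - (of_real (c n * ln (real n)) * of_nat n powr (-x))) sums g' x) \<and> (g has_field_derivative g' x) (at x)"
  proof (rule series_and_derivative_comparison_local[OF op])
    fix n :: nat and x :: complex
    show "((\<lambda>x. of_real (c n) * of_nat n powr (-x)) has_field_derivative - (of_real (c n * ln (real n)) * of_nat n powr (-x))) (at x)"
    proof (cases "n = 0")
      case False
      then have eq: "(\<lambda>x. of_nat n powr (-x)) = (\<lambda>x. exp (- x * of_real (ln (real n))) :: complex)"
        by (simp add: powr_def Ln_of_nat)
      have "((\<lambda>x. of_nat n powr (-x)) has_field_derivative - (of_real (ln (real n)) * of_nat n powr (-x))) (at x)"
        unfolding eq fun_cong[OF eq] by (rule derivative_eq_intros refl)+ (simp add: mult_ac)
      from DERIV_cmult[OF this, of "of_real (c n)"] show ?thesis by (simp add: mult_ac)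
    qed auto
  next
    fix x :: complex assume x: "x \<in> ?S"
    \<comment> \<open>Half the distance to the line Re s = 1: on the ball of this radius the series
      at the exponent 1 + d is a majorant.\<close>
    define d where "d = (Re x - 1) / 2"
    have d: "d > 0" "Re x - d = 1 + d" using x by (auto simp: d_def field_simps)
    show "\<exists>d h. 0 < d \<and> summable h \<and> (\<forall>\<^sub>F n in sequentially. \<forall>y\<in>ball x d \<inter> ?S. norm (of_real (c n) * of_nat n powr (-y) :: complex) \<le> h n)"
    proof (intro exI[of _ d] exI[of _ "\<lambda>n. \<bar>c n\<bar> * real n powr (-(1 + d))"] conjI eventually_mono[OF eventually_ge_at_top[of 1]] ballI)
      show "summable (\<lambda>n. \<bar>c n\<bar> * real n powr (-(1 + d)))"
        by (rule c[unfolded dconv_def, rule_format]) (use d in simp)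
      fix n :: nat and y assume n: "1 \<le> n" and y: "y \<in> ball x d \<inter> ?S"
      have "\<bar>Re x - Re y\<bar> \<le> norm (x - y)" using abs_Re_le_cmod[of "x - y"] by simp
      also have "\<dots> < d" using y by (simp add: dist_norm)
      finally have "Re y \<ge> 1 + d" using d by linarith
      then show "norm (of_real (c n) * of_nat n powr (-y) :: complex) \<le> \<bar>c n\<bar> * real n powr (-(1 + d))"
        unfolding norm_dseries_term using n by (intro mult_left_mono powr_mono) auto
    qed (use d in auto)
  qed
  then obtain g g' where g: "\<And>x. x \<in> ?S \<Longrightarrow> (\<lambda>n. of_real (c n) * of_nat n powr (-x)) sums g x"
     "\<And>x. x \<in> ?S \<Longrightarrow> (\<lambda>n. - (of_real (c n * ln (real n)) * of_nat n powr (-x))) sums g' x"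
     "\<And>x. x \<in> ?S \<Longrightarrow> (g has_field_derivative g' x) (at x)" by blast
  have "g x = dseries c x" if "x \<in> ?S" for x
    using g(1)[OF that] unfolding dseries_def by (simp add: sums_iff)
  moreover have "g' s = - dseries (\<lambda>n. c n * ln (real n)) s"
    using sums_unique2[OF g(2)[of s] sums_minus[OF dseries_sums[OF dconv_mult_ln[OF c] s]]] s by simp
  ultimately show ?thesis
    using g(3)[of s] s has_field_derivative_transform_within_open[OF _ op, of g "g' s" s "dseries c"] by auto
qed

lemma has_sum_dseries:
  assumes "dconv c" "Re s > 1"
  shows "((\<lambda>n. of_real (c n) * of_nat n powr (-s)) has_sum dseries c s) {1..}"
proof -
  have "((\<lambda>n. of_real (c n) * of_nat n powr (-s)) has_sum dseries c s) UNIV"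
    by (intro norm_summable_imp_has_sum dseries_norm_summable dseries_sums assms)
  also have "?this \<longleftrightarrow> ?thesis"
    by (rule has_sum_cong_neutral) (auto simp: not_le)
  finally show ?thesis .
qed

lemma dseries_mult:
  assumes c: "dconv c" and d: "dconv d" and s: "Re s > 1" and e: "dconv (dirichlet_conv c d)"
  shows "dseries c s * dseries d s = dseries (dirichlet_conv c d) s"
proof -
  define f where "f = (\<lambda>n::nat. of_real (c n) * of_nat n powr (-s) :: complex)"
  define g where "g = (\<lambda>n::nat. of_real (d n) * of_nat n powr (-s) :: complex)"
  have f: "(f has_sum dseries c s) {1..}" and g: "(g has_sum dseries d s) {1..}"
    unfolding f_def g_def by (intro has_sum_dseries c d s)+
  have nf: "(\<lambda>n. norm (f n)) summable_on {1..}"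
    unfolding f_def using dseries_norm_summable[OF c s]
    by (intro summable_on_subset_banach[OF norm_summable_imp_summable_on subset_UNIV]) simp
  have ng: "(\<lambda>n. norm (g n)) summable_on {1..}"
    unfolding g_def using dseries_norm_summable[OF d s]
    by (intro summable_on_subset_banach[OF norm_summable_imp_summable_on subset_UNIV]) simp
  have "(\<lambda>z. norm (f (fst z) * g (snd z))) summable_on ({1..} \<times> {1..})"
  proof (rule summable_on_SigmaI)
    show "((\<lambda>m. norm (f (fst (n, m)) * g (snd (n, m)))) has_sum (norm (f n) * (\<Sum>\<^sub>\<infinity>m\<in>{1..}. norm (g m)))) {1..}" for n
      unfolding fst_conv snd_conv norm_mult by (intro has_sum_cmult_right has_sum_infsum ng)
    show "(\<lambda>n. norm (f n) * (\<Sum>\<^sub>\<infinity>m\<in>{1..}. norm (g m))) summable_on {1..}"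
      by (intro summable_on_cmult_left nf)
  qed auto
  then have sm: "(\<lambda>z. f (fst z) * g (snd z)) summable_on ({1..} \<times> {1..})"
    by (rule abs_summable_summable)
  have "((\<lambda>z. f (fst z) * g (snd z)) has_sum (dseries c s * dseries d s)) ({1..} \<times> {1..})"
  proof (rule has_sum_SigmaI)
    show "((\<lambda>m. f (fst (n, m)) * g (snd (n, m))) has_sum (f n * dseries d s)) {1..}" for n
      unfolding fst_conv snd_conv by (intro has_sum_cmult_right g)
    show "((\<lambda>n. f n * dseries d s) has_sum (dseries c s * dseries d s)) {1..}"
      by (intro has_sum_cmult_left f)
  qed (rule sm)
  also have "?this \<longleftrightarrow> ((\<lambda>(n, k). f k * g (n div k)) has_sum (dseries c s * dseries d s)) (Sigma {1..} (\<lambda>n. {k. k dvd n}))"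
  proof (rule has_sum_reindex_bij_witness[of _ "\<lambda>(n, k). (k, n div k)" "\<lambda>(k, m). (k * m, k)"], goal_cases)
    case (4 b)
    then obtain n k where b: "b = (n, k)" "n \<ge> 1" "k dvd n" by auto
    then obtain m where m: "n = k * m" by (elim dvdE)
    then have "k \<ge> 1" "m \<ge> 1" using b by auto
    then show ?case using b m by simp
  qed auto
  finally have "((\<lambda>n. \<Sum>k | k dvd n. f k * g (n div k)) has_sum (dseries c s * dseries d s)) {1..}"
  proof (rule has_sum_SigmaD)
    fix n :: nat assume "n \<in> {1..}"
    then show "((\<lambda>k. case (n, k) of (n, k) \<Rightarrow> f k * g (n div k)) has_sum (\<Sum>k | k dvd n. f k * g (n div k))) {k. k dvd n}"
      unfolding prod.case by (intro has_sum_finite) auto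
  qed
  also have "?this \<longleftrightarrow> ((\<lambda>n. of_real (dirichlet_conv c d n) * of_nat n powr (-s)) has_sum (dseries c s * dseries d s)) {1..}"
  proof (rule has_sum_cong)
    fix n :: nat assume n: "n \<in> {1..}"
    have "f k * g (n div k) = of_real (c k * d (n div k)) * of_nat n powr (-s)" if "k dvd n" for k
    proof -
      from that obtain m where m: "n = k * m" by auto
      then have km: "k > 0" "m > 0" using n by auto
      have "of_nat (k * m) powr (-s) = of_nat k powr (-s) * (of_nat m powr (-s) :: complex)"
        by (simp add: powr_times_real)
      then show ?thesis unfolding f_def g_def m using km by simp
    qed
    then show "(\<Sum>k | k dvd n. f k * g (n div k)) = of_real (dirichlet_conv c d n) * of_nat n powr (-s)"
      unfolding dirichlet_conv_def by (simp add: sum_distrib_right)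
  qed
  finally show ?thesis using has_sum_dseries[OF e s] has_sum_unique by blast
qed

section \<open>The zeta function and its logarithm on Re s > 1\<close>

definition zeta :: "complex \<Rightarrow> complex" where "zeta = dseries (\<lambda>n. 1)"

lemma dconv_mangoldt: "dconv mangoldt"
  by (rule dconv_le[OF dconv_mult_ln[OF dconv_1]]) (auto simp: mangoldt_le)

text \<open>The Dirichlet series form of the identity that the divisor sum of
  \<open>mangoldt\<close> is ln.\<close>

lemma zeta_deriv:
  assumes "Re s > 1"
  shows "(zeta has_field_derivative - (zeta s * dseries mangoldt s)) (at s)"
proof -
  have ln: "dirichlet_conv mangoldt (\<lambda>n. 1) n = (1 :: real) * ln (real n)" if "n > 0" for n
    using mangoldt_sum[of n, where 'a = real] that by (simp add: dirichlet_conv_def)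
  have dc: "dconv (dirichlet_conv mangoldt (\<lambda>n. 1))"
    by (rule dconv_le[OF dconv_mult_ln[OF dconv_1]]) (simp add: ln)
  have "dseries mangoldt s * zeta s = dseries (dirichlet_conv mangoldt (\<lambda>n. 1)) s"
    unfolding zeta_def by (intro dseries_mult dconv_mangoldt dconv_1 dc assms)
  also have "\<dots> = dseries (\<lambda>n. 1 * ln (real n)) s"
    unfolding dseries_def
  proof (intro suminf_cong)
    fix n :: nat
    show "of_real (dirichlet_conv mangoldt (\<lambda>n. 1) n) * of_nat n powr (-s) = (of_real (1 * ln (real n)) * of_nat n powr (-s) :: complex)"
      using ln[of n] by (cases "n = 0") auto
  qed
  finally show ?thesis
    using has_field_derivative_dseries[OF dconv_1 assms] unfolding zeta_def by (simp add: mult.commute)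
qed

text \<open>The Dirichlet series of log \<zeta>. The coefficient at n = 1 is 0 / 0 = 0.\<close>

definition log_zeta :: "complex \<Rightarrow> complex" where
  "log_zeta = dseries (\<lambda>n. mangoldt n / ln (real n))"

lemma dconv_log_zeta: "dconv (\<lambda>n. mangoldt n / ln (real n))"
proof (rule dconv_le[OF dconv_1])
  fix n :: nat assume "n > 0"
  then show "\<bar>mangoldt n / ln (real n)\<bar> \<le> \<bar>1 :: real\<bar>"
    using mangoldt_le[of n] by (cases "n = 1") (auto simp: abs_div divide_le_eq)
qed

lemma log_zeta_deriv:
  assumes "Re s > 1"
  shows "(log_zeta has_field_derivative - dseries mangoldt s) (at s)"
proof -
  have "(\<lambda>n. mangoldt n / ln (real n) * ln (real n)) = (mangoldt :: nat \<Rightarrow> real)"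
  proof
    fix n :: nat
    show "mangoldt n / ln (real n) * ln (real n) = (mangoldt n :: real)"
      by (cases "n \<le> 1") (auto simp: le_Suc_eq)
  qed
  then show ?thesis
    using has_field_derivative_dseries[OF dconv_log_zeta assms] unfolding log_zeta_def by simp
qed

text \<open>The quotient of the two sides has derivative 0 on a convex set. This replaces the Euler
  product: it gives the nonvanishing of \<zeta> and its absolute value in terms of
  \<open>Re (log_zeta s)\<close>. An unspecified nonzero constant does no harm there.\<close>

lemma zeta_eq_exp:
  obtains C where "C \<noteq> 0" "\<And>s. Re s > 1 \<Longrightarrow> zeta s = C * exp (log_zeta s)"
proof -
  let ?S = "{s. Re s > 1}"
  have "\<exists>c. \<forall>s\<in>?S. zeta s * exp (- log_zeta s) = c"
  proof (rule has_field_derivative_zero_constant)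
    show "convex ?S" by (rule convex_halfspace_Re_gt)
    fix s assume "s \<in> ?S"
    then have s: "Re s > 1" by simp
    have "((\<lambda>s. zeta s * exp (- log_zeta s)) has_field_derivative 0) (at s)"
      by (rule derivative_eq_intros zeta_deriv[OF s] log_zeta_deriv[OF s] refl)+ (simp add: algebra_simps)
    then show "((\<lambda>s. zeta s * exp (- log_zeta s)) has_field_derivative 0) (at s within ?S)"
      by (rule has_field_derivative_at_within)
  qed
  then obtain c where c: "\<And>s. Re s > 1 \<Longrightarrow> zeta s * exp (- log_zeta s) = c" by auto
  have eq: "zeta s = c * exp (log_zeta s)" if "Re s > 1" for s
    using c[OF that] by (auto simp: exp_minus field_simps)
  have "c \<noteq> 0"
  proof
    assume "c = 0"
    then have "zeta 2 = 0" using eq[of 2] by simp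
    moreover have "(\<lambda>n. of_real (1::real) * of_nat n powr (-2)) sums zeta 2"
      unfolding zeta_def by (rule dseries_sums[OF dconv_1]) simp
    then have "(\<lambda>n. Re (of_real (1::real) * of_nat n powr (-2))) sums Re (zeta 2)" by (rule sums_Re)
    moreover have "Re (of_real (1::real) * of_nat n powr (-2)) = real n powr (-2)" for n
      using powr_of_real[of "real n" "-2"] by simp
    ultimately have *: "(\<lambda>n. real n powr (-2)) sums 0" by simp
    have "(\<Sum>n\<in>{1::nat}. real n powr (-2)) \<le> (\<Sum>n. real n powr (-2))"
      using * by (intro sum_le_suminf) (auto simp: sums_iff)
    then show False using * by (simp add: sums_iff)
  qed
  with eq show ?thesis using that by blast
qed

section \<open>Continuation and growth of the zeta function\<close>

text \<open>\<open>zeta_reg s = (s - 1) \<zeta>(s)\<close>, continued to \<open>Re s > 0\<close>: the \<open>n\<close>-th term is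
  \<open>(s - 1) * (n powr (-s) - \<integral>\<^sub>n\<^sup>n\<^sup>+\<^sup>1 u powr (-s) du)\<close>.\<close>
definition zeta_reg_term :: "nat \<Rightarrow> complex \<Rightarrow> complex" where
  "zeta_reg_term n s = (s - 1) * of_nat n powr (-s) - of_nat n powr (1 - s) + of_nat (Suc n) powr (1 - s)"

definition zeta_reg :: "complex \<Rightarrow> complex" where
  "zeta_reg s = 1 + (\<Sum>n. zeta_reg_term (Suc n) s)"

text \<open>The term is the remainder of the first-order Taylor expansion of z^(1-s) from n to n +
  1, and the second derivative of this function is s * (s - 1) * z^(-s-1).\<close>

lemma norm_zeta_reg_term_le:
  assumes n: "n \<ge> 1" and s: "Re s > 0"
  shows "norm (zeta_reg_term n s) \<le> norm s * norm (s - 1) * real n powr (- Re s - 1)"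
proof -
  define f :: "nat \<Rightarrow> complex \<Rightarrow> complex" where
    "f = (\<lambda>i z. if i = 0 then z powr (1 - s) else if i = 1 then (1 - s) * z powr (-s) else (1 - s) * (-s) * z powr (-s - 1))"
  let ?S = "closed_segment (of_nat n) (of_nat n + 1 :: complex)"
  have S: "z \<in> \<real> \<and> Re z \<ge> real n" if "z \<in> ?S" for z
  proof -
    from that obtain u where u: "0 \<le> u" "u \<le> 1" "z = (1 - u) *\<^sub>R of_nat n + u *\<^sub>R (of_nat n + 1)"
      unfolding closed_segment_def by auto
    then have "z = of_real (real n + u)" by (simp add: scaleR_conv_of_real algebra_simps)
    then show ?thesis using u by simp
  qed
  have "norm (f 0 (of_nat n + 1) - (\<Sum>i\<le>1. f i (of_nat n) * (of_nat n + 1 - of_nat n) ^ i / fact i))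
      \<le> (norm s * norm (s - 1) * real n powr (- Re s - 1)) * norm (of_nat n + 1 - of_nat n :: complex) ^ Suc 1 / fact 1"
  proof (rule complex_Taylor)
    fix i z assume z: "z \<in> ?S" and i: "i \<le> (1::nat)"
    have z0: "z \<notin> \<real>\<^sub>\<le>\<^sub>0" using S[OF z] n by (auto simp: complex_nonpos_Reals_iff)
    consider "i = 0" | "i = 1" using i by linarith
    then show "(f i has_field_derivative f (Suc i) z) (at z within ?S)"
    proof cases
      case 1
      then show ?thesis unfolding f_def using z0 by (auto intro!: derivative_eq_intros)
    next
      case 2
      then show ?thesis unfolding f_def using z0 by (auto intro!: derivative_eq_intros)
    qed
  next
    fix z assume z: "z \<in> ?S"
    have "norm (z powr (-s - 1)) = Re z powr (- Re s - 1)"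
      using S[OF z] n by (subst norm_powr_real_powr) auto
    also have "\<dots> \<le> real n powr (- Re s - 1)"
      using S[OF z] n s by (intro powr_mono2') auto
    finally show "norm (f (Suc 1) z) \<le> norm s * norm (s - 1) * real n powr (- Re s - 1)"
      unfolding f_def by (simp add: norm_mult norm_minus_commute mult_left_mono mult.commute)
  qed auto
  moreover have "f 0 (of_nat n + 1) - (\<Sum>i\<le>1. f i (of_nat n) * (of_nat n + 1 - of_nat n) ^ i / fact i) = zeta_reg_term n s"
    unfolding f_def zeta_reg_term_def by (simp add: algebra_simps)
  ultimately show ?thesis by simp
qed

lemma zeta_reg_term_holomorphic: "zeta_reg_term (Suc n) holomorphic_on A"
  unfolding zeta_reg_term_def by (auto intro!: holomorphic_intros simp del: of_nat_Suc)

lemma zeta_reg_term_summable: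
  assumes s: "Re s > 0"
  shows "summable (\<lambda>n. norm (zeta_reg_term (Suc n) s))"
proof (rule summable_comparison_test'[of _ 0])
  have "summable (\<lambda>n. real n powr (- Re s - 1))" using s by (simp add: summable_real_powr_iff)
  then have "summable (\<lambda>n. real (Suc n) powr (- Re s - 1))" by (subst summable_Suc_iff)
  then show "summable (\<lambda>n. norm s * norm (s - 1) * real (Suc n) powr (- Re s - 1))" by (rule summable_mult)
  show "norm (norm (zeta_reg_term (Suc n) s)) \<le> norm s * norm (s - 1) * real (Suc n) powr (- Re s - 1)" for n
    using norm_zeta_reg_term_le[of "Suc n" s] s by simp
qed

lemma zeta_reg_holomorphic: "zeta_reg holomorphic_on {s. Re s > 0}"
proof -
  let ?S = "{s. Re s > 0}"
  have op: "open ?S" by (rule open_halfspace_Re_gt)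
  have "\<exists>g g'. \<forall>x\<in>?S. ((\<lambda>n. zeta_reg_term (Suc n) x) sums g x) \<and>
          ((\<lambda>n. deriv (zeta_reg_term (Suc n)) x) sums g' x) \<and> (g has_field_derivative g' x) (at x)"
  proof (rule series_and_derivative_comparison_local[OF op])
    fix n :: nat and x :: complex
    show "(zeta_reg_term (Suc n) has_field_derivative deriv (zeta_reg_term (Suc n)) x) (at x)"
      using zeta_reg_term_holomorphic[of n UNIV] holomorphic_derivI[of _ UNIV] by auto
  next
    fix x :: complex assume x: "x \<in> ?S"
    define d where "d = Re x / 2"
    have d: "d > 0" "Re x - d = d" using x by (auto simp: d_def field_simps)
    show "\<exists>d h. 0 < d \<and> summable h \<and> (\<forall>\<^sub>F n in sequentially. \<forall>y\<in>ball x d \<inter> ?S. norm (zeta_reg_term (Suc n) y) \<le> h n)"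
    proof (intro exI[of _ d] exI[of _ "\<lambda>n. (norm x + d) * (norm x + d + 1) * real (Suc n) powr (- d - 1)"] conjI always_eventually allI ballI)
      have "summable (\<lambda>n. real n powr (- d - 1))" using d by (simp add: summable_real_powr_iff)
      then have "summable (\<lambda>n. real (Suc n) powr (- d - 1))" by (subst summable_Suc_iff)
      then show "summable (\<lambda>n. (norm x + d) * (norm x + d + 1) * real (Suc n) powr (- d - 1))" by (rule summable_mult)
      fix n y assume y: "y \<in> ball x d \<inter> ?S"
      have yx: "norm (x - y) < d" using y by (simp add: dist_norm)
      have "\<bar>Re x - Re y\<bar> \<le> norm (x - y)" using abs_Re_le_cmod[of "x - y"] by simp
      then have Re: "Re y \<ge> d" using d yx by linarith
      have ny: "norm y \<le> norm x + d" using yx norm_triangle_sub[of y x] by (simp add: norm_minus_commute)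
      have ny1: "norm (y - 1) \<le> norm x + d + 1" using ny norm_triangle_ineq4[of y 1] by simp
      have "norm (zeta_reg_term (Suc n) y) \<le> norm y * norm (y - 1) * real (Suc n) powr (- Re y - 1)"
        using y by (intro norm_zeta_reg_term_le) auto
      also have "\<dots> \<le> (norm x + d) * (norm x + d + 1) * real (Suc n) powr (- d - 1)"
        using ny ny1 Re d by (intro mult_mono powr_mono) (auto intro!: mult_nonneg_nonneg)
      finally show "norm (zeta_reg_term (Suc n) y) \<le> (norm x + d) * (norm x + d + 1) * real (Suc n) powr (- d - 1)" .
    qed (use d in auto)
  qed
  then obtain g g' where g: "\<And>x. x \<in> ?S \<Longrightarrow> (\<lambda>n. zeta_reg_term (Suc n) x) sums g x"
     "\<And>x. x \<in> ?S \<Longrightarrow> (g has_field_derivative g' x) (at x)" by blast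
  have "(\<lambda>x. 1 + g x) holomorphic_on ?S"
    using g(2) op by (intro holomorphic_intros) (auto simp: holomorphic_on_open)
  then show ?thesis
    by (rule holomorphic_transform) (use g(1) in \<open>auto simp: zeta_reg_def sums_iff\<close>)
qed

text \<open>The powers with exponent 1 - s telescope; the summand 1 in \<open>zeta_reg\<close>
  cancels the first of them.\<close>

lemma zeta_reg_partial_sum:
  "1 + (\<Sum>i<M. zeta_reg_term (Suc i) s) = (s - 1) * (\<Sum>i<M. of_nat (Suc i) powr (-s)) + of_nat (Suc M) powr (1 - s)"
  by (induction M) (simp_all add: zeta_reg_term_def algebra_simps del: of_nat_Suc, simp)

lemma zeta_reg_split:
  assumes "Re s > 0"
  shows "zeta_reg s = (s - 1) * (\<Sum>i<M. of_nat (Suc i) powr (-s)) + of_nat (Suc M) powr (1 - s) + (\<Sum>i. zeta_reg_term (Suc (i + M)) s)"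
proof -
  have "zeta_reg s = 1 + ((\<Sum>i. zeta_reg_term (Suc (i + M)) s) + (\<Sum>i<M. zeta_reg_term (Suc i) s))"
    unfolding zeta_reg_def
    using suminf_split_initial_segment[OF summable_norm_cancel[OF zeta_reg_term_summable[OF assms]], of M] by simp
  then show ?thesis using zeta_reg_partial_sum[of s M] by (simp add: add_ac)
qed

lemma zeta_reg_1: "zeta_reg 1 = 1"
  by (simp add: zeta_reg_def zeta_reg_term_def del: of_nat_Suc)

lemma zeta_reg_eq:
  assumes s: "Re s > 1"
  shows "zeta_reg s = (s - 1) * zeta s"
proof -
  have "(\<lambda>n. of_real 1 * of_nat n powr (-s)) sums zeta s"
    unfolding zeta_def by (rule dseries_sums[OF dconv_1 s])
  then have "(\<lambda>n. of_nat (Suc n) powr (-s)) sums zeta s"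
    by (subst sums_Suc_iff) simp
  then have 1: "(\<lambda>M. (s - 1) * (\<Sum>i<M. of_nat (Suc i) powr (-s)) + of_nat (Suc M) powr (1 - s)) \<longlonglongrightarrow> (s - 1) * zeta s + 0"
  proof (intro tendsto_add tendsto_mult tendsto_const)
    show "(\<lambda>M. of_nat (Suc M) powr (1 - s) :: complex) \<longlonglongrightarrow> 0"
    proof (rule tendsto_norm_zero_cancel)
      have "(\<lambda>M. real (Suc M) powr (1 - Re s)) \<longlonglongrightarrow> 0"
        by (rule tendsto_neg_powr[OF _ filterlim_compose[OF filterlim_real_sequentially filterlim_Suc]]) (use s in simp)
      then show "(\<lambda>M. norm (of_nat (Suc M) powr (1 - s) :: complex)) \<longlonglongrightarrow> 0"
        using norm_nat_powr[of _ "s - 1"] by (simp del: of_nat_Suc)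
    qed
  qed (simp add: sums_def)
  have "(\<lambda>M. 1 + (\<Sum>i<M. zeta_reg_term (Suc i) s)) \<longlonglongrightarrow> zeta_reg s"
    unfolding zeta_reg_def using s
    by (intro tendsto_add tendsto_const summable_LIMSEQ[OF summable_norm_cancel[OF zeta_reg_term_summable]]) auto
  then show ?thesis using LIMSEQ_unique[OF 1] unfolding zeta_reg_partial_sum by simp
qed

text \<open>The series is cut at M near 2 + |Im s|. Below M the powers n^(-s) are bounded trivially;
  beyond M the Taylor bound has the factor |s| * |s - 1|, of which the size of n recovers nearly one
  power of the height.\<close>

lemma zeta_reg_growth:
  assumes e: "0 < e" "e \<le> 1/2"
  obtains C where "C > 0" "\<And>s. 1 - e \<le> Re s \<Longrightarrow> Re s \<le> 3 \<Longrightarrow> norm (zeta_reg s) \<le> C * (2 + \<bar>Im s\<bar>) * (2 + \<bar>Im s\<bar>) powr (2 * e)"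
proof -
  define S where "S = (\<Sum>i. real (Suc i) powr (-1 - e))"
  have "summable (\<lambda>n. real n powr (-1 - e))" using e by (simp add: summable_real_powr_iff)
  then have sm: "summable (\<lambda>i. real (Suc i) powr (-1 - e))" by (subst summable_Suc_iff)
  have S0: "S \<ge> 0" unfolding S_def by (intro suminf_nonneg sm) auto
  show ?thesis
  proof (rule that[of "5 * S + 3"])
    fix s assume s: "1 - e \<le> Re s" "Re s \<le> 3"
    define \<tau> where "\<tau> = 2 + \<bar>Im s\<bar>"
    define M where "M = nat \<lceil>\<tau>\<rceil>"
    let ?p = "\<lambda>i. real (Suc i) powr (-1 - e)" and ?T = "\<tau> powr (2 * e)"
    have \<tau>: "\<tau> \<ge> 2" by (simp add: \<tau>_def)
    have M: "\<tau> \<le> real M" "real M \<le> \<tau> + 1" using \<tau> unfolding M_def by linarith+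
    have n1: "norm (s - 1) \<le> \<tau>"
      using cmod_le[of "s - 1"] s e unfolding \<tau>_def by auto
    have n2: "norm s \<le> 2 * \<tau>"
      using cmod_le[of s] s e unfolding \<tau>_def by auto
    have "norm (\<Sum>i<M. of_nat (Suc i) powr (-s) :: complex) \<le> (\<Sum>i<M. real M powr (2 * e) * ?p i)"
    proof (rule sum_norm_le)
      fix i assume i: "i \<in> {..<M}"
      have "norm (of_nat (Suc i) powr (-s) :: complex) = real (Suc i) powr (- Re s)" by (rule norm_nat_powr)
      \<comment> \<open>The exponent -1 + e is split so that a convergent series with exponent -1 -
        e remains; hence the loss 2 * e. The tail below is split in the same way.\<close>
      also have "\<dots> \<le> real (Suc i) powr (2 * e + (-1 - e))" using s by (intro powr_mono) auto
      also have "\<dots> = real (Suc i) powr (2 * e) * ?p i" by (rule powr_add)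
      also have "\<dots> \<le> real M powr (2 * e) * ?p i"
        using i e by (intro mult_right_mono powr_mono2) auto
      finally show "norm (of_nat (Suc i) powr (-s) :: complex) \<le> real M powr (2 * e) * ?p i" .
    qed
    also have "\<dots> = real M powr (2 * e) * (\<Sum>i<M. ?p i)" by (simp add: sum_distrib_left)
    also have "\<dots> \<le> real M powr (2 * e) * S" unfolding S_def by (intro mult_left_mono sum_le_suminf sm) auto
    finally have A: "norm (\<Sum>i<M. of_nat (Suc i) powr (-s) :: complex) \<le> real M powr (2 * e) * S" .
    have M2: "real (Suc M) powr (2 * e) \<le> 3 * ?T"
    proof -
      have "real (Suc M) powr (2 * e) \<le> (3 * \<tau>) powr (2 * e)" using M \<tau> e by (intro powr_mono2) auto
      also have "\<dots> = 3 powr (2 * e) * ?T" using \<tau> by (simp add: powr_mult)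
      also have "\<dots> \<le> 3 powr 1 * ?T" using e by (intro mult_right_mono powr_mono) auto
      finally show ?thesis by simp
    qed
    have "real M powr (2 * e) \<le> real (Suc M) powr (2 * e)" using e by (intro powr_mono2) auto
    with M2 have M1: "real M powr (2 * e) \<le> 3 * ?T" by simp
    have B: "norm (of_nat (Suc M) powr (1 - s) :: complex) \<le> 3 * ?T"
    proof -
      have "norm (of_nat (Suc M) powr (1 - s) :: complex) = real (Suc M) powr (1 - Re s)"
        using norm_nat_powr[of "Suc M" "s - 1"] by simp
      also have "\<dots> \<le> real (Suc M) powr (2 * e)" using s e by (intro powr_mono) auto
      finally show ?thesis using M2 by simp
    qed
    have term_le: "norm (zeta_reg_term (Suc (i + M)) s) \<le> (2 * \<tau>) * \<tau> * (\<tau> powr (2 * e - 1) * ?p i)" for i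
    proof -
      have "norm (zeta_reg_term (Suc (i + M)) s) \<le> norm s * norm (s - 1) * real (Suc (i + M)) powr (- Re s - 1)"
        using s e by (intro norm_zeta_reg_term_le) auto
      also have "\<dots> \<le> (2 * \<tau>) * \<tau> * (\<tau> powr (2 * e - 1) * ?p i)"
      proof (intro mult_mono n1 n2)
        have "real (Suc (i + M)) powr (- Re s - 1) \<le> real (Suc (i + M)) powr ((2 * e - 1) + (-1 - e))"
          using s by (intro powr_mono) auto
        also have "\<dots> = real (Suc (i + M)) powr (2 * e - 1) * real (Suc (i + M)) powr (-1 - e)" by (rule powr_add)
        also have "\<dots> \<le> \<tau> powr (2 * e - 1) * ?p i"
          using M \<tau> e by (intro mult_mono powr_mono2') auto
        finally show "real (Suc (i + M)) powr (- Re s - 1) \<le> \<tau> powr (2 * e - 1) * ?p i" .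
      qed (use \<tau> in auto)
      finally show ?thesis .
    qed
    have sm': "summable (\<lambda>i. (2 * \<tau>) * \<tau> * (\<tau> powr (2 * e - 1) * ?p i))"
      by (intro summable_mult sm)
    have "norm (\<Sum>i. zeta_reg_term (Suc (i + M)) s) \<le> (\<Sum>i. (2 * \<tau>) * \<tau> * (\<tau> powr (2 * e - 1) * ?p i))"
      by (intro norm_suminf_le term_le sm')
    also have "\<dots> = (2 * \<tau>) * \<tau> * (\<tau> powr (2 * e - 1) * S)"
      unfolding S_def by (simp only: suminf_mult sm summable_mult)
    also have "\<dots> = 2 * S * \<tau> * (\<tau> powr 1 * \<tau> powr (2 * e - 1))" using \<tau> by simp
    also have "\<tau> powr 1 * \<tau> powr (2 * e - 1) = \<tau> powr (1 + (2 * e - 1))" by (rule powr_add [symmetric])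
    also have "1 + (2 * e - 1) = 2 * e" by simp
    finally have C: "norm (\<Sum>i. zeta_reg_term (Suc (i + M)) s) \<le> 2 * S * \<tau> * ?T" .
    have D1: "norm ((s - 1) * (\<Sum>i<M. of_nat (Suc i) powr (-s))) \<le> \<tau> * ((3 * ?T) * S)"
      unfolding norm_mult using n1 A M1 S0 \<tau> by (intro mult_mono order.trans[OF A] mult_right_mono) auto
    have D2: "norm (of_nat (Suc M) powr (1 - s) :: complex) \<le> 3 * \<tau> * ?T"
    proof -
      have "3 * ?T * 1 \<le> 3 * ?T * \<tau>" using \<tau> by (intro mult_left_mono) auto
      then show ?thesis using B by (simp only: mult_ac) 
    qed
    have "norm (zeta_reg s) \<le> \<tau> * ((3 * ?T) * S) + 3 * \<tau> * ?T + 2 * S * \<tau> * ?T"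
    proof -
      have tri: "norm (a + b + c) \<le> p + q + r" if "norm a \<le> p" "norm b \<le> q" "norm c \<le> r" for a b c :: complex and p q r
        using norm_triangle_ineq[of "a + b" c] norm_triangle_ineq[of a b] that by linarith
      have "Re s > 0" using s e by linarith
      from zeta_reg_split[OF this, of M] show ?thesis
        using tri[OF D1 D2 C] by simp
    qed
    also have "\<dots> = (5 * S + 3) * \<tau> * ?T" by (simp add: algebra_simps)
    finally show "norm (zeta_reg s) \<le> (5 * S + 3) * (2 + \<bar>Im s\<bar>) * (2 + \<bar>Im s\<bar>) powr (2 * e)" unfolding \<tau>_def .
  qed (use S0 in auto)
qed

section \<open>Bounds for derivatives near the line Re s = 1\<close>

lemma deriv_power_bound:
  assumes f: "f holomorphic_on {s. Re s > 0}" and s: "Re s \<ge> 1" and j: "j \<le> 3"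
    and B: "\<And>w. norm (s - w) = 1 / 60 \<Longrightarrow> norm (f w) \<le> B"
  shows "norm ((deriv ^^ j) f s) \<le> 6 * 60 ^ 3 * B"
proof -
  have sub: "cball s (1 / 60) \<subseteq> {s. Re s > 0}"
  proof
    fix w assume "w \<in> cball s (1 / 60)"
    then have "norm (s - w) \<le> 1 / 60" by (simp add: dist_norm)
    then have "Re s - Re w \<le> 1 / 60" using complex_Re_le_cmod[of "s - w"] by simp
    then show "w \<in> {s. Re s > 0}" using s by simp
  qed
  have "norm (s - (s + 1 / 60)) = 1 / 60" by simp
  from order.trans[OF norm_ge_zero B[OF this]] have B0: "B \<ge> 0" .
  \<comment> \<open>The radius 1/60 keeps the circle inside Re w \<ge> 1 - 1/60, where the growth
    bounds hold; the constant is 3! * 60^3, the worst case j = 3.\<close>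
  have "norm ((deriv ^^ j) f s) \<le> fact j * B / (1 / 60) ^ j"
  proof (rule Cauchy_inequality)
    show "f holomorphic_on ball s (1 / 60)"
      using f sub by (rule holomorphic_on_subset[OF _ order.trans[OF ball_subset_cball]])
    show "continuous_on (cball s (1 / 60)) f"
      using f sub by (intro holomorphic_on_imp_continuous_on) (rule holomorphic_on_subset)
  qed (use B in auto)
  also have "\<dots> = (fact j * 60 ^ j) * B" by (simp add: power_divide)
  also have "\<dots> \<le> (fact 3 * 60 ^ 3) * B"
    using j B0 by (intro mult_right_mono mult_mono fact_mono power_increasing) auto
  finally show ?thesis by (simp add: fact_numeral)
qed

lemma near_point_height:
  assumes "norm (s - w) = 1 / 60" "1 \<le> Re s" "Re s \<le> 2"
  shows "1 - 1 / 60 \<le> Re w" "Re w \<le> 3" "2 + \<bar>Im w\<bar> \<le> 2 * (2 + \<bar>Im s\<bar>)"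
proof -
  have 1: "\<bar>Re s - Re w\<bar> \<le> 1 / 60" "\<bar>Im s - Im w\<bar> \<le> 1 / 60"
    using abs_Re_le_cmod[of "s - w"] abs_Im_le_cmod[of "s - w"] assms(1) by auto
  show "1 - 1 / 60 \<le> Re w" "Re w \<le> 3"
    using abs_le_D1[OF 1(1)] abs_le_D2[OF 1(1)] assms(2,3) by linarith+
  have "\<bar>Im w\<bar> \<le> \<bar>Im s\<bar> + \<bar>Im s - Im w\<bar>" by linarith
  then have "\<bar>Im w\<bar> \<le> \<bar>Im s\<bar> + 1 / 60" using 1(2) by (rule order.trans[OF _ add_left_mono])
  then show "2 + \<bar>Im w\<bar> \<le> 2 * (2 + \<bar>Im s\<bar>)" using abs_ge_zero[of "Im s"] by (simp only: distrib_left)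
qed

definition height :: "complex \<Rightarrow> real" where "height s = 2 + \<bar>Im s\<bar>"
text \<open>The factor from \<open>zeta_reg_growth\<close> with e = 1/60. Later losses are powers of
  it, up to the fifteenth, which is the square root of the height.\<close>

definition small :: "complex \<Rightarrow> real" where "small s = height s powr (1 / 30)"

lemma height_ge_2: "height s \<ge> 2" by (simp add: height_def)
lemma small_ge_1: "small s \<ge> 1" unfolding small_def using height_ge_2[of s] by (intro ge_one_powr_ge_zero) auto

lemma small_double: "height w \<le> 2 * height s \<Longrightarrow> small w \<le> 2 * small s"
proof -
  assume h: "height w \<le> 2 * height s"
  have "small w \<le> (2 * height s) powr (1 / 30)"
    unfolding small_def using h height_ge_2[of w] by (intro powr_mono2) auto
  also have "\<dots> = 2 powr (1 / 30) * small s" unfolding small_def using height_ge_2[of s] by (simp add: powr_mult)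
  also have "\<dots> \<le> 2 powr 1 * small s" using small_ge_1[of s] by (intro mult_right_mono powr_mono) auto
  finally show ?thesis by simp
qed

lemma zeta_reg_bound:
  obtains C where "C > 0" "\<And>s. 1 - 1 / 60 \<le> Re s \<Longrightarrow> Re s \<le> 3 \<Longrightarrow> norm (zeta_reg s) \<le> C * height s * small s"
proof -
  have e: "2 * (1 / 60) = (1 / 30 :: real)" by simp
  show ?thesis
    by (rule zeta_reg_growth[of "1 / 60"]) (auto intro: that simp: height_def small_def e)
qed

lemma zeta_reg_deriv_bound:
  obtains C where "C > 0" "\<And>s j. 1 \<le> Re s \<Longrightarrow> Re s \<le> 2 \<Longrightarrow> j \<le> 3 \<Longrightarrow> norm ((deriv ^^ j) zeta_reg s) \<le> C * height s * small s"
proof -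
  obtain C where C: "C > 0" "\<And>s. 1 - 1 / 60 \<le> Re s \<Longrightarrow> Re s \<le> 3 \<Longrightarrow> norm (zeta_reg s) \<le> C * height s * small s"
    using zeta_reg_bound by blast
  show ?thesis
  proof (rule that[of "6 * 60 ^ 3 * (4 * C)"])
    fix s and j :: nat assume s: "1 \<le> Re s" "Re s \<le> 2" and j: "j \<le> 3"
    have "norm ((deriv ^^ j) zeta_reg s) \<le> 6 * 60 ^ 3 * (4 * C * height s * small s)"
    proof (rule deriv_power_bound[OF zeta_reg_holomorphic s(1) j])
      fix w assume w: "norm (s - w) = 1 / 60"
      note n = near_point_height[OF w s]
      have h: "height w \<le> 2 * height s" using n(3) by (simp add: height_def)
      have "norm (zeta_reg w) \<le> C * height w * small w" using n by (intro C)
      also have "\<dots> \<le> C * (2 * height s) * (2 * small s)"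
        using C h small_double[OF h] height_ge_2[of w] height_ge_2[of s] small_ge_1[of w]
        by (intro mult_mono) auto
      finally show "norm (zeta_reg w) \<le> 4 * C * height s * small s" by (simp add: mult_ac)
    qed
    then show "norm ((deriv ^^ j) zeta_reg s) \<le> 6 * 60 ^ 3 * (4 * C) * height s * small s" by (simp add: mult_ac)
  qed (use C in auto)
qed

text \<open>This is \<zeta>(s) - 1 / (s - 1) with its removable singularity filled, because
  \<open>zeta_reg 1 = 1\<close>.\<close>

definition zeta_rem :: "complex \<Rightarrow> complex" where
  "zeta_rem s = (if s = 1 then deriv zeta_reg 1 else (zeta_reg s - zeta_reg 1) / (s - 1))"

lemma zeta_rem_holomorphic: "zeta_rem holomorphic_on {s. Re s > 0}"
  unfolding zeta_rem_def
  by (rule pole_lemma[OF zeta_reg_holomorphic]) (simp add: interior_open open_halfspace_Re_gt)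

text \<open>Near 1 compactness suffices. Elsewhere |s - 1| is comparable with the height, so the
  division removes the factor \<open>height s\<close> from the bound for
  \<open>zeta_reg\<close>.\<close>

lemma zeta_rem_bound:
  obtains C where "C > 0" "\<And>s. 1 - 1 / 60 \<le> Re s \<Longrightarrow> Re s \<le> 3 \<Longrightarrow> norm (zeta_rem s) \<le> C * small s"
proof -
  obtain C where C: "C > 0" "\<And>s. 1 - 1 / 60 \<le> Re s \<Longrightarrow> Re s \<le> 3 \<Longrightarrow> norm (zeta_reg s) \<le> C * height s * small s"
    using zeta_reg_bound by blast
  have sub: "cball 1 (1 / 2) \<subseteq> {s. Re s > 0}"
  proof
    fix w :: complex assume "w \<in> cball 1 (1 / 2)"
    then have "norm (1 - w) \<le> 1 / 2" by (simp add: dist_norm)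
    then have "1 - Re w \<le> 1 / 2" using complex_Re_le_cmod[of "1 - w"] by simp
    then show "w \<in> {s. Re s > 0}" by simp
  qed
  have "compact (zeta_rem ` cball 1 (1 / 2))"
    by (intro compact_continuous_image holomorphic_on_imp_continuous_on holomorphic_on_subset[OF zeta_rem_holomorphic sub] compact_cball)
  then obtain B where B: "B > 0" "\<And>s. s \<in> cball 1 (1 / 2) \<Longrightarrow> norm (zeta_rem s) \<le> B"
    unfolding compact_eq_bounded_closed bounded_pos by blast
  show ?thesis
  proof (rule that[of "B + 5 * (C + 1)"])
    fix s assume s: "1 - 1 / 60 \<le> Re s" "Re s \<le> 3"
    show "norm (zeta_rem s) \<le> (B + 5 * (C + 1)) * small s"
    proof (cases "s \<in> cball 1 (1 / 2)")
      case True
      have "norm (zeta_rem s) \<le> B * 1" using B(2)[OF True] by simp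
      also have "\<dots> \<le> (B + 5 * (C + 1)) * small s" using B C small_ge_1[of s] by (intro mult_mono) auto
      finally show ?thesis .
    next
      case False
      then have "norm (s - 1) > 1 / 2" by (simp add: dist_norm norm_minus_commute)
      moreover have "norm (s - 1) \<ge> \<bar>Im s\<bar>" using abs_Im_le_cmod[of "s - 1"] by simp
      \<comment> \<open>Four copies of 1/2 < N and one of a \<le> N add up to 2 + a \<le> 5 *
        N.\<close>
      moreover have "(2 + a) / 5 \<le> N" if "1 / 2 < N" "a \<le> N" for a N :: real using that by simp
      ultimately have h: "norm (s - 1) \<ge> height s / 5" unfolding height_def by blast
      have "s \<noteq> 1" using False by auto
      then have "norm (zeta_rem s) = norm (zeta_reg s - 1) / norm (s - 1)"
        unfolding zeta_rem_def zeta_reg_1 by (simp add: norm_divide)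
      also have "\<dots> \<le> (C * height s * small s + height s * small s) / (height s / 5)"
      proof (intro frac_le)
        have "1 * 1 \<le> height s * small s" using height_ge_2[of s] small_ge_1[of s] by (intro mult_mono) auto
        then show "norm (zeta_reg s - 1) \<le> C * height s * small s + height s * small s"
          using C(2)[OF s] norm_triangle_ineq4[of "zeta_reg s" 1] by simp
      qed (use h height_ge_2[of s] small_ge_1[of s] C in \<open>auto intro!: add_nonneg_nonneg mult_nonneg_nonneg\<close>)
      also have "\<dots> = 5 * (C + 1) * small s" using height_ge_2[of s] by (simp add: field_simps)
      also have "\<dots> \<le> (B + 5 * (C + 1)) * small s" using B small_ge_1[of s] by (intro mult_right_mono) auto
      finally show ?thesis .
    qed
  qed (use B C in auto)
qed

lemma zeta_rem_deriv2_bound: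
  obtains C where "C > 0" "\<And>s. 1 \<le> Re s \<Longrightarrow> Re s \<le> 2 \<Longrightarrow> norm (deriv (deriv zeta_rem) s) \<le> C * small s"
proof -
  obtain C where C: "C > 0" "\<And>s. 1 - 1 / 60 \<le> Re s \<Longrightarrow> Re s \<le> 3 \<Longrightarrow> norm (zeta_rem s) \<le> C * small s"
    using zeta_rem_bound by blast
  show ?thesis
  proof (rule that[of "6 * 60 ^ 3 * (2 * C)"])
    fix s assume s: "1 \<le> Re s" "Re s \<le> 2"
    have "norm ((deriv ^^ 2) zeta_rem s) \<le> 6 * 60 ^ 3 * (2 * C * small s)"
    proof (rule deriv_power_bound[OF zeta_rem_holomorphic s(1)])
      fix w assume w: "norm (s - w) = 1 / 60"
      note n = near_point_height[OF w s]
      have h: "height w \<le> 2 * height s" using n(3) by (simp add: height_def)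
      have "norm (zeta_rem w) \<le> C * small w" using n by (intro C)
      also have "\<dots> \<le> C * (2 * small s)"
        using C small_double[OF h] by (intro mult_left_mono) auto
      finally show "norm (zeta_rem w) \<le> 2 * C * small s" by (simp add: mult_ac)
    qed simp
    then show "norm (deriv (deriv zeta_rem) s) \<le> 6 * 60 ^ 3 * (2 * C) * small s" by (simp add: mult_ac numeral_2_eq_2)
  qed (use C in auto)
qed

section \<open>The real part of the logarithm and its positivity properties\<close>

lemma Re_nat_powr:
  assumes "n > 0"
  shows "Re (of_nat n powr (-s)) = real n powr (- Re s) * cos (Im s * ln (real n))"
  using assms by (simp add: powr_def Ln_of_nat Re_exp mult.commute)

lemma log_zeta_Re_sums:
  assumes "Re s > 1"
  shows "(\<lambda>n. mangoldt n / ln (real n) * real n powr (- Re s) * cos (Im s * ln (real n))) sums Re (log_zeta s)"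
proof -
  have "(\<lambda>n. Re (of_real (mangoldt n / ln (real n)) * of_nat n powr (-s))) sums Re (log_zeta s)"
    unfolding log_zeta_def by (intro sums_Re dseries_sums dconv_log_zeta assms)
  also have "(\<lambda>n. Re (of_real (mangoldt n / ln (real n)) * of_nat n powr (-s))) =
      (\<lambda>n. mangoldt n / ln (real n) * real n powr (- Re s) * cos (Im s * ln (real n)))"
  proof
    fix n
    show "Re (of_real (mangoldt n / ln (real n)) * of_nat n powr (-s)) =
      mangoldt n / ln (real n) * real n powr (- Re s) * cos (Im s * ln (real n))"
      by (cases "n = 0") (simp_all add: Re_nat_powr del: of_real_divide)
  qed
  finally show ?thesis .
qed

lemma cos_3_4_1_nonneg: "3 + 4 * cos x + cos (2 * x) \<ge> (0 :: real)"
proof -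
  have "3 + 4 * cos x + cos (2 * x) = 2 * (1 + cos x) ^ 2"
    by (subst cos_double_cos) (simp add: power2_eq_square algebra_simps)
  then show ?thesis by simp
qed

lemma log_zeta_coeff_nonneg: "mangoldt n / ln (real n) * real n powr x \<ge> 0"
proof (cases "n = 0")
  case False
  then show ?thesis by (intro mult_nonneg_nonneg divide_nonneg_nonneg mangoldt_nonneg) auto
qed auto

lemma log_zeta_3_4_1:
  assumes "Re s > 1"
  shows "3 * Re (log_zeta (of_real (Re s))) + 4 * Re (log_zeta s) + Re (log_zeta (Complex (Re s) (2 * Im s))) \<ge> 0"
proof -
  define g where "g = (\<lambda>n::nat. mangoldt n / ln (real n) * real n powr (- Re s))"
  have A: "(\<lambda>n. 3 * (g n * cos (0 * ln (real n))) + 4 * (g n * cos (Im s * ln (real n))) + g n * cos (2 * Im s * ln (real n))) sums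
     (3 * Re (log_zeta (of_real (Re s))) + 4 * Re (log_zeta s) + Re (log_zeta (Complex (Re s) (2 * Im s))))"
    unfolding g_def using assms log_zeta_Re_sums[of "of_real (Re s)"] log_zeta_Re_sums[of s] log_zeta_Re_sums[of "Complex (Re s) (2 * Im s)"]
    by (intro sums_add sums_mult) auto
  have B: "3 * (g n * cos (0 * ln (real n))) + 4 * (g n * cos (Im s * ln (real n))) + g n * cos (2 * Im s * ln (real n)) \<ge> 0" for n
  proof -
    have "g n * (3 + 4 * cos (Im s * ln (real n)) + cos (2 * (Im s * ln (real n)))) \<ge> 0"
      unfolding g_def by (intro mult_nonneg_nonneg log_zeta_coeff_nonneg cos_3_4_1_nonneg)
    then show ?thesis by (simp add: algebra_simps)
  qed
  show ?thesis by (rule sums_le[OF _ sums_zero A]) (rule B)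
qed

text \<open>The crude inequality 1 + cos \<ge> 0 in place of 3-4-1. It is used where Re s stays away
  from 1 but Im s is too small for the main argument.\<close>

lemma log_zeta_Re_ge:
  assumes "Re s > 1"
  shows "Re (log_zeta s) \<ge> - Re (log_zeta (of_real (Re s)))"
proof -
  define g where "g = (\<lambda>n::nat. mangoldt n / ln (real n) * real n powr (- Re s))"
  have A: "(\<lambda>n. g n * cos (0 * ln (real n)) + g n * cos (Im s * ln (real n))) sums
     (Re (log_zeta (of_real (Re s))) + Re (log_zeta s))"
    unfolding g_def using assms log_zeta_Re_sums[of "of_real (Re s)"] log_zeta_Re_sums[of s]
    by (intro sums_add) auto
  have B: "g n * cos (0 * ln (real n)) + g n * cos (Im s * ln (real n)) \<ge> 0" for n
  proof -
    have "g n * (1 + cos (Im s * ln (real n))) \<ge> 0"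
      unfolding g_def using cos_ge_minus_one[of "Im s * ln (real n)"]
      by (intro mult_nonneg_nonneg[OF log_zeta_coeff_nonneg]) linarith
    then show ?thesis by (simp add: algebra_simps)
  qed
  have "0 \<le> Re (log_zeta (of_real (Re s))) + Re (log_zeta s)"
    by (rule sums_le[OF _ sums_zero A]) (rule B)
  then show ?thesis by linarith
qed

section \<open>A lower bound for the zeta function\<close>

lemma zeta_3_4_1:
  obtains K where "K > 0" "\<And>s. Re s > 1 \<Longrightarrow>
    norm (zeta (of_real (Re s))) ^ 3 * norm (zeta s) ^ 4 * norm (zeta (Complex (Re s) (2 * Im s))) \<ge> K"
    "\<And>s. Re s > 1 \<Longrightarrow> norm (zeta (of_real (Re s))) * norm (zeta s) \<ge> K"
proof -
  obtain C where C: "C \<noteq> 0" "\<And>s. Re s > 1 \<Longrightarrow> zeta s = C * exp (log_zeta s)"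
    using zeta_eq_exp by blast
  have n: "norm (zeta s) = norm C * exp (Re (log_zeta s))" if "Re s > 1" for s
    using C(2)[OF that] by (simp add: norm_mult)
  show ?thesis
  \<comment> \<open>The constant of \<open>zeta_eq_exp\<close> enters 3 + 4 + 1 = 8 times in the
    first product and twice in the second.\<close>
  proof (rule that[of "min (norm C ^ 8) (norm C ^ 2)"])
    fix s assume s: "Re s > 1"
    let ?a = "Re (log_zeta (of_real (Re s)))" and ?b = "Re (log_zeta s)" and ?c = "Re (log_zeta (Complex (Re s) (2 * Im s)))"
    let ?z = "norm (zeta (of_real (Re s))) ^ 3 * norm (zeta s) ^ 4 * norm (zeta (Complex (Re s) (2 * Im s)))"
    have "?z =
       (norm C * exp ?a) ^ 3 * (norm C * exp ?b) ^ 4 * (norm C * exp ?c)"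
      using n[of "of_real (Re s)"] n[of s] n[of "Complex (Re s) (2 * Im s)"] s by simp
    also have "\<dots> = (norm C ^ 3 * norm C ^ 4 * norm C) * (exp ?a ^ 3 * exp ?b ^ 4 * exp ?c)"
      by (simp only: power_mult_distrib mult_ac)
    also have "exp ?a ^ 3 * exp ?b ^ 4 * exp ?c = exp (3 * ?a + 4 * ?b + ?c)"
      by (simp add: exp_add flip: exp_of_nat_mult)
    also have "norm C ^ 3 * norm C ^ 4 * norm C = norm C ^ 8" by (simp flip: power_add power_Suc2)
    also have "norm C ^ 8 * exp (3 * ?a + 4 * ?b + ?c) \<ge> norm C ^ 8 * 1"
      using log_zeta_3_4_1[OF s] by (intro mult_left_mono) auto
    finally show "?z \<ge> min (norm C ^ 8) (norm C ^ 2)"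
      by simp
    have "norm (zeta (of_real (Re s))) * norm (zeta s) = (norm C * exp ?a) * (norm C * exp ?b)"
      using n[of "of_real (Re s)"] n[of s] s by simp
    also have "\<dots> = norm C ^ 2 * exp (?a + ?b)" by (simp add: exp_add power2_eq_square)
    also have "\<dots> \<ge> norm C ^ 2 * 1" using log_zeta_Re_ge[OF s] by (intro mult_left_mono) auto
    finally show "norm (zeta (of_real (Re s))) * norm (zeta s) \<ge> min (norm C ^ 8) (norm C ^ 2)" by simp
  qed (use C in auto)
qed

text \<open>The pole at 1 is simple: \<open>zeta_reg\<close> is bounded on the real segment, where
  \<open>height\<close> is 2.\<close>

lemma zeta_real_bound:
  obtains M where "M > 0" "\<And>x. 1 < x \<Longrightarrow> x \<le> 2 \<Longrightarrow> norm (zeta (of_real x)) \<le> M / (x - 1)"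
proof -
  obtain C where C: "C > 0" "\<And>s. 1 - 1 / 60 \<le> Re s \<Longrightarrow> Re s \<le> 3 \<Longrightarrow> norm (zeta_reg s) \<le> C * height s * small s"
    using zeta_reg_bound by blast
  show ?thesis
  proof (rule that[of "C * 2 * 2 powr (1 / 30)"])
    fix x :: real assume x: "1 < x" "x \<le> 2"
    have "norm (zeta_reg (of_real x)) \<le> C * height (of_real x) * small (of_real x)" using x by (intro C) auto
    also have "\<dots> = C * 2 * 2 powr (1 / 30)" by (simp add: height_def small_def)
    finally have "norm (zeta_reg (of_real x)) \<le> C * 2 * 2 powr (1 / 30)" .
    moreover have "norm (zeta_reg (of_real x)) = (x - 1) * norm (zeta (of_real x))"
      using zeta_reg_eq[of "of_real x"] x norm_of_real[of "x - 1", where 'a = complex] by (simp add: norm_mult)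
    ultimately show "norm (zeta (of_real x)) \<le> C * 2 * 2 powr (1 / 30) / (x - 1)"
      using x by (simp add: field_simps)
  qed (use C in auto)
qed

lemma zeta_reg_ne_0: "Re s > 1 \<Longrightarrow> zeta_reg s \<noteq> 0"
proof -
  assume s: "Re s > 1"
  obtain C where C: "C \<noteq> 0" "\<And>s. Re s > 1 \<Longrightarrow> zeta s = C * exp (log_zeta s)"
    using zeta_eq_exp by blast
  then show ?thesis using zeta_reg_eq[OF s] s by auto
qed

text \<open>The 3-4-1 inequality solved for its middle factor: the pole bounds the cube by a
  multiple of (Re s - 1)^(-3), and the growth bound controls the factor at height 2 * Im s. For |Im
  s| \<ge> \<delta> the distances to the pole are comparable with the height, so passing from
  \<open>zeta\<close> to \<open>zeta_reg\<close> produces \<open>height s ^ 4\<close>.\<close>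

lemma zeta_reg_power4_lower:
  assumes \<delta>: "0 < \<delta>" "\<delta> \<le> 1"
  obtains c where "c > 0" "\<And>s. 1 < Re s \<Longrightarrow> Re s \<le> 2 \<Longrightarrow> \<bar>Im s\<bar> \<ge> \<delta> \<Longrightarrow>
    norm (zeta_reg s) ^ 4 * small s \<ge> c * (Re s - 1) ^ 3 * height s ^ 4"
proof -
  obtain C where C: "C > 0" "\<And>s. 1 - 1 / 60 \<le> Re s \<Longrightarrow> Re s \<le> 3 \<Longrightarrow> norm (zeta_reg s) \<le> C * height s * small s"
    using zeta_reg_bound by blast
  obtain M where M: "M > 0" "\<And>x. 1 < x \<Longrightarrow> x \<le> 2 \<Longrightarrow> norm (zeta (of_real x)) \<le> M / (x - 1)"
    using zeta_real_bound by blast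
  obtain K where K: "K > 0" "\<And>s. Re s > 1 \<Longrightarrow>
    norm (zeta (of_real (Re s))) ^ 3 * norm (zeta s) ^ 4 * norm (zeta (Complex (Re s) (2 * Im s))) \<ge> K"
    using zeta_3_4_1 by metis
  show ?thesis
  proof (rule that[of "K / (M ^ 3 * (3 / \<delta>) ^ 4 * (6 * C / \<delta>))"])
    show "K / (M ^ 3 * (3 / \<delta>) ^ 4 * (6 * C / \<delta>)) > 0" using K M C \<delta> by simp
    fix s assume s: "1 < Re s" "Re s \<le> 2" "\<bar>Im s\<bar> \<ge> \<delta>"
    define x where "x = Re s - 1"
    define h where "h = height s"
    define r where "r = norm (zeta_reg s)"
    define X where "X = small s"
    have x: "x > 0" using s by (simp add: x_def)
    have h: "h \<ge> 2" unfolding h_def by (rule height_ge_2)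
    have X: "X \<ge> 1" unfolding X_def by (rule small_ge_1)
    have Im_ge: "\<bar>Im s\<bar> \<ge> \<delta> * h / 3"
    proof -
      have "\<delta> * h = 2 * \<delta> + \<delta> * \<bar>Im s\<bar>" by (simp add: h_def height_def algebra_simps)
      also have "\<dots> \<le> 2 * \<bar>Im s\<bar> + 1 * \<bar>Im s\<bar>" using s \<delta> by (intro add_mono mult_left_mono mult_right_mono) auto
      finally show ?thesis by simp
    qed
    have a: "norm (zeta (of_real (Re s))) \<le> M / x" unfolding x_def using s by (intro M)
    have b: "norm (zeta s) \<le> 3 / \<delta> * (r / h)"
    proof -
      have "\<delta> * h / 3 \<le> norm (s - 1)" using Im_ge abs_Im_le_cmod[of "s - 1"] by simp
      moreover have "\<delta> * h / 3 > 0" using \<delta> h by simp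
      moreover have "norm (zeta s) = r / norm (s - 1)"
        using zeta_reg_eq[of s] s by (auto simp: r_def norm_mult)
      moreover have "r / norm (s - 1) \<le> r / (\<delta> * h / 3)"
        using calculation(1,2) by (intro divide_left_mono mult_pos_pos) (auto simp: r_def)
      ultimately show ?thesis by (simp add: mult_ac)
    qed
    have c: "norm (zeta (Complex (Re s) (2 * Im s))) \<le> 6 * C / \<delta> * X"
    proof -
      let ?w = "Complex (Re s) (2 * Im s)"
      have w1: "2 * (\<delta> * h / 3) \<le> norm (?w - 1)" using Im_ge abs_Im_le_cmod[of "?w - 1"] by (simp add: abs_mult)
      have w0: "2 * (\<delta> * h / 3) > 0" using \<delta> h by simp
      have hw: "height ?w \<le> 2 * height s" by (simp add: height_def abs_mult)
      have "norm (zeta_reg ?w) \<le> C * height ?w * small ?w" using s by (intro C) auto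
      also have "\<dots> \<le> C * (2 * h) * (2 * X)" unfolding h_def X_def
        using C hw small_double[OF hw] height_ge_2[of ?w] height_ge_2[of s] small_ge_1[of ?w]
        by (intro mult_mono) auto
      finally have w2: "norm (zeta_reg ?w) \<le> C * (2 * h) * (2 * X)" .
      have "?w \<noteq> 1" using s by (auto simp: complex_eq_iff)
      then have "norm (zeta ?w) = norm (zeta_reg ?w) / norm (?w - 1)"
        using zeta_reg_eq[of ?w] s by (simp add: norm_mult)
      also have "\<dots> \<le> C * (2 * h) * (2 * X) / (2 * (\<delta> * h / 3))" using w0 w1 w2 h X C by (intro frac_le) auto
      also have "\<dots> = 6 * C / \<delta> * X" using h by (simp add: field_simps)
      finally show ?thesis .
    qed
    have r0: "r \<ge> 0" by (simp add: r_def)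
    have "K \<le> norm (zeta (of_real (Re s))) ^ 3 * norm (zeta s) ^ 4 * norm (zeta (Complex (Re s) (2 * Im s)))"
      by (rule K(2)[OF s(1)])
    also have "\<dots> \<le> (M / x) ^ 3 * (3 / \<delta> * (r / h)) ^ 4 * (6 * C / \<delta> * X)"
      using M x \<delta> r0 h by (intro mult_mono power_mono a b c) auto
    also have "\<dots> = (M ^ 3 * (3 / \<delta>) ^ 4 * (6 * C / \<delta>)) * (r ^ 4 * X / (x ^ 3 * h ^ 4))"
    proof -
      have "(M / x) ^ 3 * (t * (r / h)) ^ 4 * (u * X) = (M ^ 3 * t ^ 4 * u) * (r ^ 4 * X / (x ^ 3 * h ^ 4))" for t u
        by (simp add: power_divide power_mult_distrib)
      then show ?thesis .
    qed
    finally have "K \<le> (M ^ 3 * (3 / \<delta>) ^ 4 * (6 * C / \<delta>)) * (r ^ 4 * X / (x ^ 3 * h ^ 4))" .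
    moreover have "M ^ 3 * (3 / \<delta>) ^ 4 * (6 * C / \<delta>) > 0" using M C \<delta> by simp
    moreover have "x ^ 3 * h ^ 4 > 0" using x h by simp
    moreover have "K / A * P \<le> R" if "K \<le> A * (R / P)" "A > 0" "P > 0" for A P R :: real
      using that by (simp add: field_simps)
    ultimately have "K / (M ^ 3 * (3 / \<delta>) ^ 4 * (6 * C / \<delta>)) * (x ^ 3 * h ^ 4) \<le> r ^ 4 * X" by blast
    then show "norm (zeta_reg s) ^ 4 * small s \<ge> K / (M ^ 3 * (3 / \<delta>) ^ 4 * (6 * C / \<delta>)) * (Re s - 1) ^ 3 * height s ^ 4"
      unfolding x_def h_def r_def X_def by (simp only: mult.assoc)
  qed
qed

text \<open>On a horizontal segment \<open>height\<close> and \<open>small\<close> are constant, so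
  the bound for the derivative is uniform along it.\<close>

lemma zeta_reg_lipschitz:
  obtains C where "C > 0" "\<And>s x. 1 \<le> Re s \<Longrightarrow> Re s \<le> x \<Longrightarrow> x \<le> 2 \<Longrightarrow>
    norm (zeta_reg s - zeta_reg (Complex x (Im s))) \<le> C * height s * small s * (x - Re s)"
proof -
  obtain C where C: "C > 0" "\<And>s j. 1 \<le> Re s \<Longrightarrow> Re s \<le> 2 \<Longrightarrow> j \<le> 3 \<Longrightarrow> norm ((deriv ^^ j) zeta_reg s) \<le> C * height s * small s"
    by (rule zeta_reg_deriv_bound) (rule that)
  show ?thesis
  proof (rule that[OF C(1)])
    fix s x assume s: "1 \<le> Re s" "Re s \<le> x" "x \<le> 2"
    let ?w = "Complex x (Im s)"
    have seg: "1 \<le> Re z \<and> Re z \<le> 2 \<and> Im z = Im s" if z: "z \<in> closed_segment s ?w" for z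
    proof -
      obtain u where u: "0 \<le> u" "u \<le> 1" "z = (1 - u) *\<^sub>R s + u *\<^sub>R ?w"
        using z unfolding closed_segment_def by auto
      have A: "Re z = (1 - u) * Re s + u * x" "Im z = Im s"
        using arg_cong[OF u(3), of Re] arg_cong[OF u(3), of Im] by (simp_all add: left_diff_distrib)
      have "(1 - u) * 1 + u * 1 \<le> Re z" unfolding A(1)
        using u(1,2) s by (intro add_mono mult_left_mono) auto
      moreover have "Re z \<le> (1 - u) * 2 + u * 2" unfolding A(1)
        using u(1,2) s by (intro add_mono mult_left_mono) auto
      ultimately have "1 \<le> Re z" "Re z \<le> 2" by (simp_all only: left_diff_distrib)
      with A(2) show ?thesis by simp
    qed
    have "norm (zeta_reg s - zeta_reg ?w) \<le> C * height s * small s * norm (s - ?w)"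
    proof (rule field_differentiable_bound[of "closed_segment s ?w"])
      fix z assume z: "z \<in> closed_segment s ?w"
      show "(zeta_reg has_field_derivative deriv zeta_reg z) (at z within closed_segment s ?w)"
        using seg[OF z]
        by (intro holomorphic_derivI[OF zeta_reg_holomorphic open_halfspace_Re_gt, THEN has_field_derivative_at_within]) simp
      have "norm (deriv zeta_reg z) \<le> C * height z * small z" using C(2)[of z 1] seg[OF z] by simp
      then show "norm (deriv zeta_reg z) \<le> C * height s * small s"
        using seg[OF z] by (simp add: height_def small_def)
    qed auto
    also have "s - ?w = of_real (Re s - x)" by (simp add: complex_eq_iff)
    also have "norm (of_real (Re s - x) :: complex) = x - Re s" using s by (simp only: norm_of_real)
    finally show "norm (zeta_reg s - zeta_reg ?w) \<le> C * height s * small s * (x - Re s)" .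
  qed
qed

text \<open>The 3-4-1 bound degenerates as Re s tends to 1, but at distance \<eta> from the line it
  is of order \<eta>^(3/4), whereas moving from there towards the line changes the function by at
  most a multiple of \<eta>. For small \<eta> the first dominates, which gives a bound uniform up to
  the line.\<close>

lemma zeta_reg_lower_away:
  assumes \<delta>: "0 < \<delta>" "\<delta> \<le> 1"
  obtains c where "c > 0" "\<And>s. 1 < Re s \<Longrightarrow> Re s \<le> 2 \<Longrightarrow> \<bar>Im s\<bar> \<ge> \<delta> \<Longrightarrow>
    norm (zeta_reg s) * small s ^ 4 \<ge> c * height s"
proof -
  obtain c1 where c1: "c1 > 0" "\<And>s. 1 < Re s \<Longrightarrow> Re s \<le> 2 \<Longrightarrow> \<bar>Im s\<bar> \<ge> \<delta> \<Longrightarrow>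
    norm (zeta_reg s) ^ 4 * small s \<ge> c1 * (Re s - 1) ^ 3 * height s ^ 4"
    using zeta_reg_power4_lower[OF \<delta>] by blast
  obtain C where C: "C > 0" "\<And>s x. 1 \<le> Re s \<Longrightarrow> Re s \<le> x \<Longrightarrow> x \<le> 2 \<Longrightarrow>
    norm (zeta_reg s - zeta_reg (Complex x (Im s))) \<le> C * height s * small s * (x - Re s)"
    using zeta_reg_lipschitz by blast
  \<comment> \<open>A substitute for the fourth root of c1.\<close>
  define c2 where "c2 = min 1 c1"
  have c2: "0 < c2" "c2 ^ 4 \<le> c1"
  proof -
    show "0 < c2" using c1 by (simp add: c2_def)
    have "c2 ^ 4 \<le> c2 ^ 1" using c1 by (intro power_decreasing) (auto simp: c2_def)
    then show "c2 ^ 4 \<le> c1" by (simp add: c2_def)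
  qed
  \<comment> \<open>Chosen so that the horizontal change, which has the factor \<open>C * d\<close>,
    is at most half of the lower bound at distance \<eta>.\<close>
  define d where "d = min 1 (c2 / (2 * C))"
  have d: "0 < d" "d \<le> 1" "C * d \<le> c2 / 2"
    using C c2 by (auto simp: d_def min_def field_simps)
  have far: "norm (zeta_reg s) * small s ^ 4 \<ge> c2 * d ^ 3 * height s"
    if s: "1 < Re s" "Re s \<le> 2" "\<bar>Im s\<bar> \<ge> \<delta>" "Re s - 1 \<ge> d ^ 4 / small s ^ 5" for s
  proof -
    define X h r where "X = small s" and "h = height s" and "r = norm (zeta_reg s)"
    have X: "X \<ge> 1" unfolding X_def by (rule small_ge_1)
    have h: "h \<ge> 2" unfolding h_def by (rule height_ge_2)
    \<comment> \<open>With Re s - 1 \<ge> d^4 / X^5 the fourth-power bound reads r^4 * X \<ge> c1 *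
      d^12 * X^(-15) * h^4. Multiplying by X^15 makes both sides fourth powers up to the
      constant.\<close>
    have "(c2 * d ^ 3 * h) ^ 4 = (c2 ^ 4 * (d ^ 4 / X ^ 5) ^ 3 * h ^ 4) * X ^ 15"
      using X by (simp add: power_mult_distrib power_divide flip: power_mult)
    also have "\<dots> \<le> (c1 * (Re s - 1) ^ 3 * h ^ 4) * X ^ 15"
      using c2 c1 s d X h unfolding X_def
      by (intro mult_mono power_mono) auto
    also have "\<dots> \<le> (r ^ 4 * X) * X ^ 15"
      using c1(2)[OF s(1-3)] X unfolding X_def h_def r_def by (intro mult_right_mono) auto
    also have "\<dots> = (r * X ^ 4) ^ 4"
      by (simp add: power_mult_distrib flip: power_mult power_Suc)
    finally have "c2 * d ^ 3 * h \<le> r * X ^ 4"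
      by (rule power_le_imp_le_base[of _ 3, unfolded eval_nat_numeral, simplified] power_mono_iff[THEN iffD1, rotated -1])
         (use X c2 d h in \<open>auto simp: r_def\<close>)
    then show ?thesis unfolding X_def h_def r_def .
  qed
  show ?thesis
  proof (rule that[of "c2 * d ^ 3 / 2"])
    show "c2 * d ^ 3 / 2 > 0" using c2 d by simp
    fix s assume s: "1 < Re s" "Re s \<le> 2" "\<bar>Im s\<bar> \<ge> \<delta>"
    define X h where "X = small s" and "h = height s"
    have X: "X \<ge> 1" unfolding X_def by (rule small_ge_1)
    have h: "h \<ge> 2" unfolding h_def by (rule height_ge_2)
    define \<eta> where "\<eta> = d ^ 4 / X ^ 5"
    have \<eta>: "\<eta> > 0" "\<eta> \<le> 1" using X d
      by (auto simp: \<eta>_def divide_le_eq power_le_one intro!: order.trans[OF power_le_one one_le_power])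
    show "norm (zeta_reg s) * small s ^ 4 \<ge> c2 * d ^ 3 / 2 * height s"
    proof (cases "Re s - 1 \<ge> \<eta>")
      case True
      then have "c2 * d ^ 3 * height s \<le> norm (zeta_reg s) * small s ^ 4"
        using s unfolding \<eta>_def X_def by (intro far)
      moreover have "c2 * d ^ 3 / 2 * height s \<le> c2 * d ^ 3 * height s"
        using c2 d height_ge_2[of s] by (intro mult_right_mono) auto
      ultimately show ?thesis by linarith
    next
      case False
      \<comment> \<open>The comparison point on the same horizontal line; the change up to it is at
        most C * h * X * \<eta> = (C * d) * d^3 * h / X^4.\<close>
      let ?w = "Complex (1 + \<eta>) (Im s)"
      have eqs: "small ?w = X" "height ?w = h" by (simp_all add: small_def height_def X_def h_def)
      have w: "norm (zeta_reg ?w) * X ^ 4 \<ge> c2 * d ^ 3 * h"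
        using far[of ?w] \<eta> s unfolding eqs by (simp add: \<eta>_def)
      have "norm (zeta_reg s - zeta_reg ?w) \<le> C * h * X * ((1 + \<eta>) - Re s)"
        unfolding h_def X_def using s False \<eta> by (intro C) auto
      also have "\<dots> \<le> C * h * X * \<eta>" using C h X s by (intro mult_left_mono) auto
      finally have "norm (zeta_reg s - zeta_reg ?w) * X ^ 4 \<le> (C * h * X * \<eta>) * X ^ 4"
        using X by (intro mult_right_mono) auto
      also have "\<dots> = (C * d) * d ^ 3 * h"
        using X by (simp add: \<eta>_def field_simps power_Suc eval_nat_numeral)
      also have "\<dots> \<le> (c2 / 2) * d ^ 3 * h" using d h by (intro mult_right_mono) auto
      finally have 1: "norm (zeta_reg s - zeta_reg ?w) * X ^ 4 \<le> c2 / 2 * d ^ 3 * h" .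
      have "norm (zeta_reg ?w) \<le> norm (zeta_reg s) + norm (zeta_reg s - zeta_reg ?w)"
        using norm_triangle_sub[of "zeta_reg ?w" "zeta_reg s"] by (simp add: norm_minus_commute)
      then have "norm (zeta_reg ?w) * X ^ 4 \<le> (norm (zeta_reg s) + norm (zeta_reg s - zeta_reg ?w)) * X ^ 4"
        using X by (intro mult_right_mono) auto
      then have "c2 * d ^ 3 * h \<le> norm (zeta_reg s) * X ^ 4 + c2 / 2 * d ^ 3 * h"
        using w 1 by (simp add: distrib_right)
      then show ?thesis unfolding X_def h_def by simp
    qed
  qed
qed

text \<open>Low heights are added: close to 1 by continuity and \<open>zeta_reg 1 = 1\<close>, and
  for Re s \<ge> 1 + \<delta> by the inequality 1 + cos \<ge> 0.\<close>

lemma zeta_reg_lower: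
  obtains c where "c > 0" "\<And>s. 1 < Re s \<Longrightarrow> Re s \<le> 2 \<Longrightarrow> norm (zeta_reg s) * small s ^ 4 \<ge> c * height s"
proof -
  have "continuous (at 1) zeta_reg"
    using holomorphic_on_imp_continuous_on[OF zeta_reg_holomorphic] open_halfspace_Re_gt[of 0]
    by (simp add: continuous_on_eq_continuous_at)
  then obtain \<delta>0 where \<delta>0: "\<delta>0 > 0" "\<And>s. dist s 1 < \<delta>0 \<Longrightarrow> dist (zeta_reg s) (zeta_reg 1) < 1 / 2"
    unfolding continuous_at_eps_delta by (metis half_gt_zero zero_less_one)
  define \<delta> where "\<delta> = min 1 (\<delta>0 / 2)"
  have \<delta>: "0 < \<delta>" "\<delta> \<le> 1" "2 * \<delta> \<le> \<delta>0" using \<delta>0 by (auto simp: \<delta>_def)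
  obtain c where c: "c > 0" "\<And>s. 1 < Re s \<Longrightarrow> Re s \<le> 2 \<Longrightarrow> \<bar>Im s\<bar> \<ge> \<delta> \<Longrightarrow>
    norm (zeta_reg s) * small s ^ 4 \<ge> c * height s"
    using zeta_reg_lower_away[OF \<delta>(1,2)] by blast
  obtain M where M: "M > 0" "\<And>x. 1 < x \<Longrightarrow> x \<le> 2 \<Longrightarrow> norm (zeta (of_real x)) \<le> M / (x - 1)"
    using zeta_real_bound by blast
  obtain K where K: "K > 0" "\<And>s. Re s > 1 \<Longrightarrow> norm (zeta (of_real (Re s))) * norm (zeta s) \<ge> K"
    using zeta_3_4_1 by metis
  \<comment> \<open>The factor 3 is the bound for the height when |Im s| < \<delta> \<le> 1.\<close>
  define c' where "c' = min (1 / 6) (\<delta> * (K * \<delta> / M) / 3)"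
  have c': "c' > 0" "3 * c' \<le> 1 / 2" "3 * c' \<le> \<delta> * (K * \<delta> / M)" using \<delta> K M by (auto simp: c'_def min_def mult_ac)
  show ?thesis
  proof (rule that[of "min c c'"])
    fix s assume s: "1 < Re s" "Re s \<le> 2"
    show "norm (zeta_reg s) * small s ^ 4 \<ge> min c c' * height s"
    proof (cases "\<bar>Im s\<bar> \<ge> \<delta>")
      case True
      have "min c c' * height s \<le> c * height s" using height_ge_2[of s] by (intro mult_right_mono) auto
      then show ?thesis using c(2)[OF s True] by linarith
    next
      case False
      have "norm (zeta_reg s) \<ge> 3 * c'"
      proof (cases "Re s \<ge> 1 + \<delta>")
        case True
        have "K \<le> norm (zeta (of_real (Re s))) * norm (zeta s)" using s by (intro K)
        also have "\<dots> \<le> M / \<delta> * norm (zeta s)"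
        proof (rule mult_right_mono)
          have "norm (zeta (of_real (Re s))) \<le> M / (Re s - 1)" using s by (intro M)
          also have "\<dots> \<le> M / \<delta>" using True \<delta> M s by (intro divide_left_mono) auto
          finally show "norm (zeta (of_real (Re s))) \<le> M / \<delta>" .
        qed auto
        finally have 1: "norm (zeta s) \<ge> K * \<delta> / M" using M \<delta> by (simp add: field_simps)
        have 2: "norm (s - 1) \<ge> \<delta>" using True abs_Re_le_cmod[of "s - 1"] by simp
        have "3 * c' \<le> \<delta> * (K * \<delta> / M)" by (rule c')
        also have "\<dots> \<le> norm (s - 1) * norm (zeta s)" using 1 2 \<delta> K M by (intro mult_mono) auto
        also have "\<dots> = norm (zeta_reg s)" using zeta_reg_eq[OF s(1)] by (simp add: norm_mult)
        finally show ?thesis .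
      next
        case False
        have "norm (s - 1) \<le> \<bar>Re s - 1\<bar> + \<bar>Im s\<bar>" using cmod_le[of "s - 1"] by simp
        also have "\<dots> < \<delta> + \<delta>" using False \<open>\<not>\<bar>Im s\<bar> \<ge> \<delta>\<close> s by (intro add_strict_mono) auto
        finally have "dist s 1 < \<delta>0" using \<delta> by (simp add: dist_norm)
        then have "norm (zeta_reg s - 1) < 1 / 2" using \<delta>0(2)[of s] by (simp add: zeta_reg_1 dist_norm)
        moreover have "norm (1 :: complex) \<le> norm (zeta_reg s) + norm (zeta_reg s - 1)"
          using norm_triangle_sub[of 1 "zeta_reg s"] by (simp add: norm_minus_commute)
        ultimately have "norm (zeta_reg s) > 1 / 2" by simp
        then show ?thesis using c'(2) by linarith
      qed
      moreover have "height s \<le> 3" using False \<delta> by (simp add: height_def)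
      then have "min c c' * height s \<le> c' * 3" using c' height_ge_2[of s] by (intro mult_mono) auto
      moreover have "norm (zeta_reg s) * 1 \<le> norm (zeta_reg s) * small s ^ 4"
        using small_ge_1[of s] by (intro mult_left_mono one_le_power) auto
      ultimately show ?thesis by linarith
    qed
  qed (use c c' in auto)
qed

text \<open>As \<open>zeta_reg s\<close> = (s - 1) * \<zeta>(s), the logarithmic derivative of
  \<open>zeta_reg\<close> is that of \<zeta> plus 1 / (s - 1). The poles of -\<zeta>'/\<zeta> and of
  \<zeta> at 1 therefore cancel, and the right-hand side is regular there.\<close>

lemma dseries_mangoldt_minus_1:
  assumes s: "Re s > 1"
  shows "dseries (\<lambda>n. mangoldt n - 1) s = - deriv zeta_reg s / zeta_reg s - zeta_rem s"
proof -
  let ?E = "zeta_reg s" and ?D = "dseries mangoldt s"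
  have E: "?E = (s - 1) * zeta s" "?E \<noteq> 0" "s \<noteq> 1" using zeta_reg_eq[OF s] zeta_reg_ne_0[OF s] s by auto
  have "((\<lambda>s. (s - 1) * zeta s) has_field_derivative (zeta s - (s - 1) * (zeta s * ?D))) (at s)"
    by (rule derivative_eq_intros zeta_deriv[OF s] refl)+ (simp add: algebra_simps)
  then have "(zeta_reg has_field_derivative (zeta s - (s - 1) * (zeta s * ?D))) (at s)"
    by (rule has_field_derivative_transform_within_open[OF _ open_halfspace_Re_gt[of 1]]) (use s zeta_reg_eq in auto)
  then have "deriv zeta_reg s = zeta s - ?E * ?D" using E by (simp add: DERIV_imp_deriv)
  moreover have z: "zeta s = ?E / (s - 1)" using E by simp
  ultimately have "?E * ?D = ?E / (s - 1) - deriv zeta_reg s" by simp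
  then have "?D = (?E / (s - 1) - deriv zeta_reg s) / ?E" using E(2) by (simp add: nonzero_eq_divide_eq mult.commute)
  then have "?D = 1 / (s - 1) - deriv zeta_reg s / ?E" using E(2) by (simp add: diff_divide_distrib)
  moreover have "dseries (\<lambda>n. mangoldt n - 1) s = ?D - zeta s"
    unfolding zeta_def by (intro dseries_diff dconv_mangoldt dconv_1 s)
  moreover have "zeta_rem s = (?E - 1) / (s - 1)" using E by (simp add: zeta_rem_def zeta_reg_1)
  ultimately show ?thesis unfolding z by (simp add: diff_divide_distrib)
qed

text \<open>Each logarithm in the coefficients is one derivative with a minus sign. The right-hand
  side is written in the quotients of derivatives by \<open>zeta_reg\<close>, which are what can be
  bounded.\<close>

lemma dseries_mangoldt_minus_1_ln_ln:
  assumes s: "Re s > 1"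
  defines "E \<equiv> zeta_reg s" and "E1 \<equiv> deriv zeta_reg s" and "E2 \<equiv> deriv (deriv zeta_reg) s" and "E3 \<equiv> deriv (deriv (deriv zeta_reg)) s"
  shows "dseries (\<lambda>n. (mangoldt n - 1) * ln (real n) * ln (real n)) s =
    - (E3 / E - 3 * (E1 / E) * (E2 / E) + 2 * (E1 / E) ^ 3 + deriv (deriv zeta_rem) s)"
proof -
  define a :: "nat \<Rightarrow> real" where "a = (\<lambda>n. mangoldt n - 1)"
  have a: "dconv a" unfolding a_def by (intro dconv_diff dconv_mangoldt dconv_1)
  let ?S = "{s. Re s > 0}" and ?H = "{s::complex. Re s > 1}"
  have op: "open ?S" "open ?H" by (rule open_halfspace_Re_gt)+
  have h0: "zeta_reg holomorphic_on ?S" by (rule zeta_reg_holomorphic)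
  have h1: "deriv zeta_reg holomorphic_on ?S" by (intro holomorphic_deriv h0 op)
  have h2: "deriv (deriv zeta_reg) holomorphic_on ?S" by (intro holomorphic_deriv h1 op)
  have z0: "zeta_rem holomorphic_on ?S" by (rule zeta_rem_holomorphic)
  have z1: "deriv zeta_rem holomorphic_on ?S" by (intro holomorphic_deriv z0 op)
  have d: "(f has_field_derivative deriv f x) (at x)" if "f holomorphic_on ?S" "Re x > 1" for f x
    using that by (intro holomorphic_derivI[OF _ op(1)]) auto
  define Q where "Q = (\<lambda>x. (deriv (deriv zeta_reg) x * zeta_reg x - deriv zeta_reg x * deriv zeta_reg x) / (zeta_reg x * zeta_reg x) + deriv zeta_rem x)"
  have 1: "dseries (\<lambda>n. a n * ln (real n)) x = Q x" if x: "Re x > 1" for x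
  proof -
    have "((\<lambda>x. - deriv zeta_reg x / zeta_reg x - zeta_rem x) has_field_derivative
        ((- deriv (deriv zeta_reg) x * zeta_reg x - (- deriv zeta_reg x) * deriv zeta_reg x) / (zeta_reg x * zeta_reg x) - deriv zeta_rem x)) (at x)"
      by (intro DERIV_diff DERIV_divide DERIV_minus d h0 h1 z0 x zeta_reg_ne_0)
    then have "(dseries a has_field_derivative
        ((- deriv (deriv zeta_reg) x * zeta_reg x - (- deriv zeta_reg x) * deriv zeta_reg x) / (zeta_reg x * zeta_reg x) - deriv zeta_rem x)) (at x)"
      by (rule has_field_derivative_transform_within_open[OF _ op(2)]) (use x dseries_mangoldt_minus_1 in \<open>auto simp: a_def\<close>)
    from DERIV_unique[OF this has_field_derivative_dseries[OF a x]]
    have "dseries (\<lambda>n. a n * ln (real n)) x = - ((- deriv (deriv zeta_reg) x * zeta_reg x - (- deriv zeta_reg x) * deriv zeta_reg x) / (zeta_reg x * zeta_reg x) - deriv zeta_rem x)"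
      by simp
    moreover have "- ((- u * e - (- v) * v) / d - z) = (u * e - v * v) / d + z" for u e v d z :: complex
      by (simp add: diff_divide_distrib add_divide_distrib)
    ultimately show ?thesis unfolding Q_def by simp
  qed
  let ?num = "((E3 * E + E1 * E2) - (E2 * E1 + E2 * E1)) * (E * E) - (E2 * E - E1 * E1) * (E1 * E + E1 * E)"
  have E0: "E \<noteq> 0" unfolding E_def by (rule zeta_reg_ne_0[OF s])
  have "(Q has_field_derivative
      (?num / ((E * E) * (E * E)) + deriv (deriv zeta_rem) s)) (at s)"
    unfolding Q_def E_def E1_def E2_def E3_def
    by (intro DERIV_add DERIV_divide DERIV_diff DERIV_mult d h0 h1 h2 z1 s) (use zeta_reg_ne_0[OF s] in auto)
  then have "(dseries (\<lambda>n. a n * ln (real n)) has_field_derivative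
      (?num / ((E * E) * (E * E)) + deriv (deriv zeta_rem) s)) (at s)"
    by (rule has_field_derivative_transform_within_open[OF _ op(2)]) (use s 1 in auto)
  from arg_cong[OF DERIV_unique[OF has_field_derivative_dseries[OF dconv_mult_ln[OF a] s] this], of uminus]
  have "dseries (\<lambda>n. a n * ln (real n) * ln (real n)) s =
    - (?num / ((E * E) * (E * E)) + deriv (deriv zeta_rem) s)"
    by (simp only: minus_minus)
  also have "?num / ((E * E) * (E * E)) =
     E3 / E - 3 * (E1 / E) * (E2 / E) + 2 * (E1 / E) ^ 3"
  proof -
    \<comment> \<open>Substituting E1 = u * E, E2 = v * E and E3 = w * E turns the quotient rule
      into a polynomial identity.\<close>
    have *: "(((w * E * E + (u * E) * (v * E)) - (v * E * (u * E) + v * E * (u * E))) * (E * E) - (v * E * E - u * E * (u * E)) * (u * E * E + u * E * E))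
       = ((E * E) * (E * E)) * (w - 3 * u * v + 2 * u ^ 3)" for u v w
      by (simp add: algebra_simps power3_eq_cube)
    have "E1 = E1 / E * E" "E2 = E2 / E * E" "E3 = E3 / E * E" using E0 by simp_all
    with *[of "E3 / E" "E1 / E" "E2 / E"] have "?num =
       ((E * E) * (E * E)) * (E3 / E - 3 * (E1 / E) * (E2 / E) + 2 * (E1 / E) ^ 3)" by (simp only:)
    then show ?thesis using E0 by (simp only: nonzero_mult_div_cancel_left mult_eq_0_iff simp_thms)
  qed
  finally show ?thesis unfolding a_def .
qed

text \<open>In each quotient the heights cancel: the numerator brings one factor
  \<open>small s\<close>, and the lower bound for \<open>zeta_reg\<close> four more. The cube of the
  first quotient is the worst term.\<close>

lemma dseries_mangoldt_minus_1_bound: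
  obtains C where "C > 0" "\<And>s. 1 < Re s \<Longrightarrow> Re s \<le> 2 \<Longrightarrow>
    norm (dseries (\<lambda>n. (mangoldt n - 1) * ln (real n) * ln (real n)) s) \<le> C * (2 + \<bar>Im s\<bar>) powr (1 / 2)"
proof -
  obtain C1 where C1: "C1 > 0" "\<And>s j. 1 \<le> Re s \<Longrightarrow> Re s \<le> 2 \<Longrightarrow> j \<le> 3 \<Longrightarrow> norm ((deriv ^^ j) zeta_reg s) \<le> C1 * height s * small s"
    by (rule zeta_reg_deriv_bound) (rule that)
  obtain c where c: "c > 0" "\<And>s. 1 < Re s \<Longrightarrow> Re s \<le> 2 \<Longrightarrow> norm (zeta_reg s) * small s ^ 4 \<ge> c * height s"
    by (rule zeta_reg_lower) (rule that)
  obtain C2 where C2: "C2 > 0" "\<And>s. 1 \<le> Re s \<Longrightarrow> Re s \<le> 2 \<Longrightarrow> norm (deriv (deriv zeta_rem) s) \<le> C2 * small s"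
    by (rule zeta_rem_deriv2_bound) (rule that)
  define R where "R = C1 / c"
  have R: "R > 0" using C1 c by (simp add: R_def)
  show ?thesis
  proof (rule that[of "R + 3 * R ^ 2 + 2 * R ^ 3 + C2"])
    fix s assume s: "1 < Re s" "Re s \<le> 2"
    define X where "X = small s"
    have X: "X \<ge> 1" unfolding X_def by (rule small_ge_1)
    have h: "height s \<ge> 2" by (rule height_ge_2)
    let ?E = "zeta_reg s"
    let ?r1 = "deriv zeta_reg s / ?E" and ?r2 = "deriv (deriv zeta_reg) s / ?E" and ?r3 = "deriv (deriv (deriv zeta_reg)) s / ?E"
    have E0: "norm ?E > 0" using zeta_reg_ne_0[OF s(1)] by simp
    have ratio: "norm ((deriv ^^ j) zeta_reg s / ?E) \<le> R * X ^ 5" if "j \<le> 3" for j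
    proof -
      have "norm ((deriv ^^ j) zeta_reg s) \<le> C1 * height s * X" unfolding X_def using s that by (intro C1) auto
      also have "\<dots> = R * X * (c * height s)" using c by (simp add: R_def)
      also have "\<dots> \<le> R * X * (norm ?E * X ^ 4)"
        using c(2)[OF s] R X unfolding X_def by (intro mult_left_mono) auto
      also have "\<dots> = R * X ^ 5 * norm ?E" by (simp add: eval_nat_numeral)
      finally show ?thesis using E0 by (simp add: norm_divide divide_le_eq)
    qed
    have X15: "X ^ 15 = (2 + \<bar>Im s\<bar>) powr (1 / 2)"
      using h unfolding X_def small_def height_def by (simp add: powr_power)
    have pX: "X ^ i \<le> X ^ 15" if "i \<le> 15" for i using X that by (intro power_increasing)
    note r1 = ratio[of 1, simplified] and r2 = ratio[of 2, unfolded numeral_2_eq_2, simplified] and r3 = ratio[of 3, unfolded numeral_3_eq_3, simplified]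
    have b3: "norm (?r3) \<le> R * X ^ 15"
      by (rule order.trans[OF r3 mult_left_mono[OF pX]]) (use R in auto)
    have b12: "norm (3 * ?r1 * ?r2) \<le> 3 * R ^ 2 * X ^ 15"
    proof -
      have "norm (3 * ?r1 * ?r2) \<le> 3 * (R * X ^ 5) * (R * X ^ 5)"
        unfolding norm_mult using R X by (intro mult_mono r1 r2) auto
      also have "\<dots> = 3 * R ^ 2 * X ^ 10" by (simp add: power2_eq_square flip: power_add)
      also have "\<dots> \<le> 3 * R ^ 2 * X ^ 15" using R by (intro mult_left_mono pX) auto
      finally show ?thesis .
    qed
    have b111: "norm (2 * ?r1 ^ 3) \<le> 2 * R ^ 3 * X ^ 15"
    proof -
      have "norm (2 * ?r1 ^ 3) \<le> 2 * (R * X ^ 5) ^ 3"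
        unfolding norm_mult norm_power by (intro mult_mono power_mono r1) auto
      also have "\<dots> = 2 * R ^ 3 * X ^ 15" by (simp add: power_mult_distrib flip: power_mult)
      finally show ?thesis .
    qed
    have bZ: "norm (deriv (deriv zeta_rem) s) \<le> C2 * X ^ 15"
    proof -
      have "norm (deriv (deriv zeta_rem) s) \<le> C2 * X ^ 1" using C2(2)[of s] s unfolding X_def by simp
      also have "\<dots> \<le> C2 * X ^ 15" using C2(1) by (intro mult_left_mono pX) auto
      finally show ?thesis .
    qed
    have tri: "norm (- (a - b + c + d)) \<le> p + q + r + t" if "norm a \<le> p" "norm b \<le> q" "norm c \<le> r" "norm d \<le> t" for a b c d :: complex and p q r t
    proof -
      have "norm (a - b + c + d) \<le> norm a + norm b + norm c + norm d"
        using norm_triangle_ineq[of "a - b + c" d] norm_triangle_ineq[of "a - b" c] norm_triangle_ineq4[of a b] by linarith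
      then show ?thesis unfolding norm_minus_cancel using that by linarith
    qed
    show "norm (dseries (\<lambda>n. (mangoldt n - 1) * ln (real n) * ln (real n)) s) \<le> (R + 3 * R ^ 2 + 2 * R ^ 3 + C2) * (2 + \<bar>Im s\<bar>) powr (1 / 2)"
      unfolding dseries_mangoldt_minus_1_ln_ln[OF s(1)]
      using tri[OF b3 b12 b111 bZ] by (simp only: X15 [symmetric] distrib_right)
  qed (use R C2 in \<open>auto intro!: add_pos_pos\<close>)
qed

section \<open>Levy inversion for smoothed sums\<close>

abbreviation exp_dist :: "real \<Rightarrow> real measure" where
  "exp_dist l \<equiv> density lborel (exponential_density l)"

lemma real_distribution_exp_dist:
  assumes "l > 0"
  shows "real_distribution (exp_dist l)"
proof -
  interpret prob_space "exp_dist l" by (rule prob_space_exponential_density[OF assms])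
  show ?thesis by unfold_locales simp
qed

text \<open>Levy's formula yields the measure of an interval when its end points have no
  mass.\<close>

lemma exp_dist_singleton:
  shows "measure (exp_dist l) {a} = 0"
proof -
  have "{a} \<in> null_sets lborel" by (simp add: null_sets_def)
  then have "{a} \<in> null_sets (exp_dist l)"
    using absolutely_continuousI_density[of "\<lambda>x. ennreal (exponential_density l x)" lborel]
    unfolding absolutely_continuous_def by auto
  then show ?thesis by (simp add: null_sets_def measure_def)
qed

lemma exp_dist_atMost:
  assumes "l > 0"
  shows "measure (exp_dist l) {..y} = (if y < 0 then 0 else 1 - exp (- l * y))"
  using assms by (simp add: measure_def emeasure_erlang_density erlang_CDF_def)

lemma exp_dist_greaterThanAtMost:
  assumes "l > 0" "a \<le> b"
  shows "measure (exp_dist l) {a<..b} = (if b < 0 then 0 else 1 - exp (- l * b)) - (if a < 0 then 0 else 1 - exp (- l * a))"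
proof -
  interpret real_distribution "exp_dist l" by (rule real_distribution_exp_dist[OF assms(1)])
  have "{a<..b} = {..b} - {..a}" by auto
  then have "measure (exp_dist l) {a<..b} = measure (exp_dist l) {..b} - measure (exp_dist l) {..a}"
    using assms by (simp only:) (intro finite_measure_Diff, auto)
  then show ?thesis by (simp only: exp_dist_atMost[OF assms(1)])
qed

lemma char_exp_dist:
  assumes l: "l > 0"
  shows "char (exp_dist l) t = of_real l / (of_real l - \<i> * of_real t)"
proof -
  let ?z = "of_real l - \<i> * of_real t :: complex"
  define F where "F = (\<lambda>x::real. - (of_real l / ?z) * exp (- ?z * of_real x))"
  define f where "f = (\<lambda>x::real. of_real l * exp (- ?z * of_real x))"
  have z: "?z \<noteq> 0" using l by (auto simp: complex_eq_iff)
  have nf: "norm (f x) = l * exp (- l * x)" for x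
    unfolding f_def norm_mult norm_exp_eq_Re using l by simp
  \<comment> \<open>The point 0 is left out: the density is l there, whereas the open interval
    excludes it.\<close>
  have eq: "(exponential_density l x) *\<^sub>R iexp (t * x) = indicator (einterval 0 \<infinity>) x *\<^sub>R f x" if "x \<noteq> 0" for x
  proof -
    have "- ?z * of_real x = of_real (- x * l) + \<i> * of_real (t * x)" by (simp add: algebra_simps)
    then have "f x = of_real l * (of_real (exp (- x * l)) * iexp (t * x))"
      by (simp only: f_def exp_add exp_of_real)
    then show ?thesis using that
      by (auto simp: exponential_density_def einterval_def scaleR_conv_of_real split: split_indicator simp del: exp_of_real)
  qed
  have "char (exp_dist l) t = (LINT x|lborel. (exponential_density l x) *\<^sub>R iexp (t * x))"
    unfolding char_def using l by (subst integral_density) auto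
  also have "\<dots> = (LINT x|lborel. indicator (einterval 0 \<infinity>) x *\<^sub>R f x)"
  proof (rule integral_cong_AE)
    show "AE x in lborel. exponential_density l x *\<^sub>R iexp (t * x) = indicator (einterval 0 \<infinity>) x *\<^sub>R f x"
      using AE_lborel_singleton[of 0] by eventually_elim (rule eq)
  qed (auto simp: f_def)
  also have "\<dots> = (LBINT x=0..\<infinity>. f x)"
    by (simp add: interval_lebesgue_integral_def set_lebesgue_integral_def)
  also have "\<dots> = 0 - (- (of_real l / ?z))"
  proof (rule interval_integral_FTC_integrable)
    fix x :: real
    have "(F has_vector_derivative (- (of_real l / ?z) * (exp (- ?z * of_real x) * (- ?z)))) (at x)"
      unfolding F_def by (rule has_vector_derivative_real_field) (use l in \<open>auto intro!: derivative_eq_intros\<close>)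
    also have "- (of_real l / ?z) * (exp (- ?z * of_real x) * (- ?z)) = f x"
    proof -
      have "- (a / z) * (b * (- z)) = a * b" if "z \<noteq> 0" for a b z :: complex using that by simp
      from this[OF z] show ?thesis unfolding f_def .
    qed
    finally show "(F has_vector_derivative f x) (at x)" .
    show "isCont f x" unfolding f_def by (intro continuous_intros)
  next
    have "integrable lborel (exponential_density l)"
      using l nn_integral_erlang_ith_moment[of l 0 0] by (intro integrableI_nonneg) auto
    then show "set_integrable lborel (einterval 0 \<infinity>) f"
      unfolding set_integrable_def
    proof (rule Bochner_Integration.integrable_bound)
      show "(\<lambda>x. indicator (einterval 0 \<infinity>) x *\<^sub>R f x) \<in> borel_measurable lborel"
        by (simp add: f_def)
      show "AE x in lborel. norm (indicator (einterval 0 \<infinity>) x *\<^sub>R f x) \<le> norm (exponential_density l x)"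
        using l by (intro AE_I2) (auto simp: nf exponential_density_def einterval_def abs_mult mult.commute split: split_indicator)
    qed
  next
    have "isCont F 0" unfolding F_def by (intro continuous_intros)
    then have "(F \<longlongrightarrow> F 0) (at_right 0)" unfolding isCont_def by (rule tendsto_mono[OF at_le, rotated]) simp
    then show "((F \<circ> real_of_ereal) \<longlongrightarrow> - (of_real l / ?z)) (at_right 0)"
      unfolding zero_ereal_def ereal_tendsto_simps by (simp add: F_def)
  next
    have "((\<lambda>x. l / norm ?z * exp (- l * x)) \<longlongrightarrow> l / norm ?z * 0) at_top"
      using l by (intro tendsto_intros filterlim_compose[OF exp_at_bot] filterlim_tendsto_neg_mult_at_bot[OF tendsto_const _ filterlim_ident]) auto
    moreover have "norm (F x) = l / norm ?z * exp (- l * x)" for x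
      unfolding F_def norm_mult norm_exp_eq_Re using l by (simp add: norm_divide)
    ultimately have "(F \<longlongrightarrow> 0) at_top" by (intro tendsto_norm_zero_cancel[of F]) simp
    then show "((F \<circ> real_of_ereal) \<longlongrightarrow> 0) (at_left \<infinity>)"
      unfolding ereal_tendsto_simps .
  qed auto
  finally show ?thesis by simp
qed

text \<open>The integrand is at most a multiple of (1 + |t|)^(-3/2), whose half-line integral is
  explicit; the other half comes from reflection.\<close>

lemma integrable_kernel_majorant: "integrable lborel (\<lambda>t::real. (2 + \<bar>t\<bar>) powr (1 / 2) / (1 + t ^ 2))"
proof -
  define f where "f = (\<lambda>t::real. (1 + t) powr (-3 / 2) * indicator {0..} t)"
  have "(\<integral>\<^sup>+t. ennreal ((1 + t) powr (-3 / 2)) * indicator {0..} t \<partial>lborel) = ennreal (0 - (- 2 * (1 + 0) powr (-1 / 2)))"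
  proof (rule nn_integral_FTC_atLeast)
    fix t :: real assume "0 \<le> t"
    then show "((\<lambda>t. - 2 * (1 + t) powr (-1 / 2)) has_real_derivative (1 + t) powr (-3 / 2)) (at t)"
      by (auto intro!: derivative_eq_intros simp: powr_diff [symmetric])
  next
    show "((\<lambda>t::real. - 2 * (1 + t) powr (-1 / 2)) \<longlongrightarrow> 0) at_top" by real_asymp
  qed auto
  then have f: "integrable lborel f"
    unfolding f_def by (intro integrableI_nonneg) (auto simp: ennreal_mult'' ennreal_indicator)
  have "integrable lborel (\<lambda>t. f t + f (0 + (-1) * t))"
    by (intro Bochner_Integration.integrable_add f lborel_integrable_real_affine) auto
  then have "integrable lborel (\<lambda>t. 4 * (f t + f (0 + (-1) * t)))" by (rule integrable_mult_right) 
  then show ?thesis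
  proof (rule Bochner_Integration.integrable_bound)
    show "AE t in lborel. norm ((2 + \<bar>t\<bar>) powr (1 / 2) / (1 + t ^ 2)) \<le> norm (4 * (f t + f (0 + (-1) * t)))"
    proof (rule AE_I2)
      fix t :: real
      define u where "u = 1 + \<bar>t\<bar>"
      have u: "u \<ge> 1" by (simp add: u_def)
      have "(2 + \<bar>t\<bar>) powr (1 / 2) \<le> (2 * u) powr (1 / 2)" unfolding u_def by (intro powr_mono2) auto
      also have "\<dots> = 2 powr (1 / 2) * u powr (1 / 2)" using u by (simp add: powr_mult)
      also have "\<dots> \<le> 2 powr 1 * u powr (1 / 2)" by (intro mult_right_mono powr_mono) auto
      finally have 1: "(2 + \<bar>t\<bar>) powr (1 / 2) \<le> 2 * u powr (1 / 2)" by simp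
      have "u ^ 2 \<le> 2 * (1 + t ^ 2)"
        using sum_squares_ge_zero[of "1 - \<bar>t\<bar>" 0] by (simp add: u_def power2_eq_square algebra_simps)
      then have 2: "u ^ 2 / 2 \<le> 1 + t ^ 2" by simp
      have "(2 + \<bar>t\<bar>) powr (1 / 2) / (1 + t ^ 2) \<le> 2 * u powr (1 / 2) / (u ^ 2 / 2)"
        using 1 2 u by (intro frac_le) auto
      also have "\<dots> = 4 * (u powr (1 / 2) / u powr 2)" using u by (simp add: powr_numeral)
      also have "\<dots> = 4 * u powr (-3 / 2)" by (simp flip: powr_diff)
      also have "u powr (-3 / 2) \<le> f t + f (0 + (-1) * t)" unfolding f_def u_def by (cases "t \<ge> 0") auto
      finally show "norm ((2 + \<bar>t\<bar>) powr (1 / 2) / (1 + t ^ 2)) \<le> norm (4 * (f t + f (0 + (-1) * t)))"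
        by simp
    qed
  qed auto
qed

text \<open>What remains of the integrand in Levy's formula for the interval from a to a + h once
  \<open>iexp (- (t * a))\<close> is taken out. With a = \<open>ln (x / n)\<close> it is the same
  for all n. At t = 0 the division makes it 0.\<close>

definition levy_kernel :: "real \<Rightarrow> real \<Rightarrow> real \<Rightarrow> complex" where
  "levy_kernel h \<sigma> t = (1 - iexp (- (t * h))) / (\<i> * of_real t) * (of_real \<sigma> / (of_real \<sigma> - \<i> * of_real t))"

text \<open>For |t| \<le> 1 the difference quotient is at most h \<le> 1; beyond that, it and the
  characteristic function each contribute 2 / |t|. The bound is uniform in h, so nothing is lost
  when h shrinks.\<close>

lemma norm_levy_kernel_le:
  assumes h: "0 < h" "h \<le> 1" and \<sigma>: "1 < \<sigma>" "\<sigma> \<le> 2"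
  shows "norm (levy_kernel h \<sigma> t) \<le> 8 / (1 + t ^ 2)"
proof (cases "t = 0")
  case False
  have A: "norm (of_real \<sigma> - \<i> * of_real t) \<ge> \<bar>t\<bar>" "norm (of_real \<sigma> - \<i> * of_real t) \<ge> 1"
    using abs_Im_le_cmod[of "of_real \<sigma> - \<i> * of_real t"] abs_Re_le_cmod[of "of_real \<sigma> - \<i> * of_real t"] \<sigma> by auto
  have B1: "norm (1 - iexp (- (t * h))) \<le> \<bar>t\<bar>"
  proof -
    have "norm (1 - iexp (- (t * h))) \<le> \<bar>- (t * h)\<bar>"
      using iexp_approx1[of "- (t * h)" 0] by (simp add: norm_minus_commute)
    also have "\<dots> \<le> \<bar>t\<bar> * 1" using h unfolding abs_minus_cancel abs_mult by (intro mult_left_mono) auto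
    finally show ?thesis by simp
  qed
  have B2: "norm (1 - iexp (- (t * h))) \<le> 2"
    using norm_triangle_ineq4[of 1 "iexp (- (t * h))"] by simp
  have n: "norm (levy_kernel h \<sigma> t) = norm (1 - iexp (- (t * h))) / \<bar>t\<bar> * (\<sigma> / norm (of_real \<sigma> - \<i> * of_real t))"
    unfolding levy_kernel_def using \<sigma> by (simp add: norm_mult norm_divide)
  show ?thesis
  proof (cases "\<bar>t\<bar> \<le> 1")
    case True
    have "norm (levy_kernel h \<sigma> t) \<le> 1 * (2 / 1)"
      unfolding n using A B1 \<sigma> False by (intro mult_mono frac_le) (auto simp: divide_le_eq)
    also have "\<dots> \<le> 8 / (1 + 1)" by simp
    also have "\<dots> \<le> 8 / (1 + t ^ 2)" using True by (intro divide_left_mono add_left_mono) (auto simp: abs_square_le_1 add_pos_nonneg)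
    finally show ?thesis .
  next
    case False
    have "norm (levy_kernel h \<sigma> t) \<le> (2 / \<bar>t\<bar>) * (2 / \<bar>t\<bar>)"
      unfolding n using A B2 \<sigma> False by (intro mult_mono frac_le) auto
    also have "\<dots> = 4 / t ^ 2" by (simp add: power2_eq_square)
    also have "\<dots> = 8 / (2 * t ^ 2)" by simp
    also have "\<dots> \<le> 8 / (1 + t ^ 2)"
    proof (intro divide_left_mono)
      have "1 \<le> t ^ 2" using False by (simp add: abs_square_le_1 [symmetric] not_le less_imp_le)
      then show "1 + t ^ 2 \<le> 2 * t ^ 2" by simp
    qed (use False in \<open>auto intro!: mult_pos_pos add_pos_nonneg\<close>)
    finally show ?thesis .
  qed
qed (auto simp: levy_kernel_def)

lemma norm_integral_le:
  fixes f :: "'a \<Rightarrow> 'b :: {banach, second_countable_topology}"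
  assumes "integrable M g" "\<And>x. norm (f x) \<le> g x"
  shows "norm (LINT x|M. f x) \<le> (LINT x|M. g x)"
  by (rule order.trans[OF integral_norm_bound integral_mono'])
     (use assms order.trans[OF norm_ge_zero assms(2)] in auto)

lemma CLBINT_symmetric:
  fixes T :: nat
  shows "(CLBINT t=-T..T. f t) = (LINT t|lborel. indicator {-real T<..<real T} t *\<^sub>R f t)"
  by (simp add: interval_lebesgue_integral_def set_lebesgue_integral_def)

text \<open>The rate \<sigma> of the law matches the exponent of the factor n^(-\<sigma>) that
  accompanies it: for n \<le> x this mass is proportional to n^\<sigma>, so the product is constant
  in n.\<close>

abbreviation smooth_weight :: "real \<Rightarrow> real \<Rightarrow> real \<Rightarrow> nat \<Rightarrow> real" where
  "smooth_weight \<sigma> h x n \<equiv> measure (exp_dist \<sigma>) {ln (x / real n)<..ln (x / real n) + h}"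

text \<open>Levy's formula expresses each weight as a limit of integrals over (-T, T). Summing over
  n under the integral produces the value of the Dirichlet series at \<sigma> - i * t, and its
  growth against the 1 / t^2 decay of the kernel gives a bound independent of T, \<sigma>, h and
  x.\<close>

lemma levy_smoothed_sum_bound:
  assumes c: "dconv c" and C0: "C > 0"
    and C: "\<And>s. 1 < Re s \<Longrightarrow> Re s \<le> 2 \<Longrightarrow> norm (dseries c s) \<le> C * (2 + \<bar>Im s\<bar>) powr (1 / 2)"
  obtains B where "B \<ge> 0" "\<And>\<sigma> h x. 1 < \<sigma> \<Longrightarrow> \<sigma> \<le> 2 \<Longrightarrow> 0 < h \<Longrightarrow> h \<le> 1 \<Longrightarrow> x > 0 \<Longrightarrow>
    \<bar>\<Sum>n. c n * real n powr (-\<sigma>) * smooth_weight \<sigma> h x n\<bar> \<le> B"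
proof -
  define w where "w = (\<lambda>t::real. (2 + \<bar>t\<bar>) powr (1 / 2) / (1 + t ^ 2))"
  define J where "J = (LINT t|lborel. w t)"
  have w: "integrable lborel w" unfolding w_def by (rule integrable_kernel_majorant)
  have w0: "w t \<ge> 0" for t unfolding w_def by (intro divide_nonneg_nonneg) auto
  have J0: "J \<ge> 0" unfolding J_def by (intro integral_nonneg_AE) (simp add: w0)
  have w1: "1 / (1 + t ^ 2) \<le> w t" for t
    unfolding w_def by (intro divide_right_mono ge_one_powr_ge_zero) auto
  show ?thesis
  proof (rule that[of "8 * C * J"])
    fix \<sigma> h x :: real assume \<sigma>: "1 < \<sigma>" "\<sigma> \<le> 2" and h: "0 < h" "h \<le> 1" and x: "x > 0"
    let ?M = "exp_dist \<sigma>"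
    let ?p = "\<lambda>n::nat. real n powr (-\<sigma>)"
    have s0: "\<sigma> > 0" using \<sigma> by simp
    interpret real_distribution ?M by (rule real_distribution_exp_dist[OF s0])
    \<comment> \<open>With x^(-i * t) moved into G, the only dependence on n left is n^(i * t);
      together with n^(-\<sigma>) it forms \<open>e n t\<close>.\<close>
    define G where "G = (\<lambda>t. iexp (- (t * ln x)) * levy_kernel h \<sigma> t)"
    define e where "e = (\<lambda>(n::nat) t. of_nat n powr (- (of_real \<sigma> - \<i> * of_real t)) :: complex)"
    define L where "L = (\<lambda>(T::nat) a. 1 / (2 * pi) * (CLBINT t=-T..T. (iexp (-(t * a)) - iexp (-(t * (a + h)))) / (\<i> * t) * char ?M t))"
    let ?v = "\<lambda>T n. of_real (c n * ?p n) * L T (ln (x / real n))"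
    let ?lim = "\<lambda>n. of_real (c n * ?p n) * of_real (smooth_weight \<sigma> h x n) :: complex"
    let ?g = "\<lambda>T n t. indicator {-real T<..<real T} t *\<^sub>R (of_nat n powr (\<i> * of_real t) * G t)"
    have G_meas [measurable]: "G \<in> borel_measurable borel" unfolding G_def levy_kernel_def by measurable
    have e_meas [measurable]: "e n \<in> borel_measurable borel" for n
    proof (cases "n = 0")
      case False
      then have "e n = (\<lambda>t. exp (- (of_real \<sigma> - \<i> * of_real t) * of_real (ln (real n))))"
        unfolding e_def by (auto simp: powr_def Ln_of_nat)
      then show ?thesis by simp
    qed (simp add: e_def)
    have G_le: "norm (G t) \<le> 8 * w t" for t
    proof -
      have "norm (G t) = norm (levy_kernel h \<sigma> t)" unfolding G_def norm_mult by simp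
      also have "\<dots> \<le> 8 * (1 / (1 + t ^ 2))" using norm_levy_kernel_le[OF h \<sigma>, of t] by simp
      also have "\<dots> \<le> 8 * w t" using w1[of t] by (intro mult_left_mono) auto
      finally show ?thesis .
    qed
    have e_norm: "norm (e n t) = ?p n" for n t
      unfolding e_def norm_nat_powr by simp
    define u where "u = (\<lambda>(T::nat) n t. indicator {-real T<..<real T} t *\<^sub>R (of_real (c n) * e n t * G t))"
    have u_le: "norm (u T n t) \<le> \<bar>c n\<bar> * ?p n * (8 * w t)" for T n t
      unfolding u_def using G_le[of t] w0[of t]
      by (auto simp: norm_mult e_norm split: split_indicator intro!: mult_left_mono mult_nonneg_nonneg)
    have u_meas [measurable]: "u T n \<in> borel_measurable borel" for T n unfolding u_def by measurable
    have u_int: "integrable lborel (u T n)" for T n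
      by (rule Bochner_Integration.integrable_bound[of _ "\<lambda>t. \<bar>c n\<bar> * ?p n * (8 * w t)"])
         (use w u_le w0 in \<open>auto intro!: integrable_mult_right AE_I2 order.trans[OF u_le]\<close>)
    have term_eq: "?v T n = of_real (1 / (2 * pi)) * (LINT t|lborel. u T n t)" for n T
    proof (cases "n = 0")
      case False
      have "(CLBINT t=-T..T. (iexp (-(t * ln (x / real n))) - iexp (-(t * (ln (x / real n) + h)))) / (\<i> * t) * char ?M t)
          = (LINT t|lborel. ?g T n t)"
        unfolding CLBINT_symmetric
      proof (rule Bochner_Integration.integral_cong, simp)
        fix t :: real
        have a: "iexp (-(t * ln (x / real n))) = of_nat n powr (\<i> * of_real t) * iexp (- (t * ln x))"
          using False x by (simp add: powr_def Ln_of_nat ln_div exp_add [symmetric] algebra_simps)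
        have b: "iexp (-(t * (ln (x / real n) + h))) = iexp (-(t * ln (x / real n))) * iexp (- (t * h))"
          by (simp add: exp_add [symmetric] algebra_simps)
        have "(iexp (-(t * ln (x / real n))) - iexp (-(t * (ln (x / real n) + h)))) / (\<i> * t) * char ?M t =
          of_nat n powr (\<i> * of_real t) * G t"
          unfolding b char_exp_dist[OF s0] G_def levy_kernel_def unfolding a by (simp add: algebra_simps diff_divide_distrib)
        then show "indicator {-real T<..<real T} t *\<^sub>R ((iexp (-(t * ln (x / real n))) - iexp (-(t * (ln (x / real n) + h)))) / (\<i> * t) * char ?M t) =
           ?g T n t"
          by simp
      qed
      then have "?v T n =
         of_real (1 / (2 * pi)) * (of_real (c n * ?p n) * (LINT t|lborel. ?g T n t))"
        unfolding L_def by simp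
      also have "of_real (c n * ?p n) * (LINT t|lborel. ?g T n t) =
         (LINT t|lborel. of_real (c n * ?p n) * (?g T n t))"
        by (rule integral_mult_right_zero [symmetric])
      also have "\<dots> = (LINT t|lborel. u T n t)"
      proof (rule Bochner_Integration.integral_cong, simp)
        fix t :: real
        have "of_real (?p n) * of_nat n powr (\<i> * of_real t) = e n t"
          using False by (simp add: e_def powr_def Ln_of_nat exp_add [symmetric] exp_of_real [symmetric] algebra_simps del: exp_of_real)
        then show "of_real (c n * ?p n) * (?g T n t) = u T n t"
          unfolding u_def by (auto split: split_indicator)
      qed
      finally show ?thesis .
    qed (simp add: u_def e_def)
    have sm: "summable (\<lambda>n. \<bar>c n\<bar> * ?p n)" using c \<sigma> unfolding dconv_def by blast
    have T_bound: "norm (\<Sum>n. ?v T n) \<le> 8 * C * J" for T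
    proof -
      have sum_u: "(\<lambda>n. u T n t) sums (indicator {-real T<..<real T} t *\<^sub>R (dseries c (of_real \<sigma> - \<i> * of_real t) * G t))" for t
        unfolding u_def e_def using \<sigma> by (intro sums_scaleR_right sums_mult2 dseries_sums c) auto
      have int_norm: "(LINT t|lborel. norm (u T n t)) \<le> \<bar>c n\<bar> * ?p n * (8 * J)" for n
      proof -
        have "(LINT t|lborel. norm (u T n t)) \<le> (LINT t|lborel. \<bar>c n\<bar> * ?p n * (8 * w t))"
          by (intro integral_mono integrable_norm u_int u_le integrable_mult_right) (use w in auto)
        then show ?thesis unfolding J_def by simp
      qed
      \<comment> \<open>Sum and integral may be exchanged because the n-th term is at most |c n| *
        n^(-\<sigma>) * 8 * w(t), summable in n and integrable in t.\<close>
      have "(\<lambda>n. LINT t|lborel. u T n t) sums (LINT t|lborel. (\<Sum>n. u T n t))"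
      proof (rule sums_integral[OF u_int])
        show "AE t in lborel. summable (\<lambda>n. norm (u T n t))"
          by (intro AE_I2 summable_comparison_test'[OF summable_mult2[OF sm], of 0]) (use u_le in auto)
        show "summable (\<lambda>n. LINT t|lborel. norm (u T n t))"
          by (intro summable_comparison_test'[OF summable_mult2[OF sm], of 0]) (use int_norm in auto)
      qed
      then have "(\<lambda>n. of_real (1 / (2 * pi)) * (LINT t|lborel. u T n t)) sums (of_real (1 / (2 * pi)) * (LINT t|lborel. (\<Sum>n. u T n t)))"
        by (rule sums_mult)
      then have "(\<Sum>n. ?v T n) = of_real (1 / (2 * pi)) * (LINT t|lborel. (\<Sum>n. u T n t))"
        unfolding term_eq by (simp add: sums_iff)
      also have "norm \<dots> = 1 / (2 * pi) * norm (LINT t|lborel. (\<Sum>n. u T n t))" by (simp add: norm_mult norm_divide)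
      also have "\<dots> \<le> 1 * norm (LINT t|lborel. (\<Sum>n. u T n t))"
        using pi_gt3 by (intro mult_right_mono) (auto simp: divide_le_eq)
      also have "norm (LINT t|lborel. (\<Sum>n. u T n t)) \<le> (LINT t|lborel. 8 * C * w t)"
      proof (rule norm_integral_le)
        fix t :: real
        have eq: "(\<Sum>n. u T n t) = indicator {-real T<..<real T} t *\<^sub>R (dseries c (of_real \<sigma> - \<i> * of_real t) * G t)"
          using sum_u[of t] by (simp add: sums_iff)
        have "norm (dseries c (of_real \<sigma> - \<i> * of_real t) * G t) \<le> C * (2 + \<bar>t\<bar>) powr (1 / 2) * (8 / (1 + t ^ 2))"
          unfolding norm_mult
        proof (intro mult_mono)
          show "norm (dseries c (of_real \<sigma> - \<i> * of_real t)) \<le> C * (2 + \<bar>t\<bar>) powr (1 / 2)"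
            using C[of "of_real \<sigma> - \<i> * of_real t"] \<sigma> by simp
          show "norm (G t) \<le> 8 / (1 + t ^ 2)"
            using norm_levy_kernel_le[OF h \<sigma>, of t] unfolding G_def norm_mult by simp
        qed (use C0 in auto)
        also have "\<dots> = 8 * C * w t" by (simp add: w_def)
        finally show "norm (\<Sum>n. u T n t) \<le> 8 * C * w t"
          unfolding eq using w0[of t] C0 by (auto split: split_indicator)
      qed (use w in auto)
      also have "\<dots> = 8 * C * J" by (simp add: J_def)
      finally show ?thesis by simp
    qed
    have lim: "(\<lambda>T. ?v T n) \<longlonglongrightarrow>
        ?lim n" for n
      unfolding L_def using h by (intro tendsto_mult_left Levy_Inversion exp_dist_singleton) auto
    \<comment> \<open>A majorant free of T, as Tannery's theorem requires for the limit in T inside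
      the series.\<close>
    have "eventually (\<lambda>(n, T). norm (?v T n) \<le> \<bar>c n\<bar> * ?p n * (8 * J)) (at_top \<times>\<^sub>F sequentially)"
    proof (rule always_eventually, clarify)
      fix n T
      have "norm (LINT t|lborel. u T n t) \<le> (LINT t|lborel. \<bar>c n\<bar> * ?p n * (8 * w t))"
        by (rule norm_integral_le) (use w u_le in auto)
      also have "\<dots> = \<bar>c n\<bar> * ?p n * (8 * J)" by (simp add: J_def)
      finally have "1 / (2 * pi) * norm (LINT t|lborel. u T n t) \<le> 1 * (\<bar>c n\<bar> * ?p n * (8 * J))"
        using pi_gt3 by (intro mult_mono) (auto simp: divide_le_eq)
      then show "norm (?v T n) \<le> \<bar>c n\<bar> * ?p n * (8 * J)"
        unfolding term_eq by (simp add: norm_mult norm_divide)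
    qed
    from tannerys_theorem[OF lim this summable_mult2[OF sm]]
    have tan: "summable (\<lambda>n. norm (?lim n))"
      "(\<lambda>T. \<Sum>n. ?v T n) \<longlonglongrightarrow>
       (\<Sum>n. ?lim n)"
      by auto
    have "norm (\<Sum>n. ?lim n) \<le> 8 * C * J"
      by (rule LIMSEQ_le_const2[OF tendsto_norm[OF tan(2)]]) (use T_bound in auto)
    also have "(\<Sum>n. ?lim n) =
       of_real (\<Sum>n. c n * ?p n * smooth_weight \<sigma> h x n)"
      using summable_norm_cancel[OF tan(1)] summable_Re[OF summable_norm_cancel[OF tan(1)]]
      by (subst suminf_of_real) (auto simp flip: of_real_mult)
    finally show "\<bar>\<Sum>n. c n * ?p n * smooth_weight \<sigma> h x n\<bar> \<le> 8 * C * J"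
      unfolding norm_of_real .
  qed (use C0 J0 in auto)
qed

section \<open>The prime number theorem with an error term\<close>

text \<open>With a = \<open>ln (x / n)\<close>, the factor n^(-\<sigma>) is x^(-\<sigma>) *
  e^(\<sigma> * a), which cancels the e^(-\<sigma> * a) in the mass of the interval when a \<ge> 0.
  For a < 0 the interval is cut off at 0, and for a + h < 0 it misses the support. So W is a plateau
  on n \<le> x that ends at x * e^h.\<close>

lemma smoothing_weight:
  fixes n :: nat
  assumes \<sigma>: "\<sigma> > 0" and h: "h > 0" and x: "x > 0" and n: "n \<ge> 1"
  defines "W \<equiv> real n powr (-\<sigma>) * smooth_weight \<sigma> h x n"
  shows "real n \<le> x \<Longrightarrow> W = x powr (-\<sigma>) * (1 - exp (- \<sigma> * h))"
    and "W \<le> x powr (-\<sigma>) * (1 - exp (- \<sigma> * h))"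
    and "real n > x * exp h \<Longrightarrow> W = 0"
proof -
  define a where "a = ln (x / real n)"
  have m: "measure (exp_dist \<sigma>) {a<..a + h} = (if a + h < 0 then 0 else 1 - exp (- \<sigma> * (a + h))) - (if a < 0 then 0 else 1 - exp (- \<sigma> * a))"
    using h by (intro exp_dist_greaterThanAtMost \<sigma>) simp
  have W: "W = real n powr (-\<sigma>) * measure (exp_dist \<sigma>) {a<..a + h}" by (simp add: W_def a_def)
  have np: "real n powr (-\<sigma>) = x powr (-\<sigma>) * exp (\<sigma> * a)"
    using x n by (simp add: a_def powr_def ln_div exp_add [symmetric] algebra_simps)
  have eh: "exp (- \<sigma> * (a + h)) = exp (- \<sigma> * a) * exp (- \<sigma> * h)" by (simp add: exp_add [symmetric] algebra_simps)
  have ee: "exp (\<sigma> * a) * exp (- \<sigma> * a) = 1" by (simp add: exp_add [symmetric])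
  have k0: "exp (- \<sigma> * h) \<le> 1" using \<sigma> h by simp
  have eq: "W = x powr (-\<sigma>) * (1 - exp (- \<sigma> * h))" if "a \<ge> 0"
  proof -
    have "measure (exp_dist \<sigma>) {a<..a + h} = exp (- \<sigma> * a) * (1 - exp (- \<sigma> * h))"
      using that h unfolding m eh by (simp add: algebra_simps)
    then have "W = x powr (-\<sigma>) * (exp (\<sigma> * a) * exp (- \<sigma> * a)) * (1 - exp (- \<sigma> * h))" unfolding W np by simp
    then show ?thesis unfolding ee by simp
  qed
  show "W = x powr (-\<sigma>) * (1 - exp (- \<sigma> * h))" if "real n \<le> x"
    using that n x by (intro eq) (simp add: a_def)
  show "W = 0" if "real n > x * exp h"
  proof -
    have "ln (x * exp h) < ln (real n)" using that x n by (subst ln_less_cancel_iff) auto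
    then have "a + h < 0" using x n by (simp add: a_def ln_div ln_mult)
    then show ?thesis using h unfolding W m by simp
  qed
  show "W \<le> x powr (-\<sigma>) * (1 - exp (- \<sigma> * h))"
  proof (cases "a \<ge> 0")
    case False
    have "measure (exp_dist \<sigma>) {a<..a + h} \<le> exp (- \<sigma> * a) * (1 - exp (- \<sigma> * h))"
    proof (cases "a + h < 0")
      case True
      then show ?thesis using False k0 unfolding m by simp
    next
      case F: False
      have "exp (- \<sigma> * a) \<ge> 1" using \<sigma> False by (simp add: mult_nonneg_nonpos)
      then show ?thesis using False F unfolding m eh by (simp add: algebra_simps)
    qed
    then have "W \<le> real n powr (-\<sigma>) * (exp (- \<sigma> * a) * (1 - exp (- \<sigma> * h)))"
      unfolding W by (intro mult_left_mono) auto
    also have "\<dots> = x powr (-\<sigma>) * (exp (\<sigma> * a) * exp (- \<sigma> * a)) * (1 - exp (- \<sigma> * h))" unfolding np by simp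
    finally show ?thesis unfolding ee by simp
  qed (simp add: eq)
qed

text \<open>The plateau, the maximum and the support of W sandwich the smoothed sum; this is where
  nonnegative coefficients are indispensable.\<close>

lemma smoothed_sum_bounds:
  assumes c: "dconv c" "\<And>n. c n \<ge> 0" and \<sigma>: "\<sigma> > 1" and h: "h > 0" and x: "x > 0"
  defines "W \<equiv> \<lambda>n. real n powr (-\<sigma>) * smooth_weight \<sigma> h x n"
  defines "k \<equiv> x powr (-\<sigma>) * (1 - exp (- \<sigma> * h))"
  shows "summable (\<lambda>n. c n * W n)" "k * (\<Sum>n=1..nat \<lfloor>x\<rfloor>. c n) \<le> (\<Sum>n. c n * W n)"
    "(\<Sum>n. c n * W n) \<le> k * (\<Sum>n=1..nat \<lfloor>x * exp h\<rfloor>. c n)"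
proof -
  have s0: "\<sigma> > 0" using \<sigma> by simp
  have mem: "n \<ge> 1 \<and> real n \<le> y \<longleftrightarrow> n \<in> {1..nat \<lfloor>y\<rfloor>}" for n y
    unfolding ge_1_le_eq_atLeastAtMost[symmetric] by simp
  have W0: "W n \<ge> 0" for n unfolding W_def by simp
  have out: "c n * W n = 0" if "n \<notin> {1..nat \<lfloor>x * exp h\<rfloor>}" for n
  proof (cases "n = 0")
    case False
    then have "real n > x * exp h" using that mem[of n "x * exp h"] by auto
    then show ?thesis using smoothing_weight(3)[OF s0 h x, of n] False by (simp add: W_def)
  qed (simp add: W_def)
  show sm: "summable (\<lambda>n. c n * W n)" by (rule summable_finite[of "{1..nat \<lfloor>x * exp h\<rfloor>}"]) (simp, rule out)
  have "k * (\<Sum>n=1..nat \<lfloor>x\<rfloor>. c n) = (\<Sum>n=1..nat \<lfloor>x\<rfloor>. c n * W n)"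
    unfolding sum_distrib_left
  proof (intro sum.cong refl)
    fix n assume "n \<in> {1..nat \<lfloor>x\<rfloor>}"
    then have "n \<ge> 1" "real n \<le> x" using mem by auto
    then show "k * c n = c n * W n" using smoothing_weight(1)[OF s0 h x, of n] by (simp add: W_def k_def)
  qed
  also have "\<dots> \<le> (\<Sum>n. c n * W n)" by (intro sum_le_suminf sm) (auto simp: c W0)
  finally show "k * (\<Sum>n=1..nat \<lfloor>x\<rfloor>. c n) \<le> (\<Sum>n. c n * W n)" .
  have "(\<Sum>n. c n * W n) = (\<Sum>n=1..nat \<lfloor>x * exp h\<rfloor>. c n * W n)"
    by (rule suminf_finite) (simp, rule out)
  also have "\<dots> \<le> (\<Sum>n=1..nat \<lfloor>x * exp h\<rfloor>. c n * k)"
    using smoothing_weight(2)[OF s0 h x] c(2) by (intro sum_mono mult_left_mono) (auto simp: W_def k_def)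
  finally show "(\<Sum>n. c n * W n) \<le> k * (\<Sum>n=1..nat \<lfloor>x * exp h\<rfloor>. c n)"
    by (simp add: sum_distrib_left mult.commute)
qed

text \<open>The coefficients of the difference change sign, so the sandwich is applied to the two
  nonnegative sums separately, and the bounded difference of their smoothed forms links
  them.\<close>

lemma mangoldt_ln_sq_sum_compare:
  obtains B where "B \<ge> 0"
    "\<And>\<sigma> h x. 1 < \<sigma> \<Longrightarrow> \<sigma> \<le> 2 \<Longrightarrow> 0 < h \<Longrightarrow> h \<le> 1 \<Longrightarrow> x > 0 \<Longrightarrow>
      (\<Sum>n=1..nat \<lfloor>x\<rfloor>. mangoldt n * ln (real n) ^ 2) \<le> (\<Sum>n=1..nat \<lfloor>x * exp h\<rfloor>. ln (real n) ^ 2) + B * x powr \<sigma> / h \<and>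
      (\<Sum>n=1..nat \<lfloor>x\<rfloor>. ln (real n) ^ 2) \<le> (\<Sum>n=1..nat \<lfloor>x * exp h\<rfloor>. mangoldt n * ln (real n) ^ 2) + B * x powr \<sigma> / h"
proof -
  define a :: "nat \<Rightarrow> real" where "a = (\<lambda>n. (mangoldt n - 1) * ln (real n) * ln (real n))"
  define b :: "nat \<Rightarrow> real" where "b = (\<lambda>n. mangoldt n * ln (real n) ^ 2)"
  define l :: "nat \<Rightarrow> real" where "l = (\<lambda>n. ln (real n) ^ 2)"
  have a: "dconv a" unfolding a_def by (intro dconv_mult_ln dconv_diff dconv_mangoldt dconv_1)
  have b: "dconv b" "b n \<ge> 0" for n
    using dconv_mult_ln[OF dconv_mult_ln[OF dconv_mangoldt]] unfolding b_def
    by (simp_all add: power2_eq_square mult.assoc mangoldt_nonneg)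
  have l: "dconv l" "l n \<ge> 0" for n
    using dconv_mult_ln[OF dconv_mult_ln[OF dconv_1]] unfolding l_def by (simp_all add: power2_eq_square)
  obtain C where C: "C > 0" "\<And>s. 1 < Re s \<Longrightarrow> Re s \<le> 2 \<Longrightarrow> norm (dseries a s) \<le> C * (2 + \<bar>Im s\<bar>) powr (1 / 2)"
    by (rule dseries_mangoldt_minus_1_bound[folded a_def]) (rule that)
  obtain B where B: "B \<ge> 0" "\<And>\<sigma> h x. 1 < \<sigma> \<Longrightarrow> \<sigma> \<le> 2 \<Longrightarrow> 0 < h \<Longrightarrow> h \<le> 1 \<Longrightarrow> x > 0 \<Longrightarrow>
    \<bar>\<Sum>n. a n * real n powr (-\<sigma>) * smooth_weight \<sigma> h x n\<bar> \<le> B"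
    by (rule levy_smoothed_sum_bound[OF a C]) (assumption, assumption, rule that)
  have main: "(\<Sum>n=1..nat \<lfloor>x\<rfloor>. b n) \<le> (\<Sum>n=1..nat \<lfloor>x * exp h\<rfloor>. l n) + 2 * B * x powr \<sigma> / h \<and>
              (\<Sum>n=1..nat \<lfloor>x\<rfloor>. l n) \<le> (\<Sum>n=1..nat \<lfloor>x * exp h\<rfloor>. b n) + 2 * B * x powr \<sigma> / h"
    if \<sigma>: "1 < \<sigma>" "\<sigma> \<le> 2" and h: "0 < h" "h \<le> 1" and x: "x > 0" for \<sigma> h x :: real
  proof -
    define W where "W n = real n powr (-\<sigma>) * smooth_weight \<sigma> h x n" for n
    define k where "k = x powr (-\<sigma>) * (1 - exp (- \<sigma> * h))"
    note Bb = smoothed_sum_bounds[OF b \<sigma>(1) h(1) x, folded W_def k_def]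
    note Bl = smoothed_sum_bounds[OF l \<sigma>(1) h(1) x, folded W_def k_def]
    have "(\<Sum>n. a n * real n powr (-\<sigma>) * smooth_weight \<sigma> h x n) = (\<Sum>n. b n * W n - l n * W n)"
      by (intro suminf_cong) (simp add: a_def b_def l_def W_def power2_eq_square algebra_simps)
    also have "\<dots> = (\<Sum>n. b n * W n) - (\<Sum>n. l n * W n)" by (rule suminf_diff [symmetric, OF Bb(1) Bl(1)])
    finally have diff: "\<bar>(\<Sum>n. b n * W n) - (\<Sum>n. l n * W n)\<bar> \<le> B" using B(2)[OF \<sigma> h x] by simp
    \<comment> \<open>The plateau times x^\<sigma> is 1 - e^(-\<sigma> * h), at least 1 - e^(-h)
      \<ge> h / (1 + h) \<ge> h / 2. This is the source of the division by h in the error.\<close>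
    have k: "h / 2 \<le> k * x powr \<sigma>" "k > 0"
    proof -
      have "exp (- \<sigma> * h) \<le> exp (- h)" using \<sigma> h by simp
      also have "\<dots> = 1 / exp h" by (simp add: exp_minus inverse_eq_divide)
      also have "\<dots> \<le> 1 / (1 + h)" using h exp_ge_add_one_self[of h] by (intro divide_left_mono) auto
      finally have "1 - exp (- \<sigma> * h) \<ge> h / (1 + h)" using h by (simp add: field_simps)
      moreover have "h / (1 + h) \<ge> h / 2" using h by (intro divide_left_mono) auto
      ultimately have *: "1 - exp (- \<sigma> * h) \<ge> h / 2" by linarith
      have "x powr (-\<sigma>) * x powr \<sigma> = 1" using x by (simp flip: powr_add)
      then have "k * x powr \<sigma> = 1 - exp (- \<sigma> * h)" unfolding k_def by (simp add: mult_ac)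
      then show "h / 2 \<le> k * x powr \<sigma>" using * by simp
      have "1 - exp (- \<sigma> * h) > 0" using * h(1) by linarith
      then show "k > 0" unfolding k_def by (rule mult_pos_pos[rotated]) (use x in simp)
    qed
    have Bk: "B / k \<le> 2 * B * x powr \<sigma> / h"
    proof -
      have "B * (h / 2) \<le> B * (k * x powr \<sigma>)" using k B by (intro mult_left_mono) auto
      then show ?thesis using k h by (simp add: field_simps)
    qed
    have cancel: "P \<le> Q + B / k" if "k * P \<le> k * Q + B" for P Q using that k by (simp add: field_simps)
    have "(\<Sum>n=1..nat \<lfloor>x\<rfloor>. b n) \<le> (\<Sum>n=1..nat \<lfloor>x * exp h\<rfloor>. l n) + B / k"
      using Bb(2) Bl(3) diff by (intro cancel) linarith
    moreover have "(\<Sum>n=1..nat \<lfloor>x\<rfloor>. l n) \<le> (\<Sum>n=1..nat \<lfloor>x * exp h\<rfloor>. b n) + B / k"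
      using Bl(2) Bb(3) diff by (intro cancel) linarith
    ultimately show ?thesis using Bk by linarith
  qed
  show ?thesis by (rule that[of "2 * B"]) (use B main in \<open>auto simp: b_def l_def\<close>)
qed

section \<open>Removal of the smoothing\<close>

lemma sum_ln_sq_short:
  assumes "M \<le> N" "N \<ge> 1"
  shows "(\<Sum>n=1..N. ln (real n) ^ 2) \<le> (\<Sum>n=1..M. ln (real n) ^ 2) + (real N - real M) * ln (real N) ^ 2"
proof -
  have "(\<Sum>n=1..N. ln (real n) ^ 2) = (\<Sum>n=1..M. ln (real n) ^ 2) + (\<Sum>n=Suc M..N. ln (real n) ^ 2)"
    using assms by (subst sum.union_disjoint [symmetric]) (auto intro!: sum.cong)
  also have "(\<Sum>n=Suc M..N. ln (real n) ^ 2) \<le> (\<Sum>n=Suc M..N. ln (real N) ^ 2)"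
    by (intro sum_mono power_mono) auto
  finally show ?thesis using assms by (simp add: of_nat_diff)
qed

text \<open>The choice h = 1 / ln N balances the smoothing error N / h against the range between N
  and N * e^h, which contributes about h * N * ln^2 N.\<close>

lemma mangoldt_ln_sq_sum:
  obtains K where "K \<ge> 0"
    "\<And>N. N \<ge> 3 \<Longrightarrow> \<bar>\<Sum>n=1..N. (mangoldt n - 1) * ln (real n) ^ 2\<bar> \<le> K * (real N * ln (real N))"
proof -
  obtain B where B: "B \<ge> 0"
    "\<And>\<sigma> h x. 1 < \<sigma> \<Longrightarrow> \<sigma> \<le> 2 \<Longrightarrow> 0 < h \<Longrightarrow> h \<le> 1 \<Longrightarrow> x > 0 \<Longrightarrow>
      (\<Sum>n=1..nat \<lfloor>x\<rfloor>. mangoldt n * ln (real n) ^ 2) \<le> (\<Sum>n=1..nat \<lfloor>x * exp h\<rfloor>. ln (real n) ^ 2) + B * x powr \<sigma> / h \<and>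
      (\<Sum>n=1..nat \<lfloor>x\<rfloor>. ln (real n) ^ 2) \<le> (\<Sum>n=1..nat \<lfloor>x * exp h\<rfloor>. mangoldt n * ln (real n) ^ 2) + B * x powr \<sigma> / h"
    by (rule mangoldt_ln_sq_sum_compare) (rule that)
  show ?thesis
  proof (rule that[of "8 + 3 * B"])
    fix N :: nat assume N3: "N \<ge> 3"
    let ?l = "\<lambda>N::nat. \<Sum>n=1..N. ln (real n) ^ 2" and ?b = "\<lambda>N. \<Sum>n=1..N. mangoldt n * ln (real n) ^ 2"
    define y where "y = real N"
    define L where "L = ln y"
    have y: "y \<ge> 3" using N3 by (simp add: y_def)
    have L: "L \<ge> 1" unfolding L_def by (rule ln_ge_1[OF y])
    have Ly: "L \<le> y" unfolding L_def using ln_le_minus_one[of y] y by linarith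
    define h where "h = 1 / L"
    define \<sigma> where "\<sigma> = 1 + h"
    have h: "0 < h" "h \<le> 1" "h * L = 1" using L by (auto simp: h_def)
    have \<sigma>: "1 < \<sigma>" "\<sigma> \<le> 2" using h by (auto simp: \<sigma>_def)
    \<comment> \<open>As h * L = 1, the excess power y^h is exactly e, at most 3.\<close>
    have pw: "y powr \<sigma> \<le> 3 * y"
    proof -
      have "y powr \<sigma> = y powr 1 * y powr h" unfolding \<sigma>_def by (rule powr_add)
      also have "y powr h = exp 1" using y h(3) by (simp add: powr_def L_def)
      also have "y powr 1 * exp 1 \<le> y * 3" using y exp_le by (intro mult_mono) auto
      finally show ?thesis by simp
    qed
    have err: "B * x powr \<sigma> / h \<le> 3 * B * (y * L)" if "0 < x" "x \<le> y" for x
    proof -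
      have "x powr \<sigma> \<le> y powr \<sigma>" using that \<sigma> by (intro powr_mono2) auto
      then have "B * x powr \<sigma> \<le> B * (3 * y)" using pw B by (intro mult_left_mono) auto
      then have "B * x powr \<sigma> / h \<le> B * (3 * y) / h" using h by (intro divide_right_mono) auto
      then show ?thesis by (simp add: h_def)
    qed
    have yN: "nat \<lfloor>y\<rfloor> = N" by (simp add: y_def)
    have up: "?b N \<le> ?l N + (8 + 3 * B) * (y * L)"
    proof -
      define M where "M = nat \<lfloor>y * exp h\<rfloor>"
      have eh: "1 \<le> exp h" "exp h \<le> 1 + 2 * h"
      proof -
        have "exp h \<le> 1 + h + h ^ 2" using h by (intro exp_bound) auto
        also have "h ^ 2 \<le> h ^ 1" using h by (intro power_decreasing) auto
        finally show "exp h \<le> 1 + 2 * h" by simp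
      qed (use h in simp)
      have M: "N \<le> M" "real M \<le> y * exp h"
      proof -
        have "y * 1 \<le> y * exp h" using eh y by (intro mult_left_mono) auto
        then show "N \<le> M" unfolding M_def y_def by (simp add: le_nat_floor)
        show "real M \<le> y * exp h" unfolding M_def using y by simp
      qed
      have "ln (real M) \<le> ln (y * exp h)" using M N3 y by (subst ln_le_cancel_iff) auto
      also have "\<dots> = L + h" using y by (simp add: ln_mult L_def)
      finally have lnM: "ln (real M) \<le> 2 * L" using h L by linarith
      have "real M - real N \<le> 2 * h * y"
      proof -
        have "y * exp h \<le> y * (1 + 2 * h)" using eh y by (intro mult_left_mono) auto
        then show ?thesis using M by (simp add: y_def algebra_simps)
      qed
      then have "(real M - real N) * ln (real M) ^ 2 \<le> (2 * h * y) * (2 * L) ^ 2"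
        using lnM M N3 h y by (intro mult_mono power_mono) auto
      also have "\<dots> = 8 * (y * L) * (h * L)" by (simp add: power2_eq_square)
      also have "\<dots> = 8 * (y * L)" using h(3) by simp
      finally have "?l M \<le> ?l N + 8 * (y * L)"
        using sum_ln_sq_short[of N M] M N3 by simp
      moreover have "?b N \<le> ?l M + B * y powr \<sigma> / h"
        using B(2)[OF \<sigma> h(1,2), of y, THEN conjunct1] y unfolding yN M_def by simp
      moreover have "B * y powr \<sigma> / h \<le> 3 * B * (y * L)" using y by (intro err) auto
      ultimately show ?thesis by (simp only: distrib_right)
    qed
    have low: "?l N \<le> ?b N + (8 + 3 * B) * (y * L)"
    proof -
      \<comment> \<open>For the lower bound the smoothing starts at N * e^(-h), so that it ends
        exactly at N.\<close>
      define x where "x = y * exp (- h)"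
      define M where "M = nat \<lfloor>x\<rfloor>"
      have xy: "x * exp h = y" by (simp add: x_def exp_minus)
      have x: "0 < x" "x \<le> y" using y h by (auto simp: x_def mult_le_cancel_left1)
      have M: "M \<le> N" "x < real M + 1"
        using x unfolding M_def y_def by (auto simp: nat_le_iff floor_le_iff)
      have "y * (1 - h) \<le> x" unfolding x_def using y exp_ge_add_one_self[of "- h"] by (intro mult_left_mono) auto
      then have "real N - real M \<le> h * y + 1" using M by (simp add: y_def algebra_simps)
      then have "(real N - real M) * ln (real N) ^ 2 \<le> (h * y + 1) * L ^ 2"
        unfolding L_def y_def by (intro mult_right_mono) auto
      also have "\<dots> = y * L * (h * L) + L * L" by (simp add: power2_eq_square algebra_simps)
      also have "\<dots> \<le> y * L * 1 + y * L" using h Ly L by (intro add_mono mult_right_mono) auto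
      finally have "?l N \<le> ?l M + 2 * (y * L)"
        using sum_ln_sq_short[OF M(1)] N3 by (simp add: mult.commute)
      moreover have "?l M \<le> ?b N + B * x powr \<sigma> / h"
        using B(2)[OF \<sigma> h(1,2) x(1), THEN conjunct2] unfolding xy yN M_def .
      moreover have "B * x powr \<sigma> / h \<le> 3 * B * (y * L)" using x by (intro err)
      moreover have "0 \<le> y * L" using y L by simp
      ultimately show ?thesis by (simp only: distrib_right)
    qed
    have "(\<Sum>n=1..N. (mangoldt n - 1) * ln (real n) ^ 2) = ?b N - ?l N"
      by (simp add: sum_subtractf left_diff_distrib)
    then show "\<bar>\<Sum>n=1..N. (mangoldt n - 1) * ln (real n) ^ 2\<bar> \<le> (8 + 3 * B) * (real N * ln (real N))"
      using up low unfolding L_def y_def abs_le_iff by linarith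
  qed (use B in auto)
qed

text \<open>Partial summation with the decreasing weights 1 / ln n removes one logarithm.\<close>

lemma mangoldt_ln_sum:
  obtains K where "\<And>N. \<bar>\<Sum>n=1..N. (mangoldt n - 1) * ln (real n)\<bar> \<le> K * real N"
proof -
  obtain K where K: "K \<ge> 0"
    "\<And>N. N \<ge> 3 \<Longrightarrow> \<bar>\<Sum>n=1..N. (mangoldt n - 1) * ln (real n) ^ 2\<bar> \<le> K * (real N * ln (real N))"
    by (rule mangoldt_ln_sq_sum) (rule that)
  have l2: "1 / 2 \<le> ln (2 :: real)" using ln_le_minus_one[of "1 / 2 :: real"] by (simp add: ln_div)
  have l2': "ln (2 :: real) \<le> 1" using ln_le_minus_one[of "2 :: real"] by simp
  show ?thesis
  proof (rule that[of "3 * (K + 1)"])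
    fix N :: nat
    \<comment> \<open>At n = 1 the value of 1 / ln n would be 0 and break monotonicity; the
      \<open>max\<close> repairs this, and the term itself vanishes by ln 1 = 0.\<close>
    define f where "f = (\<lambda>n::nat. 1 / ln (real (max 2 n)))"
    have lnf: "ln (real (max 2 n)) \<ge> 1 / 2" for n :: nat
      using l2 ln_le_cancel_iff[of 2 "real (max 2 n)"] by linarith
    \<comment> \<open>The comparison terms 1 + ln n have partial sums of at least n * ln n, and
      after division by ln n they are at most 3. Passing from K to K + 1 covers n = 2, which the
      estimate with K does not reach.\<close>
    have "\<bar>\<Sum>n=1..N. ((mangoldt n - 1) * ln (real n) ^ 2) * f n\<bar> \<le> (K + 1) * (\<Sum>n=1..N. (1 + ln (real n)) * f n)"
    proof (rule abel_comparison)
      fix n assume "n \<le> N"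
      have ge: "real n * ln (real n) \<le> (\<Sum>j=1..n. 1 + ln (real j))" using sum_ln_ge[of n] by (simp add: sum.distrib)
      have ge0: "0 \<le> (\<Sum>j=1..n. 1 + ln (real j))" by (intro sum_nonneg) auto
      have s2: "sum F {1..n} = F 1 + F 2" if "n = 2" for F :: "nat \<Rightarrow> real"
        using that by (simp add: numeral_2_eq_2)
      consider "n \<le> 1" | "n = 2" | "n \<ge> 3" by linarith
      then show "\<bar>\<Sum>j=1..n. (mangoldt j - 1) * ln (real j) ^ 2\<bar> \<le> (K + 1) * (\<Sum>j=1..n. 1 + ln (real j))"
      proof cases
        case 1
        then have "(\<Sum>j=1..n. (mangoldt j - 1) * ln (real j) ^ 2) = 0" by (intro sum.neutral) auto
        then show ?thesis using K ge0 by simp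
      next
        case 2
        have "(\<Sum>j=1..n. (mangoldt j - 1) * ln (real j) ^ 2) = (ln 2 - 1) * ln 2 ^ 2"
          using s2[OF 2, of "\<lambda>j. (mangoldt j - 1) * ln (real j) ^ 2"] mangoldt_prime[of 2] by simp
        also have "\<bar>(ln 2 - 1) * ln 2 ^ 2 :: real\<bar> \<le> 1 * 1"
          unfolding abs_mult using l2 l2' by (intro mult_mono) (auto simp: power_le_one)
        also have "\<dots> \<le> (\<Sum>j=1..n. 1 + ln (real j))" using s2[OF 2, of "\<lambda>j. 1 + ln (real j)"] l2 by simp
        also have "\<dots> \<le> (K + 1) * (\<Sum>j=1..n. 1 + ln (real j))"
          using K ge0 mult_right_mono[of 1 "K + 1" "\<Sum>j=1..n. 1 + ln (real j)"] by simp
        finally show ?thesis .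
      next
        case 3
        have "\<bar>\<Sum>j=1..n. (mangoldt j - 1) * ln (real j) ^ 2\<bar> \<le> K * (real n * ln (real n))" by (rule K(2)[OF 3])
        also have "\<dots> \<le> (K + 1) * (\<Sum>j=1..n. 1 + ln (real j))" using K ge 3 by (intro mult_mono) auto
        finally show ?thesis .
      qed
    next
      fix n :: nat
      show "f (Suc n) \<le> f n" unfolding f_def using lnf[of n] lnf[of "Suc n"] by (intro divide_left_mono) auto
      show "f n \<ge> 0" unfolding f_def using lnf[of n] by simp
    qed
    also have "\<dots> \<le> (K + 1) * (\<Sum>n=1..N. 3)"
    proof (intro mult_left_mono sum_mono)
      fix n assume "n \<in> {1..N}"
      then have "ln (real n) \<le> ln (real (max 2 n))" by (subst ln_le_cancel_iff) auto
      then have "1 + ln (real n) \<le> 3 * ln (real (max 2 n))" using lnf[of n] by linarith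
      then show "(1 + ln (real n)) * f n \<le> 3" unfolding f_def using lnf[of n] by (simp add: divide_le_eq)
    qed (use K in auto)
    also have "(\<Sum>n=1..N. ((mangoldt n - 1) * ln (real n) ^ 2) * f n) = (\<Sum>n=1..N. (mangoldt n - 1) * ln (real n))"
    proof (intro sum.cong refl)
      fix n assume n: "n \<in> {1..N}"
      show "((mangoldt n - 1) * ln (real n) ^ 2) * f n = (mangoldt n - 1) * ln (real n)"
      proof (cases "n = 1")
        case False
        then have "max 2 n = n" "ln (real n) > 0" using n by auto
        then show ?thesis by (simp add: f_def power2_eq_square)
      qed simp
    qed
    finally show "\<bar>\<Sum>n=1..N. (mangoldt n - 1) * ln (real n)\<bar> \<le> 3 * (K + 1) * real N" by (simp add: mult_ac)
  qed
qed

text \<open>The difference \<Lambda>(n) * ln n - \<Lambda>(n)^2 is nonnegative and vanishes at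
  primes, so only proper prime powers contribute. There it is at most the squared logarithm of the
  prime power, which sums to O(N).\<close>

lemma mangoldt_sq_sum:
  obtains K where "\<And>N. \<bar>\<Sum>n=1..N. mangoldt_sq n - ln (real n)\<bar> \<le> K * real N"
proof -
  obtain K where K: "\<And>N. \<bar>\<Sum>n=1..N. (mangoldt n - 1) * ln (real n)\<bar> \<le> K * real N"
    by (rule mangoldt_ln_sum) (rule that)
  obtain C where C: "C \<ge> 0" "\<And>N h. (\<And>n p. n \<in> {1..N} \<Longrightarrow> prime p \<Longrightarrow> p ^ 2 dvd n \<Longrightarrow> h n \<le> ln (real (p ^ multiplicity p n)) ^ 2) \<Longrightarrow>
       (\<Sum>n\<in>nonsqfree N. h n) \<le> C * real N"
    using sum_nonsquarefree_le by blast
  define d :: "nat \<Rightarrow> real" where "d = (\<lambda>n. mangoldt n * ln (real n) - mangoldt_sq n)"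
  have d0: "d n \<ge> 0" if "n \<ge> 1" for n
    using that mangoldt_le[of n] mult_left_mono[OF mangoldt_le[of n] mangoldt_nonneg[of n]] by (simp add: d_def power2_eq_square)
  have dsq: "d n = 0" if "squarefree n" for n
  proof (cases "primepow n")
    case True
    then obtain p k where "prime p" "k > 0" "n = p ^ k" by (auto simp: primepow_def)
    then have "prime n" using that by (auto simp: squarefree_power_iff)
    then show ?thesis by (simp add: d_def power2_eq_square)
  qed (simp add: d_def mangoldt_def)
  show ?thesis
  proof (rule that[of "K + C"])
    fix N
    have "(\<Sum>n=1..N. d n) = (\<Sum>n\<in>nonsqfree N. d n)"
      unfolding sum_squarefree_split[of d N] using dsq by (simp add: sum.neutral)
    also have "\<dots> \<le> C * real N"
    proof (rule C(2))
      fix n p assume n: "n \<in> {1..N}" and p: "prime p" "p ^ 2 dvd n"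
      show "d n \<le> ln (real (p ^ multiplicity p n)) ^ 2"
      proof (cases "primepow n")
        case True
        then obtain q k where q: "prime q" "k > 0" "n = q ^ k" by (auto simp: primepow_def)
        have "p dvd q ^ k" using p(2) q(3) by (metis dvd_power dvd_trans pos2)
        then have "p = q" using p q by (metis prime_dvd_power primes_dvd_imp_eq)
        then have "p ^ multiplicity p n = n" using q by simp
        moreover have "d n \<le> mangoldt n * ln (real n)" by (simp add: d_def)
        moreover have "mangoldt n * ln (real n) \<le> ln (real n) * ln (real n)"
          using n by (intro mult_right_mono mangoldt_le) auto
        ultimately show ?thesis by (simp add: power2_eq_square)
      qed (simp add: d_def mangoldt_def)
    qed
    finally have "(\<Sum>n=1..N. d n) \<le> C * real N" .
    moreover have "(\<Sum>n=1..N. d n) \<ge> 0" by (intro sum_nonneg d0) auto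
    moreover have "(\<Sum>n=1..N. mangoldt_sq n - ln (real n)) = (\<Sum>n=1..N. (mangoldt n - 1) * ln (real n)) - (\<Sum>n=1..N. d n)"
      unfolding sum_subtractf [symmetric] by (intro sum.cong refl) (simp add: d_def algebra_simps)
    ultimately show "\<bar>\<Sum>n=1..N. mangoldt_sq n - ln (real n)\<bar> \<le> (K + C) * real N"
      using K[of N] by (simp only: distrib_right)
  qed
qed

section \<open>The correlation sums\<close>

lemma mangoldt_corr_off_diagonal:
  assumes "k > l" "l \<ge> 1"
  shows "mangoldt_corr k l \<in> O(\<lambda>x::real. x * ln x ^ (k + l - 2))"
proof -
  obtain C :: real where C: "C \<ge> 0"
    "\<And>x. x \<ge> 3 \<Longrightarrow> (\<Sum>n\<in>nonsqfree (nat \<lfloor>x\<rfloor>). mangoldt_pow k n * mangoldt_pow l n) \<le> C * (x * ln x ^ (k + l - 2))"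
    using assms by (rule_tac mangoldt_pow_corr_nonsquarefree[of k l]) (auto intro: that)
  show ?thesis
  proof (rule bigoI)
    show "eventually (\<lambda>x::real. norm (mangoldt_corr k l x) \<le> C * norm (x * ln x ^ (k + l - 2))) at_top"
      using eventually_ge_at_top[of 3]
    proof eventually_elim
      case (elim x)
      have "mangoldt_corr k l x = (\<Sum>n\<in>nonsqfree (nat \<lfloor>x\<rfloor>). mangoldt_pow k n * mangoldt_pow l n)"
        unfolding mangoldt_corr_def ge_1_le_eq_atLeastAtMost sum_squarefree_split[of _ "nat \<lfloor>x\<rfloor>"]
        using assms mangoldt_pow_mult_squarefree[of _ k l] by (simp add: sum.neutral)
      moreover have "\<dots> \<ge> 0" by (intro sum_nonneg mult_nonneg_nonneg mangoldt_pow_nonneg)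
      ultimately show ?case using C(2)[OF elim] elim by simp
    qed
  qed
qed

text \<open>On squarefree n the correlation is k! times the convolution power of \<Lambda>^2. Its
  sum over all n is known, and completing it costs the nonsquarefree part Q; the correlation itself
  has the nonsquarefree part P. Both are of the size of the error.\<close>

lemma mangoldt_corr_diagonal:
  assumes k: "k \<ge> 1" and w: "\<And>N. \<bar>\<Sum>n=1..N. mangoldt_sq n - ln (real n)\<bar> \<le> K * real N"
  shows "(\<lambda>x::real. mangoldt_corr k k x - fact k / fact (2 * k - 1) * x * ln x ^ (2 * k - 1))
              \<in> O(\<lambda>x::real. x * ln x ^ (2 * k - 2))"
proof -
  \<comment> \<open>Writing k as a successor removes the truncated subtraction from the exponents 2k
    - 1 and 2k - 2.\<close>
  obtain j where j: "k = Suc j" using k by (cases k) auto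
  obtain A :: real where A: "A \<ge> 0"
    "\<And>x. x \<ge> 3 \<Longrightarrow> (\<Sum>n\<in>nonsqfree (nat \<lfloor>x\<rfloor>). mangoldt_pow k n * mangoldt_pow k n) \<le> A * (x * ln x ^ (k + k - 2))"
    using k by (rule_tac mangoldt_pow_corr_nonsquarefree[of k k]) (auto intro: that)
  obtain B :: real where B: "B \<ge> 0"
    "\<And>x. x \<ge> 3 \<Longrightarrow> (\<Sum>n\<in>nonsqfree (nat \<lfloor>x\<rfloor>). conv_pow mangoldt_sq k n) \<le> B * (x * ln x ^ (2 * k - 2))"
    using k by (rule_tac mangoldt_sq_pow_nonsquarefree[of k]) (auto intro: that)
  obtain C where C: "C \<ge> 0" "\<And>x. x \<ge> 1 \<Longrightarrow> 
      \<bar>(\<Sum>n=1..nat \<lfloor>x\<rfloor>. conv_pow mangoldt_sq (Suc j) n) - x * ln x ^ (2 * j + 1) / fact (2 * j + 1)\<bar> \<le> C * x * (1 + ln x) ^ (2 * j)"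
    using sum_conv_pow_asymp[OF _ w, of j] by auto
  show ?thesis
  proof (rule bigoI)
    show "eventually (\<lambda>x::real. norm (mangoldt_corr k k x - fact k / fact (2 * k - 1) * x * ln x ^ (2 * k - 1))
       \<le> (A + fact k * B + fact k * (C * 2 ^ (2 * j))) * norm (x * ln x ^ (2 * k - 2))) at_top"
      using eventually_ge_at_top[of 3]
    proof eventually_elim
      case (elim x)
      have L: "ln x \<ge> 1" using elim by (rule ln_ge_1)
      let ?m = "x * ln x ^ (2 * j + 1) / fact (2 * j + 1)"
      define P where "P = (\<Sum>n\<in>nonsqfree (nat \<lfloor>x\<rfloor>). mangoldt_pow k n * mangoldt_pow k n)"
      define Q where "Q = (\<Sum>n\<in>nonsqfree (nat \<lfloor>x\<rfloor>). conv_pow mangoldt_sq k n)"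
      define W where "W = (\<Sum>n=1..nat \<lfloor>x\<rfloor>. conv_pow mangoldt_sq k n)"
      define V where "V = x * ln x ^ (2 * k - 2)"
      have e: "2 * k - 2 = 2 * j" "2 * k - 1 = 2 * j + 1" "k + k - 2 = 2 * k - 2" using j by auto
      have P0: "P \<ge> 0" unfolding P_def by (intro sum_nonneg mult_nonneg_nonneg mangoldt_pow_nonneg)
      have Q0: "Q \<ge> 0" unfolding Q_def by (intro sum_nonneg conv_pow_nonneg) auto
      have V0: "V \<ge> 0" unfolding V_def using L elim by simp
      have "mangoldt_corr k k x = (\<Sum>n | n \<in> {1..nat \<lfloor>x\<rfloor>} \<and> squarefree n. mangoldt_pow k n * mangoldt_pow k n) + P"
        unfolding mangoldt_corr_def ge_1_le_eq_atLeastAtMost sum_squarefree_split[of _ "nat \<lfloor>x\<rfloor>"] P_def by simp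
      also have "(\<Sum>n | n \<in> {1..nat \<lfloor>x\<rfloor>} \<and> squarefree n. mangoldt_pow k n * mangoldt_pow k n) =
                 (\<Sum>n | n \<in> {1..nat \<lfloor>x\<rfloor>} \<and> squarefree n. fact k * conv_pow mangoldt_sq k n)"
        by (intro sum.cong refl mangoldt_pow_sq_squarefree) auto
      also have "\<dots> = fact k * (W - Q)"
        unfolding W_def Q_def sum_squarefree_split[of _ "nat \<lfloor>x\<rfloor>"] by (simp add: sum_distrib_left)
      finally have eq: "mangoldt_corr k k x = fact k * (W - Q) + P" .
      have tri: "\<bar>a - q + p\<bar> \<le> u + v + w" if "\<bar>a\<bar> \<le> w" "q \<le> v" "0 \<le> q" "p \<le> u" "0 \<le> p" for a p q u v w :: real
        using that by linarith
      have "\<bar>W - ?m\<bar> \<le> C * x * (1 + ln x) ^ (2 * j)"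
        unfolding W_def j using elim by (intro C) auto
      also have "\<dots> \<le> C * x * (2 * ln x) ^ (2 * j)"
        using L elim C(1) by (intro mult_left_mono power_mono) auto
      also have "\<dots> = C * 2 ^ (2 * j) * V" unfolding V_def e by (simp add: power_mult_distrib)
      finally have "fact k * \<bar>W - ?m\<bar> \<le> fact k * (C * 2 ^ (2 * j) * V)"
        by (intro mult_left_mono) auto
      then have "\<bar>fact k * (W - ?m)\<bar> \<le> fact k * (C * 2 ^ (2 * j) * V)"
        by (simp only: abs_mult) simp
      moreover have "fact k * Q \<le> fact k * (B * V)" using B(2)[OF elim] unfolding Q_def V_def by (intro mult_left_mono) auto
      moreover have "fact k * Q \<ge> 0" using Q0 by simp
      moreover have "P \<le> A * V" using A(2)[OF elim] unfolding P_def V_def e .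
      moreover note P0
      ultimately have "\<bar>fact k * (W - ?m) - fact k * Q + P\<bar> \<le>
         A * V + fact k * (B * V) + fact k * (C * 2 ^ (2 * j) * V)"
        by (rule tri)
      moreover have "mangoldt_corr k k x - fact k / fact (2 * k - 1) * x * ln x ^ (2 * k - 1) = 
          fact k * (W - ?m) - fact k * Q + P"
        unfolding eq e(2) by (simp only: right_diff_distrib) (simp only: times_divide_eq_right times_divide_eq_left mult_ac diff_add_eq diff_diff_eq2)
      ultimately show ?case unfolding V_def[symmetric] real_norm_def abs_of_nonneg[OF V0]
        by (simp only: distrib_right distrib_left mult_ac)
    qed
  qed
qed

theorem theorem2:
  shows "(\<forall>k l :: nat. k > l \<and> l \<ge> 1 \<longrightarrow>
            mangoldt_corr k l \<in> O(\<lambda>x::real. x * ln x ^ (k + l - 2))) \<and>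
         (\<forall>k :: nat. k \<ge> 1 \<longrightarrow>
            (\<lambda>x::real. mangoldt_corr k k x - fact k / fact (2 * k - 1) * x * ln x ^ (2 * k - 1))
              \<in> O(\<lambda>x::real. x * ln x ^ (2 * k - 2)))"
proof -
  obtain K where K: "\<And>N. \<bar>\<Sum>n=1..N. mangoldt_sq n - ln (real n)\<bar> \<le> K * real N"
    by (rule mangoldt_sq_sum) (rule that)
  show ?thesis by (intro conjI allI impI mangoldt_corr_off_diagonal mangoldt_corr_diagonal[OF _ K]) auto
qed

end
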